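(* Let $K$ be a field of characteristic $0$ with algebraic closure $\overline K$, and let $I\subset K[X]=K[x_1,x_2,\dots]$ be a homogeneous symmetric ideal, with $I_n=I\cap K[x_1,\dots,x_n]$. Suppose $\overline K$ is uncountable. If there exist positive integers $p,q$ such that \[ V_{\overline K}(I)\subset \Delta_p\cup H_q, \] where \[ \Delta_p=\{(a_1,a_2,\dots)\in\mathbb A^\infty_{\overline K}\mid a_i^p=a_j^p\text{ for all }i,j\}, \qquad H_q=\bigcup_{\sigma\in\mathrm{Sym}(\infty)}\sigma\big(\{(a_1,\dots,a_q,0,0,\dots)\mid a_1,\dots,a_q\in\overline K\}\big), \] then the coefficientwise limit $\lim_{n\to\infty}H\big((K[X_n]/I_n)^{\mathrm{Sym}};t\big)$ exists and is a rational function of $t$.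
   Context: $K[X]=K[x_i\mid i\ge1]$ is graded by degree and $K[X_n]=K[x_1,\dots,x_n]$. $\mathrm{Sym}(\infty)=\bigcup_{n\ge1}\mathrm{Sym}(n)$ acts on $K[X]$ by $\sigma\cdot x_i=x_{\sigma(i)}$; an ideal is symmetric if it is stable under this action. $\mathbb A^\infty_{\overline K}$ is the set of all sequences $(a_1,a_2,\dots)$ with entries in $\overline K$, on which $\mathrm{Sym}(\infty)$ acts by permuting coordinates; $V_{\overline K}(I)$ is the set of points of $\mathbb A^\infty_{\overline K}$ at which all elements of $I$ vanish. $(K[X_n]/I_n)^{\mathrm{Sym}}$ denotes the graded subspace of $\mathrm{Sym}(n)$-invariants, and $H(M;t)=\sum_{d\ge0}\dim_K[M]_d\,t^d$ is the Hilbert series. *)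

theory Defs
  imports
    "HOL-Library.Poly_Mapping"
    "HOL-Library.Countable_Set"
    "HOL-Combinatorics.Permutations"
    "HOL-Computational_Algebra.Polynomial_FPS"
    "HOL-Algebra.QuotRing"
    "HOL-Algebra.Embedded_Algebras"
    "HOL-Algebra.Algebraic_Closure_Type"
begin

(* K[x_1, x_2, ...]: a monomial is a finitely supported exponent function, a polynomial a finitely
   supported coefficient function on monomials.  Variables and coordinates are indexed from 0
   throughout: index i stands for x_{i+1} and for the (i+1)-st coordinate of a point, so that
   K[X_n] and Sym(n) are about the indices in {..<n}. *)
type_synonym 'a inf_poly = "(nat \<Rightarrow>\<^sub>0 nat) \<Rightarrow>\<^sub>0 'a"

definition const :: "'a::zero \<Rightarrow> 'a inf_poly" where
  "const c = Poly_Mapping.single 0 c"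

definition var :: "nat \<Rightarrow> 'a::zero_neq_one inf_poly" where
  "var i = Poly_Mapping.single (Poly_Mapping.single i 1) 1"

(* Coefficients are mapped by \<phi>, the variable with index i is replaced by a i. *)
definition eval_poly :: "('a::zero \<Rightarrow> 'b::comm_semiring_1) \<Rightarrow> (nat \<Rightarrow> 'b) \<Rightarrow> 'a inf_poly \<Rightarrow> 'b" where
  "eval_poly \<phi> a f =
     (\<Sum>m\<in>Poly_Mapping.keys f. \<phi> (Poly_Mapping.lookup f m) *
        (\<Prod>i\<in>Poly_Mapping.keys m. a i ^ Poly_Mapping.lookup m i))"

definition mon_degree :: "(nat \<Rightarrow>\<^sub>0 nat) \<Rightarrow> nat" where
  "mon_degree m = (\<Sum>i\<in>Poly_Mapping.keys m. Poly_Mapping.lookup m i)"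

(* The zero polynomial is homogeneous of every degree. *)
definition homogeneous :: "nat \<Rightarrow> 'a::zero inf_poly \<Rightarrow> bool" where
  "homogeneous d f \<longleftrightarrow> (\<forall>m\<in>Poly_Mapping.keys f. mon_degree m = d)"

definition homogeneous_part :: "nat \<Rightarrow> 'a::comm_monoid_add inf_poly \<Rightarrow> 'a inf_poly" where
  "homogeneous_part d f =
     (\<Sum>m | m \<in> Poly_Mapping.keys f \<and> mon_degree m = d.
        Poly_Mapping.single m (Poly_Mapping.lookup f m))"

definition homogeneous_ideal :: "'a::comm_ring_1 inf_poly set \<Rightarrow> bool" where
  "homogeneous_ideal I \<longleftrightarrow>
     ideal I ring_of_type_algebra \<and> (\<forall>f\<in>I. \<forall>d. homogeneous_part d f \<in> I)"

definition Sym :: "nat \<Rightarrow> (nat \<Rightarrow> nat) set" where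
  "Sym n = {\<sigma>. \<sigma> permutes {..<n}}"

definition Sym_inf :: "(nat \<Rightarrow> nat) set" where
  "Sym_inf = (\<Union>n. Sym n)"

definition perm_poly :: "(nat \<Rightarrow> nat) \<Rightarrow> 'a::comm_semiring_1 inf_poly \<Rightarrow> 'a inf_poly" where
  "perm_poly \<sigma> = eval_poly const (\<lambda>i. var (\<sigma> i))"

lemma perm_poly_var: "perm_poly \<sigma> (var i :: 'a::comm_semiring_1 inf_poly) = var (\<sigma> i)"
  by (simp add: perm_poly_def eval_poly_def const_def var_def)

definition symmetric_ideal :: "'a::comm_ring_1 inf_poly set \<Rightarrow> bool" where
  "symmetric_ideal I \<longleftrightarrow>
     ideal I ring_of_type_algebra \<and> (\<forall>\<sigma>\<in>Sym_inf. \<forall>f\<in>I. perm_poly \<sigma> f \<in> I)"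

definition zero_locus :: "'a::field inf_poly set \<Rightarrow> (nat \<Rightarrow> 'a alg_closure) set" where
  "zero_locus I = {a. \<forall>f\<in>I. eval_poly to_ac a f = 0}"

definition Delta_set :: "nat \<Rightarrow> (nat \<Rightarrow> 'b::field) set" where
  "Delta_set p = {a. \<forall>i j. a i ^ p = a j ^ p}"

(* \<sigma> moves the entry at index i to index \<sigma> i. *)
definition H_set :: "nat \<Rightarrow> (nat \<Rightarrow> 'b::field) set" where
  "H_set q = (\<Union>\<sigma>\<in>Sym_inf. (\<lambda>a. a \<circ> inv_into UNIV \<sigma>) ` {a. \<forall>i\<ge>q. a i = 0})"

definition polys_in :: "nat \<Rightarrow> 'a::zero inf_poly set" where
  "polys_in n = {f. \<forall>m\<in>Poly_Mapping.keys f. Poly_Mapping.keys m \<subseteq> {..<n}}"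

definition poly_ring :: "nat \<Rightarrow> 'a::comm_ring_1 inf_poly ring" where
  "poly_ring n = ring_of_type_algebra \<lparr>carrier := polys_in n\<rparr>"

definition trunc :: "'a::zero inf_poly set \<Rightarrow> nat \<Rightarrow> 'a inf_poly set" where
  "trunc I n = I \<inter> polys_in n"

definition quot :: "'a::comm_ring_1 inf_poly set \<Rightarrow> nat \<Rightarrow> 'a inf_poly set ring" where
  "quot I n = poly_ring n Quot trunc I n"

definition scalars :: "'a::comm_ring_1 inf_poly set \<Rightarrow> nat \<Rightarrow> 'a inf_poly set set" where
  "scalars I n = (\<lambda>c. trunc I n +>\<^bsub>poly_ring n\<^esub> const c) ` UNIV"

definition quot_graded :: "'a::comm_ring_1 inf_poly set \<Rightarrow> nat \<Rightarrow> nat \<Rightarrow> 'a inf_poly set set" where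
  "quot_graded I n d =
     (\<lambda>f. trunc I n +>\<^bsub>poly_ring n\<^esub> f) ` {f \<in> polys_in n. homogeneous d f}"

(* For a symmetric ideal, \<sigma> in Sym(n) sends the coset of f to the coset of \<sigma> f, which is its
   elementwise image. *)
definition quot_invariants :: "'a::comm_ring_1 inf_poly set \<Rightarrow> nat \<Rightarrow> 'a inf_poly set set" where
  "quot_invariants I n = {C \<in> carrier (quot I n). \<forall>\<sigma>\<in>Sym n. perm_poly \<sigma> ` C = C}"

(* K acts on the quotient through the image of the constant polynomials.  If the quotient is the
   zero ring, this image is not a subfield, but the dimension is still 0, as it should be. *)
definition hilbert_series_invariants :: "'a::field inf_poly set \<Rightarrow> nat \<Rightarrow> int fps" where
  "hilbert_series_invariants I n =
     Abs_fps (\<lambda>d. int (ring.dim (quot I n) (scalars I n) (quot_invariants I n \<inter> quot_graded I n d)))"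

(* Cross-multiplied, since division in the type of formal power series truncates when the
   denominator has zero constant term.  Integer and rational coefficients of the two polynomials
   give the same notion. *)
definition rational_fps :: "int fps \<Rightarrow> bool" where
  "rational_fps F \<longleftrightarrow> (\<exists>P Q :: int poly. Q \<noteq> 0 \<and> fps_of_poly Q * F = fps_of_poly P)"

end

theory Submission
  imports Defs "HOL-Library.Multiset_Order"
begin

text \<open>
  In characteristic 0 the invariants of \<open>K[X_n]/I_n\<close> are its coinvariants, and for \<open>n \<ge> d\<close> the degree \<open>d\<close>
  coinvariants of \<open>K[X_n]\<close> have the partitions of \<open>d\<close> as a basis. The images of the \<open>I_n\<close> there increase with
  \<open>n\<close>, so the dimensions become stationary, and the limit counts the partitions that are not leading for \<open>I\<close>,
  with respect to any total order of the partitions.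

  A Nullstellensatz over the uncountable field gives \<open>(x_0^p - x_1^p)^k x_2^k \<dots> x_{q+2}^k \<in> I\<close> for some
  \<open>k > 0\<close>. Call a part large if it is at least \<open>k\<close>, and let the leading partition be one with the fewest large parts,
  ties being broken by the multiset order. Leading partitions are closed under adding parts (multiply by a power of
  a fresh variable) and under raising the \<open>i\<close> largest parts by \<open>k\<close> if these are large (multiply by the \<open>i\<close>-th
  elementary symmetric polynomial in the \<open>x_j^k\<close>). The displayed element of \<open>I\<close> makes every partition with
  at least \<open>q + 2\<close> large parts leading once one of its parts is at least \<open>k + p k\<close>. Hence the nonleading
  partitions fall into the classes with \<open>0, \<dots>, q + 1\<close> large parts and a class with bounded parts. In suitable
  coordinates each class is a difference of two subsets of \<open>\<nat>^r\<close> that are closed under adding \<open>M e_i\<close>, and such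
  subsets have rational generating functions by a Dickson type argument.
\<close>

section \<open>Rational generating functions\<close>

text \<open>The coinvariants carry no product, so the leading partitions form no ideal. They inherit
  only multiplications with a predictable effect on shapes: by a fresh variable, or by a symmetric
  polynomial after symmetrizing. One number \<open>k\<close> is the exponent from the
  Nullstellensatz, the threshold for large parts and the amount of raising. Raising by
  \<open>k\<close> makes every raised part large; hitting a small part thus increases the number of
  large parts and falls in the order, while raising large parts keeps that number. Fixing the number
  of large parts makes the number of coordinates finite. Without a bound on that number there would
  be infinitely many classes; there the element of \<open>I\<close> caps the parts instead. It has q
  + 1 variables besides x_0 and x_1 because points of H_q have at most q nonzero coordinates.
  Uncountability is played off against the countable set of monomials: it forces each variable to be
  constant modulo a suitable ideal. Characteristic 0 makes n! and the numbers of coinciding terms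
  nonzero.\<close>

definition gf :: "('x \<Rightarrow> nat) \<Rightarrow> 'x set \<Rightarrow> int fps" where
  "gf w Z = Abs_fps (\<lambda>d. int (card {x \<in> Z. w x = d}))"

lemma gf_nth: "fps_nth (gf w Z) d = int (card {x \<in> Z. w x = d})"
  by (simp add: gf_def)

lemma gf_empty [simp]: "gf w {} = 0"
  by (rule fps_ext) (simp add: gf_nth)

text \<open>\<open>card\<close> of an infinite set is 0, so additivity of \<open>gf\<close> needs
  finite fibres. \<open>gf_image\<close> does not: an injection preserves \<open>card\<close> of
  infinite sets too.\<close>

lemma gf_Un_disjoint:
  assumes "\<And>d. finite {x \<in> Z. w x = d}" "\<And>d. finite {x \<in> Y. w x = d}" "Z \<inter> Y = {}"
  shows "gf w (Z \<union> Y) = gf w Z + gf w Y"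
proof (rule fps_ext)
  fix d
  have "{x \<in> Z \<union> Y. w x = d} = {x \<in> Z. w x = d} \<union> {x \<in> Y. w x = d}" by auto
  moreover have "{x \<in> Z. w x = d} \<inter> {x \<in> Y. w x = d} = {}" using assms(3) by auto
  ultimately show "fps_nth (gf w (Z \<union> Y)) d = fps_nth (gf w Z + gf w Y) d"
    by (simp add: gf_nth card_Un_disjoint assms)
qed

lemma gf_Diff:
  assumes "\<And>d. finite {x \<in> Z. w x = d}" "Y \<subseteq> Z"
  shows "gf w (Z - Y) = gf w Z - gf w Y"
proof -
  have "gf w ((Z - Y) \<union> Y) = gf w (Z - Y) + gf w Y"
    by (rule gf_Un_disjoint; (rule finite_subset[OF _ assms(1)])?) (use assms(2) in auto)
  moreover have "(Z - Y) \<union> Y = Z" using assms(2) by auto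
  ultimately show ?thesis by simp
qed

lemma gf_UN_disjoint:
  assumes "finite A" "\<And>a d. a \<in> A \<Longrightarrow> finite {x \<in> Z a. w x = d}"
    "\<And>a b. a \<in> A \<Longrightarrow> b \<in> A \<Longrightarrow> a \<noteq> b \<Longrightarrow> Z a \<inter> Z b = {}"
  shows "gf w (\<Union>a\<in>A. Z a) = (\<Sum>a\<in>A. gf w (Z a))"
  using assms
proof (induction A)
  case empty
  then show ?case by simp
next
  case (insert a A)
  have fin: "finite {x \<in> \<Union> (Z ` A). w x = d}" for d
  proof -
    have "{x \<in> \<Union> (Z ` A). w x = d} = (\<Union>a\<in>A. {x \<in> Z a. w x = d})" by auto
    then show ?thesis using insert by simp
  qed
  have dis: "Z a \<inter> \<Union> (Z ` A) = {}"
    using insert.hyps(2) insert.prems(2) by fastforce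
  have "gf w (Z a \<union> \<Union> (Z ` A)) = gf w (Z a) + gf w (\<Union> (Z ` A))"
    by (rule gf_Un_disjoint[OF _ fin dis]) (use insert.prems in auto)
  moreover have "gf w (\<Union> (Z ` A)) = (\<Sum>a\<in>A. gf w (Z a))"
    by (rule insert.IH) (use insert.prems in auto)
  ultimately show ?case using insert.hyps by simp
qed

lemma gf_image:
  assumes "inj_on f Z" "\<And>x. x \<in> Z \<Longrightarrow> w' (f x) = w x + c"
  shows "gf w' (f ` Z) = fps_X ^ c * gf w Z"
proof (rule fps_ext)
  fix d
  have eq: "{y \<in> f ` Z. w' y = d} = f ` {x \<in> Z. w x + c = d}" using assms(2) by force
  have "card {y \<in> f ` Z. w' y = d} = card {x \<in> Z. w x + c = d}"
    unfolding eq by (rule card_image) (use assms(1) in \<open>auto simp: inj_on_def\<close>)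
  also have "\<dots> = (if d < c then 0 else card {x \<in> Z. w x = d - c})"
    by (auto intro: arg_cong[where f = card])
  finally show "fps_nth (gf w' (f ` Z)) d = fps_nth (fps_X ^ c * gf w Z) d"
    by (simp add: gf_nth fps_X_power_mult_nth)
qed

section \<open>Closure properties of rational power series\<close>

lemma rational_fps_0 [simp]: "rational_fps 0"
  unfolding rational_fps_def by (intro exI[of _ 0] exI[of _ 1]) simp

lemma rational_fps_of_poly: "rational_fps (fps_of_poly P)"
  unfolding rational_fps_def by (intro exI[of _ P] exI[of _ 1]) simp

lemma rational_fps_add:
  assumes "rational_fps F" "rational_fps G" shows "rational_fps (F + G)"
proof -
  obtain P Q where 1: "Q \<noteq> 0" "fps_of_poly Q * F = fps_of_poly P"
    using assms(1) unfolding rational_fps_def by auto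
  obtain P' Q' where 2: "Q' \<noteq> 0" "fps_of_poly Q' * G = fps_of_poly P'"
    using assms(2) unfolding rational_fps_def by auto
  have "fps_of_poly (Q * Q') * (F + G)
      = fps_of_poly Q' * (fps_of_poly Q * F) + fps_of_poly Q * (fps_of_poly Q' * G)"
    by (simp add: fps_of_poly_mult algebra_simps)
  also have "\<dots> = fps_of_poly (Q' * P + Q * P')"
    by (simp add: 1 2 fps_of_poly_mult fps_of_poly_add)
  finally show ?thesis unfolding rational_fps_def using 1 2 by (metis no_zero_divisors)
qed

lemma rational_fps_mult:
  assumes "rational_fps F" "rational_fps G" shows "rational_fps (F * G)"
proof -
  obtain P Q where 1: "Q \<noteq> 0" "fps_of_poly Q * F = fps_of_poly P"
    using assms(1) unfolding rational_fps_def by auto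
  obtain P' Q' where 2: "Q' \<noteq> 0" "fps_of_poly Q' * G = fps_of_poly P'"
    using assms(2) unfolding rational_fps_def by auto
  have "fps_of_poly (Q * Q') * (F * G) = (fps_of_poly Q * F) * (fps_of_poly Q' * G)"
    by (simp add: fps_of_poly_mult algebra_simps)
  also have "\<dots> = fps_of_poly (P * P')"
    by (simp add: 1 2 fps_of_poly_mult)
  finally show ?thesis unfolding rational_fps_def using 1 2 by (metis no_zero_divisors)
qed

lemma rational_fps_cancel:
  assumes "Q \<noteq> 0" "rational_fps (fps_of_poly Q * F)" shows "rational_fps F"
proof -
  obtain P Q' where 1: "Q' \<noteq> 0" "fps_of_poly Q' * (fps_of_poly Q * F) = fps_of_poly P"
    using assms(2) unfolding rational_fps_def by auto
  then have "fps_of_poly (Q' * Q) * F = fps_of_poly P"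
    by (simp add: fps_of_poly_mult mult.assoc)
  then show ?thesis unfolding rational_fps_def using 1 assms(1) by (metis no_zero_divisors)
qed

lemma rational_fps_X_power: "rational_fps (fps_X ^ n)"
  using rational_fps_of_poly[of "monom 1 n"] by (simp add: fps_of_poly_monom')

lemma rational_fps_diff:
  assumes "rational_fps F" "rational_fps G" shows "rational_fps (F - G)"
proof -
  have "rational_fps (fps_of_poly [:-1:] * G)"
    by (rule rational_fps_mult[OF rational_fps_of_poly assms(2)])
  moreover have "fps_of_poly [:-1:] * G = - G"
    by (simp add: fps_of_poly_const flip: fps_const_neg)
  ultimately show ?thesis using rational_fps_add[OF assms(1)] by fastforce
qed

lemma rational_fps_sum:
  assumes "\<And>a. a \<in> A \<Longrightarrow> rational_fps (F a)" shows "rational_fps (\<Sum>a\<in>A. F a)"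
  using assms by (induction A rule: infinite_finite_induct) (auto intro: rational_fps_add)

text \<open>For \<open>M > 0\<close>, sorting by the residues of the entries modulo \<open>M\<close>
  cuts \<open>U\<close> into up-sets of \<nat>^r, the exponent sets of monomial ideals.\<close>

definition shift_closed :: "nat \<Rightarrow> nat \<Rightarrow> nat list set \<Rightarrow> bool" where
  "shift_closed M r U \<longleftrightarrow>
     (\<forall>xs\<in>U. length xs = r \<and> (\<forall>i<r. xs[i := xs ! i + M] \<in> U))"

definition slice :: "nat list set \<Rightarrow> nat \<Rightarrow> nat list set" where
  "slice U j = {ys. j # ys \<in> U}"

lemma shift_closed_slice:
  assumes "shift_closed M (Suc r) U" shows "shift_closed M r (slice U j)"
  using assms unfolding shift_closed_def slice_def by fastforce

lemma slice_mono: "U \<subseteq> V \<Longrightarrow> slice U j \<subseteq> slice V j"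
  by (auto simp: slice_def)

lemma slice_shift:
  assumes "shift_closed M (Suc r) U" shows "slice U j \<subseteq> slice U (j + s * M)"
proof (induction s)
  case (Suc s)
  have "slice U i \<subseteq> slice U (i + M)" for i
    using assms unfolding shift_closed_def slice_def by fastforce
  from this[of "j + s * M"] show ?case using Suc by (simp add: algebra_simps)
qed simp

text \<open>Noetherianity by diagonalization: in each residue class the slices increase both with \<open>t\<close> and with
  their position, so stability along the diagonal bounds all but finitely many slices.\<close>

lemma shift_closed_acc:
  assumes "M > 0" "\<And>t. shift_closed M r (A t)" "\<And>t. A t \<subseteq> A (Suc t)"
  shows "\<exists>N. \<forall>t\<ge>N. A t = A N"
  using assms(2,3)
proof (induction r arbitrary: A)
  case 0
  have sub: "A t \<subseteq> {[]}" for t using 0(1)[of t] by (auto simp: shift_closed_def)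
  have mono: "s \<le> t \<Longrightarrow> A s \<subseteq> A t" for s t using 0(2) by (rule lift_Suc_mono_le)
  show ?case
  proof (cases "\<exists>t. A t \<noteq> {}")
    case True
    then obtain N where "A N \<noteq> {}" by auto
    then have "A t = {[]}" if "t \<ge> N" for t using sub mono[OF that] by blast
    then show ?thesis by (metis order_refl)
  qed (use sub in auto)
next
  case (Suc r)
  have mono: "s \<le> t \<Longrightarrow> A s \<subseteq> A t" for s t using Suc.prems(2) by (rule lift_Suc_mono_le)
  have smono: "slice (A s) (c + i * M) \<subseteq> slice (A t) (c + j * M)"
    if st: "s \<le> t" and ij: "i \<le> j" for s t c i j
  proof -
    obtain l where l: "j = i + l" using ij le_Suc_ex by blast
    have "slice (A s) (c + i * M) \<subseteq> slice (A t) (c + i * M)" by (rule slice_mono[OF mono[OF st]])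
    also have "\<dots> \<subseteq> slice (A t) (c + i * M + l * M)" by (rule slice_shift[OF Suc.prems(1)])
    finally show ?thesis by (simp add: l algebra_simps)
  qed
  \<comment> \<open>The diagonal chain in residue class \<open>c\<close>: it increases by
    \<open>smono\<close>, and its members have one coordinate less.\<close>
  have "\<exists>N. \<forall>t\<ge>N. slice (A t) (c + t * M) = slice (A N) (c + N * M)" for c
    using Suc.IH[of "\<lambda>t. slice (A t) (c + t * M)", OF shift_closed_slice[OF Suc.prems(1)] smono]
    by simp
  then obtain T where T: "\<And>c t. t \<ge> T c \<Longrightarrow> slice (A t) (c + t * M) = slice (A (T c)) (c + T c * M)"
    by metis
  have "\<exists>N. \<forall>t\<ge>N. slice (A t) j = slice (A N) j" for j
    by (rule Suc.IH[of "\<lambda>t. slice (A t) j"])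
      (auto intro: shift_closed_slice Suc.prems(1) subsetD[OF slice_mono[OF Suc.prems(2)]])
  then obtain S where S: "\<And>j t. t \<ge> S j \<Longrightarrow> slice (A t) j = slice (A (S j)) j"
    by metis
  \<comment> \<open>\<open>T'\<close> serves all residue classes. Positions from \<open>J\<close> on
    have quotient by \<open>M\<close> beyond \<open>T'\<close> and are settled together by
    \<open>big\<close>; the finitely many below \<open>J\<close> are settled one by one through
    \<open>S\<close>.\<close>
  define T' where "T' = Max (T ` {..<M})"
  define J where "J = Suc T' * M"
  define N where "N = max T' (Max (S ` {..<J}))"
  have T': "T c \<le> T'" if "c < M" for c using that by (auto simp: T'_def)
  have N: "S j \<le> N" if "j < J" for j
    using that by (auto simp: N_def max_def intro: order_trans[OF Max_ge[of "S ` {..<J}" "S j"]])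
  \<comment> \<open>The slice is squeezed between the diagonal members at \<open>T c\<close> and at
    \<open>max t s\<close>, which agree.\<close>
  have big: "slice (A t) (c + s * M) = slice (A (T c)) (c + T c * M)"
    if "c < M" "T' \<le> t" "T' \<le> s" for c t s
  proof -
    have Tc: "T c \<le> t" "T c \<le> s" using T'[OF that(1)] that by auto
    have "slice (A (T c)) (c + T c * M) \<subseteq> slice (A t) (c + s * M)" by (rule smono[OF Tc])
    moreover have "slice (A t) (c + s * M) \<subseteq> slice (A (max t s)) (c + max t s * M)"
      by (rule smono) auto
    ultimately show ?thesis using T[of c "max t s"] Tc by auto
  qed
  have eq: "slice (A t) j = slice (A N) j" if t: "t \<ge> N" for t j
  proof (cases "j < J")
    case True
    then show ?thesis using S[of j t] S[of j N] N[OF True] t by simp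
  next
    case False
    define c s where "c = j mod M" and "s = j div M"
    have j: "j = c + s * M" by (simp add: c_def s_def)
    have c: "c < M" using assms(1) by (simp add: c_def)
    have "Suc T' \<le> s" unfolding s_def
      using False assms(1) unfolding J_def by (simp add: less_eq_div_iff_mult_less_eq)
    then show ?thesis using big[OF c, of t s] big[OF c, of N s] t by (simp add: j N_def)
  qed
  have "A t = A N" if "t \<ge> N" for t
  proof -
    have "xs \<in> A t \<longleftrightarrow> xs \<in> A N" for xs
    proof (cases xs)
      case Nil
      then show ?thesis using Suc.prems(1)[of t] Suc.prems(1)[of N] by (auto simp: shift_closed_def)
    next
      case (Cons j ys)
      then show ?thesis using eq[OF that, of j] by (auto simp: slice_def set_eq_iff)
    qed
    then show ?thesis by blast
  qed
  then show ?case by blast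
qed

definition weight :: "nat list \<Rightarrow> nat list \<Rightarrow> nat" where
  "weight ws xs = sum_list (map2 (*) ws xs)"

lemma weight_Cons [simp]: "weight (w # ws) (x # xs) = w * x + weight ws xs"
  by (simp add: weight_def)

lemma finite_weight:
  assumes "\<forall>w\<in>set ws. w > 0"
  shows "finite {xs. length xs = length ws \<and> weight ws xs = d}"
proof (rule finite_subset)
  have "xs ! i \<le> weight ws xs" if "length xs = length ws" "i < length xs" for xs i
    using that assms
  proof (induction ws arbitrary: xs i)
    case (Cons w ws)
    then obtain x ys where xs: "xs = x # ys" by (cases xs) auto
    show ?case
    proof (cases i)
      case 0
      have "1 * x \<le> w * x" using Cons.prems(3) by (intro mult_right_mono) auto
      then show ?thesis using 0 by (simp add: xs trans_le_add1)
    next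
      case (Suc i')
      then show ?thesis using Cons.IH[of ys i'] Cons.prems by (simp add: xs trans_le_add2)
    qed
  qed simp
  then show "{xs. length xs = length ws \<and> weight ws xs = d}
      \<subseteq> {xs. set xs \<subseteq> {..d} \<and> length xs = length ws}"
    by (auto simp: in_set_conv_nth)
  show "finite {xs. set xs \<subseteq> {..d} \<and> length xs = length ws}"
    by (rule finite_lists_length_eq) simp
qed

text \<open>Shifting the first entry by \<open>M\<close> maps \<open>U\<close> injectively into
  itself and multiplies the series by X^(wM). Since slices stabilize in each residue class, what the
  shift misses lies in finitely many layers of constant first entry, each a difference of slices and
  rational by induction. Hence (1 - X^(wM)) times the series is rational.\<close>

theorem rational_gf_shift_closed:
  assumes "M > 0" "\<forall>w\<in>set ws. w > 0" "shift_closed M (length ws) U"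
  shows "rational_fps (gf (weight ws) U)"
  using assms(2,3)
proof (induction ws arbitrary: U)
  case Nil
  then have "U = {} \<or> U = {[]}" by (auto simp: shift_closed_def)
  moreover have "gf (weight []) {[]} = 1"
    by (rule fps_ext) (simp add: gf_nth weight_def)
  moreover have "rational_fps 1" using rational_fps_of_poly[of 1] by simp
  ultimately show ?case by auto
next
  case (Cons w ws)
  let ?r = "length ws"
  have sc: "shift_closed M (Suc ?r) U" using Cons.prems(2) by simp
  have len: "length xs = Suc ?r" if "xs \<in> U" for xs using sc that by (auto simp: shift_closed_def)
  have scs: "shift_closed M ?r (slice U j)" for j by (rule shift_closed_slice[OF sc])
  have fin: "finite {xs \<in> Z. weight (w # ws) xs = d}" if "Z \<subseteq> U" for Z d
    by (rule finite_subset[OF _ finite_weight[OF Cons.prems(1), of d]]) (use that len in auto)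
  have fins: "finite {xs \<in> Z. weight ws xs = d}" if "Z \<subseteq> slice U j" for Z d j
    by (rule finite_subset[OF _ finite_weight[of ws d]])
      (use that scs[of j] Cons.prems(1) in \<open>auto simp: shift_closed_def\<close>)
  have "\<exists>N. \<forall>t\<ge>N. slice U (c + t * M) = slice U (c + N * M)" for c
    by (rule shift_closed_acc[OF assms(1), of ?r "\<lambda>t. slice U (c + t * M)"])
      (rule scs, use slice_shift[OF sc, of "c + _ * M" 1] in \<open>simp add: algebra_simps\<close>)
  then obtain T where T: "\<And>c t. t \<ge> T c \<Longrightarrow> slice U (c + t * M) = slice U (c + T c * M)"
    by metis
  \<comment> \<open>The margin 2 puts both quotients \<open>s\<close> and \<open>s - 1\<close> of
    any \<open>j \<ge> N\<close> past \<open>T c\<close> and makes \<open>j - M\<close> a genuine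
    subtraction.\<close>
  define N where "N = (2 + Max (T ` {..<M})) * M"
  have stable: "slice U j = slice U (j - M)" if "j \<ge> N" for j
  proof -
    define c s where "c = j mod M" and "s = j div M"
    have j: "j = c + s * M" by (simp add: c_def s_def)
    have c: "c < M" using assms(1) by (simp add: c_def)
    have "2 + Max (T ` {..<M}) \<le> s" unfolding s_def
      using that assms(1) unfolding N_def by (simp add: less_eq_div_iff_mult_less_eq)
    moreover have "T c \<le> Max (T ` {..<M})" using c by auto
    ultimately have s: "T c \<le> s - 1" "s \<ge> 1" by auto
    then have "j - M = c + (s - 1) * M" by (simp add: j algebra_simps diff_mult_distrib)
    then show ?thesis using T[of c s] T[of c "s - 1"] s by (simp add: j)
  qed
  define sh where "sh = (\<lambda>xs :: nat list. (hd xs + M) # tl xs)"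
  \<comment> \<open>The tails that are new at first entry \<open>j\<close>. Below \<open>M\<close>
    there is no earlier layer, and the truncated \<open>j - M\<close> would wrongly name layer
    0.\<close>
  define D where "D j = (if j < M then slice U j else slice U j - slice U (j - M))" for j
  define E where "E j = (#) j ` D j" for j
  have shU: "sh ` U \<subseteq> U"
  proof
    fix y assume "y \<in> sh ` U"
    then obtain xs where xs: "xs \<in> U" "y = sh xs" by auto
    obtain j ys where j: "xs = j # ys" using len[OF xs(1)] by (cases xs) auto
    show "y \<in> U" using slice_shift[OF sc, of j 1] xs by (auto simp: j sh_def slice_def)
  qed
  have inj: "inj_on sh U"
  proof (rule inj_onI)
    fix xs ys assume "xs \<in> U" "ys \<in> U" "sh xs = sh ys"
    then show "xs = ys" using len[of xs] len[of ys] by (cases xs; cases ys) (auto simp: sh_def)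
  qed
  have diff: "U - sh ` U = (\<Union>j<N. E j)"
  proof (intro equalityI subsetI)
    fix xs assume xs: "xs \<in> U - sh ` U"
    obtain j ys where j: "xs = j # ys" using len[of xs] xs by (cases xs) auto
    have nin: "ys \<notin> slice U (j - M)" if "j \<ge> M"
    proof
      assume "ys \<in> slice U (j - M)"
      then have "sh ((j - M) # ys) \<in> sh ` U" by (auto simp: slice_def)
      then show False using xs that by (simp add: sh_def j)
    qed
    have ys: "ys \<in> slice U j" using xs by (simp add: slice_def j)
    have "j < N"
    proof (rule ccontr)
      assume "\<not> j < N"
      then have "j \<ge> N" by simp
      moreover have "M \<le> N" by (simp add: N_def)
      ultimately show False using stable[of j] nin ys by auto
    qed
    moreover have "xs \<in> E j" using nin ys by (auto simp: E_def D_def j)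
    ultimately show "xs \<in> (\<Union>j<N. E j)" by auto
  next
    fix xs assume "xs \<in> (\<Union>j<N. E j)"
    then obtain j ys where j: "j < N" "xs = j # ys" "ys \<in> D j" by (auto simp: E_def)
    have "ys \<in> slice U j" using j(3) by (auto simp: D_def split: if_splits)
    then have U: "xs \<in> U" by (simp add: slice_def j)
    have "xs \<notin> sh ` U"
    proof
      assume "xs \<in> sh ` U"
      then obtain zs where zs: "zs \<in> U" "xs = sh zs" by auto
      obtain i us where i: "zs = i # us" using len[OF zs(1)] by (cases zs) auto
      have "j = i + M" "us = ys" using zs(2) j(2) by (auto simp: sh_def i)
      then show False using j(3) zs(1) by (auto simp: D_def slice_def i)
    qed
    then show "xs \<in> U - sh ` U" using U by simp
  qed
  have gsh: "gf (weight (w # ws)) (sh ` U) = fps_X ^ (w * M) * gf (weight (w # ws)) U"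
  proof (rule gf_image[OF inj])
    fix xs assume "xs \<in> U"
    then show "weight (w # ws) (sh xs) = weight (w # ws) xs + w * M"
      using len[of xs] by (cases xs) (auto simp: sh_def algebra_simps)
  qed
  have gD: "rational_fps (gf (weight ws) (D j))" for j
  proof -
    have r: "rational_fps (gf (weight ws) (slice U i))" for i
      by (rule Cons.IH[OF _ scs]) (use Cons.prems in auto)
    show ?thesis
    proof (cases "j < M")
      case False
      then have "slice U (j - M) \<subseteq> slice U j" using slice_shift[OF sc, of "j - M" 1] by simp
      then have "gf (weight ws) (D j) = gf (weight ws) (slice U j) - gf (weight ws) (slice U (j - M))"
        using False gf_Diff[OF fins[OF order_refl]] by (simp add: D_def)
      then show ?thesis using r rational_fps_diff by simp
    qed (simp add: D_def r)
  qed
  have gE: "rational_fps (gf (weight (w # ws)) (E j))" for j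
  proof -
    have "gf (weight (w # ws)) (E j) = fps_X ^ (w * j) * gf (weight ws) (D j)"
      unfolding E_def by (rule gf_image) auto
    then show ?thesis using gD rational_fps_mult rational_fps_X_power by simp
  qed
  have EU: "E j \<subseteq> U" for j
    by (auto simp: E_def D_def slice_def split: if_splits)
  have "gf (weight (w # ws)) (U - sh ` U) = (\<Sum>j<N. gf (weight (w # ws)) (E j))"
    unfolding diff by (rule gf_UN_disjoint) (use fin[OF EU] in \<open>auto simp: E_def\<close>)
  moreover have "gf (weight (w # ws)) (U - sh ` U)
      = gf (weight (w # ws)) U - fps_X ^ (w * M) * gf (weight (w # ws)) U"
    using gf_Diff[OF fin[OF order_refl] shU] gsh by simp
  moreover have "\<dots> = fps_of_poly (1 - monom 1 (w * M)) * gf (weight (w # ws)) U"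
    by (simp add: fps_of_poly_diff fps_of_poly_monom' algebra_simps)
  ultimately have rat: "rational_fps (fps_of_poly (1 - monom 1 (w * M)) * gf (weight (w # ws)) U)"
    using rational_fps_sum[of "{..<N}", OF gE] by simp
  have "coeff (1 - monom 1 (w * M) :: int poly) 0 = 1"
    using assms(1) Cons.prems(1) by simp
  then have "(1 - monom 1 (w * M) :: int poly) \<noteq> 0" by force
  then show ?case using rat by (rule rational_fps_cancel)
qed

section \<open>Sets of partitions with rational generating function\<close>

fun large_parts :: "nat \<Rightarrow> nat list \<Rightarrow> nat list" where
  "large_parts K [] = []"
| "large_parts K (b # bs) = (K + b + sum_list bs) # large_parts K bs"

fun small_parts :: "nat \<Rightarrow> nat list \<Rightarrow> nat multiset" where
  "small_parts e [] = {#}"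
| "small_parts e (c # cs) = replicate_mset c e + small_parts (Suc e) cs"

lemma length_large_parts [simp]: "length (large_parts K bs) = length bs"
  by (induction bs) auto

lemma large_parts_ge: "x \<in> set (large_parts K bs) \<Longrightarrow> K \<le> x"
  by (induction bs) auto

lemma large_parts_le: "x \<in> set (large_parts K bs) \<Longrightarrow> x \<le> K + sum_list bs"
  by (induction bs) auto

lemma large_parts_sorted: "sorted_wrt (\<ge>) (large_parts K bs)"
proof (induction bs)
  case (Cons b bs)
  have "x \<le> K + b + sum_list bs" if "x \<in> set (large_parts K bs)" for x
    using large_parts_le[OF that] by simp
  then show ?case using Cons by simp
qed simp

text \<open>The parts are suffix sums, so entry \<open>i\<close> enters exactly those with indices
  \<open>0, ..., i\<close>, and these are the largest ones.\<close>

lemma large_parts_update: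
  "i < length bs \<Longrightarrow>
   large_parts K (bs[i := bs ! i + M]) = map (\<lambda>x. x + M) (take (Suc i) (large_parts K bs)) @ drop (Suc i) (large_parts K bs)"
proof (induction bs arbitrary: i)
  case (Cons b bs)
  show ?case
  proof (cases i)
    case (Suc i')
    then have i': "i' < length bs" using Cons.prems by simp
    have "sum_list (bs[i' := bs ! i' + M]) = sum_list bs + M"
      using i' member_le_sum_list[OF nth_mem[OF i']] by (simp add: sum_list_update)
    then show ?thesis using Cons.IH[OF i'] Suc by simp
  qed simp
qed simp

lemma large_parts_inj: "large_parts K bs = large_parts K cs \<Longrightarrow> bs = cs"
proof (induction bs arbitrary: cs)
  case Nil
  then show ?case by (cases cs) auto
next
  case (Cons b bs)
  then show ?case by (cases cs) auto
qed

text \<open>The entries are the gaps from each part to the next one, and from the last part to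
  \<open>K\<close>; sortedness makes them nonnegative.\<close>

lemma large_parts_surj:
  "sorted_wrt (\<ge>) xs \<Longrightarrow> \<forall>x\<in>set xs. K \<le> x \<Longrightarrow> \<exists>bs. length bs = length xs \<and> large_parts K bs = xs"
proof (induction xs)
  case (Cons x xs)
  then obtain bs where bs: "length bs = length xs" "large_parts K bs = xs" by auto
  have "K + sum_list bs \<le> x"
    using bs Cons.prems by (cases bs) auto
  then have "large_parts K ((x - K - sum_list bs) # bs) = x # xs" by (simp add: bs)
  then show ?case using bs(1) by (metis length_Cons)
qed simp

lemma weight_map_Suc:
  "length ws = length xs \<Longrightarrow> weight (map Suc ws) xs = sum_list xs + weight ws xs"
  by (induction ws xs rule: list_induct2) (auto simp: weight_def)

text \<open>The entry at index \<open>i\<close> is counted in \<open>i + 1\<close> parts, which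
  gives the weights 1, 2, and so on.\<close>

lemma sum_list_large_parts: "sum_list (large_parts K bs) = K * length bs + weight [1..<Suc (length bs)] bs"
proof (induction bs)
  case (Cons b bs)
  have "weight [1..<Suc (length (b # bs))] (b # bs) = b + weight (map Suc [1..<Suc (length bs)]) bs"
    by (subst upt_conv_Cons) (auto simp: map_Suc_upt simp del: upt_Suc)
  also have "\<dots> = b + sum_list bs + weight [1..<Suc (length bs)] bs"
    by (subst weight_map_Suc) (auto simp: Suc_le_eq)
  finally show ?case using Cons by simp
qed (simp add: weight_def)

lemma small_parts_bounds: "x \<in># small_parts e cs \<Longrightarrow> e \<le> x \<and> x < e + length cs"
proof (induction e cs rule: small_parts.induct)
  case (2 e c cs)
  then consider "x = e" | "x \<in># small_parts (Suc e) cs" by (auto split: if_splits)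
  then show ?case using "2.IH" by cases auto
qed simp

lemma count_small_parts: "i < length cs \<Longrightarrow> count (small_parts e cs) (e + i) = cs ! i"
proof (induction e cs arbitrary: i rule: small_parts.induct)
  case (2 e c cs)
  show ?case
  proof (cases i)
    case 0
    have "count (small_parts (Suc e) cs) e = 0"
      using small_parts_bounds[of e "Suc e" cs] by (meson Suc_n_not_le_n count_inI)
    then show ?thesis using 0 by simp
  next
    case (Suc i')
    then show ?thesis using "2.IH"[of i'] "2.prems" by simp
  qed
qed simp

lemma small_parts_update:
  "i < length cs \<Longrightarrow> small_parts e (cs[i := cs ! i + M]) = small_parts e cs + replicate_mset M (e + i)"
proof (induction e cs arbitrary: i rule: small_parts.induct)
  case (2 e c cs)
  then show ?case by (cases i) (auto intro!: multiset_eqI)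
qed simp

lemma sum_mset_small_parts: "sum_mset (small_parts e cs) = weight [e..<e + length cs] cs"
proof (induction e cs rule: small_parts.induct)
  case (2 e c cs)
  have "weight [e..<e + length (c # cs)] (c # cs) = e * c + weight [Suc e..<Suc e + length cs] cs"
    by (subst upt_conv_Cons) auto
  then show ?case using 2 by simp
qed (simp add: weight_def)

lemma small_parts_count: "small_parts e (map (count \<mu>) [e..<e + n]) = filter_mset (\<lambda>x. e \<le> x \<and> x < e + n) \<mu>"
proof (induction n arbitrary: e)
  case (Suc n)
  have "small_parts e (map (count \<mu>) [e..<e + Suc n])
      = replicate_mset (count \<mu> e) e + small_parts (Suc e) (map (count \<mu>) [Suc e..<Suc e + n])"
    by (subst upt_conv_Cons) auto
  also have "\<dots> = filter_mset (\<lambda>x. x = e) \<mu> + filter_mset (\<lambda>x. Suc e \<le> x \<and> x < Suc e + n) \<mu>"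
    by (simp only: Suc.IH filter_eq_replicate_mset)
  also have "\<dots> = filter_mset (\<lambda>x. e \<le> x \<and> x < e + Suc n) \<mu>"
    by (rule multiset_eqI) auto
  finally show ?case .
qed simp

definition big :: "nat \<Rightarrow> nat multiset \<Rightarrow> nat" where
  "big K \<mu> = size (filter_mset (\<lambda>x. K \<le> x) \<mu>)"

text \<open>A partition is encoded by the multiplicities of its parts below \<open>K\<close>, followed by the successive
  differences of its parts \<open>\<ge> K\<close> (the last one measured from \<open>K\<close>). Raising the \<open>i\<close> largest parts by \<open>M\<close> thereby
  becomes adding \<open>M\<close> to one coordinate.\<close>

definition decode :: "nat \<Rightarrow> nat list \<Rightarrow> nat multiset" where
  "decode K xs = small_parts 1 (take (K - 1) xs) + mset (large_parts K (drop (K - 1) xs))"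

lemma filter_mset_all: "(\<And>x. x \<in># A \<Longrightarrow> P x) \<Longrightarrow> filter_mset P A = A"
  by (induction A) auto

lemma filter_mset_none: "(\<And>x. x \<in># A \<Longrightarrow> \<not> P x) \<Longrightarrow> filter_mset P A = {#}"
  by (induction A) auto

text \<open>The two halves of a code occupy disjoint ranges of part sizes, so each can be recovered
  by filtering; injectivity of \<open>decode\<close> rests on this.\<close>

lemma filter_decode:
  assumes "K > 0"
  shows "filter_mset (\<lambda>x. x < K) (decode K xs) = small_parts 1 (take (K - 1) xs)" (is ?A)
    and "filter_mset (\<lambda>x. K \<le> x) (decode K xs) = mset (large_parts K (drop (K - 1) xs))" (is ?B)
proof -
  define A B where "A = small_parts 1 (take (K - 1) xs)" and "B = mset (large_parts K (drop (K - 1) xs))"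
  have A: "x < K" if "x \<in># A" for x
    using small_parts_bounds[OF that[unfolded A_def]] assms by auto
  have B: "\<not> x < K" if "x \<in># B" for x
    using that unfolding B_def set_mset_mset not_less by (rule large_parts_ge)
  have eq: "decode K xs = A + B" by (simp only: decode_def A_def B_def)
  have "filter_mset (\<lambda>x. x < K) (A + B) = A"
    unfolding filter_union_mset by (subst filter_mset_all[OF A], assumption, subst filter_mset_none[OF B]) simp_all
  then show ?A by (simp only: eq A_def)
  have "filter_mset (\<lambda>x. \<not> x < K) A = {#}" by (rule filter_mset_none) (use A in simp)
  then have "filter_mset (\<lambda>x. \<not> x < K) (A + B) = B"
    unfolding filter_union_mset by (subst filter_mset_all[OF B]) simp_all
  then show ?B by (simp only: eq B_def not_less)
qed

lemma mset_eq_sorted_desc: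
  assumes "mset xs = mset ys" "sorted_wrt (\<ge>) xs" "sorted_wrt (\<ge>) (ys :: nat list)"
  shows "xs = ys"
proof -
  have "sorted (rev xs)" "sorted (rev ys)" unfolding sorted_wrt_rev by (rule assms(2), rule assms(3))
  have "mset (rev xs) = mset (rev ys)" unfolding mset_rev by (rule assms(1))
  then have "sort (rev ys) = rev xs" using \<open>sorted (rev xs)\<close> by (rule properties_for_sort)
  moreover have "sort (rev ys) = rev ys" using \<open>sorted (rev ys)\<close> by (rule sorted_sort_id)
  ultimately show ?thesis by (simp only: rev_is_rev_conv)
qed

lemma decode_inj:
  assumes "K > 0" "decode K xs = decode K ys" "length xs = length ys" "K - 1 \<le> length xs"
  shows "xs = ys"
proof -
  have "large_parts K (drop (K - 1) xs) = large_parts K (drop (K - 1) ys)"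
    using filter_decode(2)[OF assms(1), of xs] filter_decode(2)[OF assms(1), of ys] assms(2)
    by (intro mset_eq_sorted_desc large_parts_sorted) simp
  then have 1: "drop (K - 1) xs = drop (K - 1) ys" by (rule large_parts_inj)
  have s: "small_parts 1 (take (K - 1) xs) = small_parts 1 (take (K - 1) ys)"
    using filter_decode(1)[OF assms(1), of xs] filter_decode(1)[OF assms(1), of ys] assms(2) by simp
  have "take (K - 1) xs = take (K - 1) ys"
  proof (rule nth_equalityI)
    fix i assume i: "i < length (take (K - 1) xs)"
    then show "take (K - 1) xs ! i = take (K - 1) ys ! i"
      using count_small_parts[of i "take (K - 1) xs" 1] count_small_parts[of i "take (K - 1) ys" 1] s assms(3)
      by simp
  qed (use assms(3) in simp)
  then show ?thesis using 1 by (metis append_take_drop_id)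
qed

lemma decode_surj:
  assumes "K > 0" "0 \<notin># \<mu>" "big K \<mu> = j"
  shows "\<exists>xs. length xs = K - 1 + j \<and> decode K xs = \<mu>"
proof -
  define cs where "cs = map (count \<mu>) [1..<1 + (K - 1)]"
  define ys where "ys = rev (sorted_list_of_multiset (filter_mset (\<lambda>x. K \<le> x) \<mu>))"
  have "sorted_wrt (\<ge>) ys" by (simp add: ys_def sorted_wrt_rev)
  moreover have "\<forall>x\<in>set ys. K \<le> x" by (simp add: ys_def)
  ultimately obtain bs where bs: "length bs = length ys" "large_parts K bs = ys" using large_parts_surj by blast
  have m: "mset ys = filter_mset (\<lambda>x. K \<le> x) \<mu>" by (simp add: ys_def)
  then have len: "length ys = j" using assms(3) by (metis big_def size_mset)
  have lc: "length cs = K - 1" unfolding cs_def by (simp only: length_map length_upt)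
  have "small_parts 1 cs = filter_mset (\<lambda>x. x < K) \<mu>"
    unfolding cs_def small_parts_count
  proof (rule filter_mset_cong)
    fix x assume "x \<in># \<mu>"
    then have "x \<noteq> 0" using assms(2) by metis
    then show "(1 \<le> x \<and> x < 1 + (K - 1)) = (x < K)" using assms(1) by linarith
  qed simp
  then have "decode K (cs @ bs) = filter_mset (\<lambda>x. x < K) \<mu> + filter_mset (\<lambda>x. K \<le> x) \<mu>"
    by (simp add: decode_def lc bs m)
  also have "\<dots> = \<mu>" by (rule multiset_eqI) auto
  finally show ?thesis using lc bs(1) len by (intro exI[of _ "cs @ bs"]) simp
qed

lemma weight_append:
  "length ws = length xs \<Longrightarrow> weight (ws @ vs) (xs @ ys) = weight ws xs + weight vs ys"
  by (simp add: weight_def)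

lemma sum_mset_decode:
  assumes "K > 0" "length xs = K - 1 + j"
  shows "sum_mset (decode K xs) = weight ([1..<K] @ [1..<Suc j]) xs + K * j"
proof -
  have "weight ([1..<K] @ [1..<Suc j]) (take (K - 1) xs @ drop (K - 1) xs)
      = weight [1..<K] (take (K - 1) xs) + weight [1..<Suc j] (drop (K - 1) xs)"
    by (rule weight_append) (use assms in simp)
  moreover have "sum_mset (small_parts 1 (take (K - 1) xs)) = weight [1..<K] (take (K - 1) xs)"
    using assms by (simp add: sum_mset_small_parts)
  moreover have "sum_list (large_parts K (drop (K - 1) xs)) = K * j + weight [1..<Suc j] (drop (K - 1) xs)"
    using assms by (simp add: sum_list_large_parts del: upt_Suc)
  ultimately show ?thesis by (simp add: decode_def sum_mset_sum_list del: upt_Suc)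
qed

text \<open>In the coordinates of \<open>decode\<close>, \<open>add_part\<close> gives closure in
  the multiplicities and \<open>raise\<close> gives closure in the gaps, so the codes form a
  shift-closed set. The size of a partition is a positive weight of its code plus the constant
  \<open>K * j\<close>. Fixing \<open>j\<close> fixes the number of coordinates.\<close>

theorem rational_gf_partitions:
  fixes Z :: "nat multiset set"
  assumes "K > 0" "M > 0"
    and parts: "\<And>\<mu>. \<mu> \<in> Z \<Longrightarrow> 0 \<notin># \<mu> \<and> big K \<mu> = j"
    and add_part: "\<And>\<mu> e. \<mu> \<in> Z \<Longrightarrow> 0 < e \<Longrightarrow> e < K \<Longrightarrow> add_mset e \<mu> \<in> Z"
    and raise: "\<And>A T. A + T \<in> Z \<Longrightarrow> \<forall>x\<in>#T. K \<le> x \<Longrightarrow> \<forall>x\<in>#T. \<forall>y\<in>#A. y \<le> x \<Longrightarrow>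
                  A + image_mset (\<lambda>x. x + M) T \<in> Z"
  shows "rational_fps (gf sum_mset Z)"
proof -
  define ws where "ws = [1..<K] @ [1..<Suc j]"
  define U where "U = {xs. length xs = K - 1 + j \<and> decode K xs \<in> Z}"
  have lenws: "length ws = K - 1 + j" by (simp add: ws_def)
  have add: "\<mu> + replicate_mset m e \<in> Z" if "\<mu> \<in> Z" "0 < e" "e < K" for \<mu> m e
    using add_part[OF _ that(2,3)] that(1) by (induction m) auto
  have "shift_closed M (length ws) U"
    unfolding shift_closed_def
  proof (intro ballI conjI allI impI)
    fix xs assume xs: "xs \<in> U"
    show len: "length xs = length ws" using xs by (simp add: U_def lenws)
    fix i assume i: "i < length ws"
    have "decode K (xs[i := xs ! i + M]) \<in> Z"
    proof (cases "i < K - 1")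
      case True
      have "take (K - 1) (xs[i := xs ! i + M]) = (take (K - 1) xs)[i := take (K - 1) xs ! i + M]"
        using True by (simp add: take_update_swap)
      moreover have "drop (K - 1) (xs[i := xs ! i + M]) = drop (K - 1) xs" using True by simp
      ultimately have "decode K (xs[i := xs ! i + M]) = decode K xs + replicate_mset M (1 + i)"
        using True i len small_parts_update[of i "take (K - 1) xs" 1 M]
        by (simp add: decode_def lenws)
      then show ?thesis using add[of "decode K xs" "1 + i" M] xs True by (simp add: U_def)
    next
      case False
      \<comment> \<open>Coordinate \<open>i\<close> is the gap with index \<open>l\<close>; shifting
        it raises the \<open>Suc l\<close> largest parts, which play the role of \<open>T\<close> in
        \<open>raise\<close>.\<close>
      define l where "l = i - (K - 1)"
      define ys where "ys = large_parts K (drop (K - 1) xs)"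
      define R where "R = small_parts 1 (take (K - 1) xs)"
      have l: "l < length (drop (K - 1) xs)" using False i len by (simp add: l_def)
      have "drop (K - 1) (xs[i := xs ! i + M]) = (drop (K - 1) xs)[l := drop (K - 1) xs ! l + M]"
        using False i len by (simp add: drop_update_swap l_def)
      moreover have "take (K - 1) (xs[i := xs ! i + M]) = take (K - 1) xs" using False by simp
      ultimately have 1: "decode K (xs[i := xs ! i + M])
          = R + mset (map (\<lambda>x. x + M) (take (Suc l) ys) @ drop (Suc l) ys)"
        using large_parts_update[OF l] by (simp add: decode_def R_def ys_def)
      have "decode K xs = R + mset (take (Suc l) ys @ drop (Suc l) ys)"
        unfolding append_take_drop_id by (simp add: decode_def R_def ys_def)
      also have "\<dots> = (R + mset (drop (Suc l) ys)) + mset (take (Suc l) ys)"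
        by (simp only: mset_append ac_simps)
      finally have Z: "(R + mset (drop (Suc l) ys)) + mset (take (Suc l) ys) \<in> Z"
        using xs by (simp only: U_def mem_Collect_eq)
      have large: "K \<le> x" if "x \<in> set ys" for x using large_parts_ge that by (simp add: ys_def)
      have "(R + mset (drop (Suc l) ys)) + image_mset (\<lambda>x. x + M) (mset (take (Suc l) ys)) \<in> Z"
      proof (rule raise[OF Z]; intro ballI)
        fix x assume "x \<in># mset (take (Suc l) ys)"
        then have x: "x \<in> set (take (Suc l) ys)" by simp
        show Kx: "K \<le> x" by (rule large) (rule in_set_takeD[OF x])
        fix y assume "y \<in># R + mset (drop (Suc l) ys)"
        then consider "y \<in># R" | "y \<in> set (drop (Suc l) ys)" by auto
        then show "y \<le> x"
        proof cases
          case 1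
          then have "y < K" using small_parts_bounds assms(1) by (fastforce simp: R_def)
          then show ?thesis using Kx by simp
        next
          case 2
          have "sorted_wrt (\<ge>) (take (Suc l) ys @ drop (Suc l) ys)"
            by (simp add: ys_def large_parts_sorted)
          then show ?thesis using x 2 unfolding sorted_wrt_append by blast
        qed
      qed
      then show ?thesis unfolding 1 by (simp add: ac_simps)
    qed
    then show "xs[i := xs ! i + M] \<in> U" using xs by (simp add: U_def)
  qed
  then have rat: "rational_fps (gf (weight ws) U)"
    by (rule rational_gf_shift_closed[OF assms(2), rotated]) (auto simp: ws_def)
  have inj: "inj_on (decode K) U"
    by (rule inj_onI) (use decode_inj[OF assms(1)] in \<open>auto simp: U_def\<close>)
  have img: "decode K ` U = Z"
  proof
    show "decode K ` U \<subseteq> Z" by (auto simp: U_def)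
    show "Z \<subseteq> decode K ` U"
    proof
      fix \<mu> assume "\<mu> \<in> Z"
      then show "\<mu> \<in> decode K ` U"
        using decode_surj[OF assms(1), of \<mu> j] parts unfolding U_def by blast
    qed
  qed
  have "gf sum_mset (decode K ` U) = fps_X ^ (K * j) * gf (weight ws) U"
    by (rule gf_image[OF inj]) (simp add: U_def ws_def sum_mset_decode[OF assms(1)] del: upt_Suc)
  then show ?thesis unfolding img using rat rational_fps_mult rational_fps_X_power by simp
qed

section \<open>Shapes of monomials\<close>

abbreviation lookup :: "('a \<Rightarrow>\<^sub>0 'b::zero) \<Rightarrow> 'a \<Rightarrow> 'b" where
  "lookup \<equiv> Poly_Mapping.lookup"

abbreviation keys :: "('a \<Rightarrow>\<^sub>0 'b::zero) \<Rightarrow> 'a set" where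
  "keys \<equiv> Poly_Mapping.keys"

abbreviation mon :: "'a \<Rightarrow> 'b::zero \<Rightarrow> 'a \<Rightarrow>\<^sub>0 'b" where
  "mon \<equiv> Poly_Mapping.single"

definition shape :: "(nat \<Rightarrow>\<^sub>0 nat) \<Rightarrow> nat multiset" where
  "shape m = image_mset (lookup m) (mset_set (keys m))"

lemma zero_notin_shape: "0 \<notin># shape m"
  by (auto simp: shape_def in_keys_iff)

lemma sum_mset_shape: "sum_mset (shape m) = mon_degree m"
  by (simp add: shape_def mon_degree_def sum_unfold_sum_mset)

lemma keys_add_nat: "keys (m + m') = keys m \<union> keys (m' :: 'a \<Rightarrow>\<^sub>0 nat)"
  by (auto simp: in_keys_iff lookup_add)

lemma shape_add_disjoint:
  assumes "keys m \<inter> keys m' = {}"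
  shows "shape (m + m') = shape m + shape m'"
proof -
  have "image_mset (lookup (m + m')) (mset_set (keys m)) = shape m"
    unfolding shape_def using assms
    by (intro image_mset_cong) (auto simp: lookup_add in_keys_iff)
  moreover have "image_mset (lookup (m + m')) (mset_set (keys m')) = shape m'"
    unfolding shape_def using assms
    by (intro image_mset_cong) (auto simp: lookup_add in_keys_iff)
  moreover have "mset_set (keys (m + m')) = mset_set (keys m) + mset_set (keys m')"
    unfolding keys_add_nat using assms by (intro mset_set_Union) auto
  ultimately show ?thesis unfolding shape_def[of "m + m'"] by simp
qed

lemma shape_single: "shape (mon i e) = (if e = 0 then {#} else {#e#})"
  by (simp add: shape_def)

lemma shape_0 [simp]: "shape 0 = {#}"
  by (simp add: shape_def)

text \<open>Padding with zeros gives exponent multisets of the fixed size \<open>n\<close>. Equal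
  shapes then yield a permutation of all of \<open>{..<n}\<close> and not merely a bijection between
  supports.\<close>

lemma image_mset_lessThan_shape:
  assumes "keys m \<subseteq> {..<n}"
  shows "image_mset (lookup m) (mset_set {..<n}) = shape m + replicate_mset (n - size (shape m)) 0"
proof -
  have sz: "size (shape m) = card (keys m)" by (simp add: shape_def)
  have "mset_set {..<n} = mset_set (keys m \<union> ({..<n} - keys m))"
    using assms by (simp add: Un_absorb1)
  also have "\<dots> = mset_set (keys m) + mset_set ({..<n} - keys m)"
    by (rule mset_set_Union) auto
  finally have "image_mset (lookup m) (mset_set {..<n})
      = shape m + image_mset (lookup m) (mset_set ({..<n} - keys m))"
    by (simp add: shape_def)
  also have "image_mset (lookup m) (mset_set ({..<n} - keys m))
      = image_mset (\<lambda>_. 0) (mset_set ({..<n} - keys m))"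
    by (rule image_mset_cong) (simp add: in_keys_iff)
  also have "\<dots> = replicate_mset (n - size (shape m)) 0"
    using assms by (simp add: sz card_Diff_subset image_mset_const_eq)
  finally show ?thesis .
qed

section \<open>The action of permutations on monomials\<close>

definition perm_mon :: "(nat \<Rightarrow> nat) \<Rightarrow> (nat \<Rightarrow>\<^sub>0 nat) \<Rightarrow> (nat \<Rightarrow>\<^sub>0 nat)" where
  "perm_mon \<sigma> m = (\<Sum>i\<in>keys m. mon (\<sigma> i) (lookup m i))"

lemma lookup_perm_mon:
  assumes "bij \<sigma>"
  shows "lookup (perm_mon \<sigma> m) j = lookup m (inv_into UNIV \<sigma> j)"
proof -
  have "lookup (perm_mon \<sigma> m) j = (\<Sum>i\<in>keys m. if i = inv_into UNIV \<sigma> j then lookup m i else 0)"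
    unfolding perm_mon_def lookup_sum
    by (rule sum.cong) (use assms bij_inv_eq_iff[OF assms] in \<open>auto simp: lookup_single when_def\<close>)
  also have "\<dots> = lookup m (inv_into UNIV \<sigma> j)"
    by (simp add: in_keys_iff)
  finally show ?thesis .
qed

lemma keys_perm_mon: "bij \<sigma> \<Longrightarrow> keys (perm_mon \<sigma> m) = \<sigma> ` keys m"
proof (rule Set.set_eqI)
  fix x assume "bij \<sigma>"
  then show "x \<in> keys (perm_mon \<sigma> m) \<longleftrightarrow> x \<in> \<sigma> ` keys m"
    unfolding in_keys_iff lookup_perm_mon[OF \<open>bij \<sigma>\<close>] image_iff by (metis bij_inv_eq_iff in_keys_iff)
qed

lemma perm_mon_comp:
  assumes "bij \<sigma>" "bij \<tau>" shows "perm_mon \<sigma> (perm_mon \<tau> m) = perm_mon (\<sigma> \<circ> \<tau>) m"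
  by (rule poly_mapping_eqI)
    (simp add: lookup_perm_mon assms bij_comp o_inv_distrib)

lemma perm_mon_id: "perm_mon id m = m"
  by (rule poly_mapping_eqI) (simp add: lookup_perm_mon)

lemma perm_mon_inv:
  assumes "bij \<sigma>"
  shows "perm_mon (inv_into UNIV \<sigma>) (perm_mon \<sigma> m) = m"
    "perm_mon \<sigma> (perm_mon (inv_into UNIV \<sigma>) m) = m"
proof -
  have "inv_into UNIV \<sigma> \<circ> \<sigma> = id" "\<sigma> \<circ> inv_into UNIV \<sigma> = id"
    using assms by (auto simp: bij_is_inj surj_iff[THEN iffD1, OF bij_is_surj])
  then show "perm_mon (inv_into UNIV \<sigma>) (perm_mon \<sigma> m) = m"
    "perm_mon \<sigma> (perm_mon (inv_into UNIV \<sigma>) m) = m"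
    using assms by (simp_all add: perm_mon_comp bij_imp_bij_inv perm_mon_id)
qed

lemma shape_perm_mon:
  assumes "bij \<sigma>" shows "shape (perm_mon \<sigma> m) = shape m"
proof -
  have inj: "inj_on \<sigma> (keys m)" using assms bij_is_inj inj_on_subset by blast
  have "mset_set (\<sigma> ` keys m) = image_mset \<sigma> (mset_set (keys m))"
    using inj by (simp add: image_mset_mset_set)
  then show ?thesis
    unfolding shape_def keys_perm_mon[OF assms]
    by (simp add: multiset.map_comp o_def lookup_perm_mon[OF assms] bij_is_inj[OF assms])
qed

lemma Sym_bij: "\<sigma> \<in> Sym n \<Longrightarrow> bij \<sigma>"
  by (auto simp: Sym_def permutes_bij)

lemma Sym_inv: "\<sigma> \<in> Sym n \<Longrightarrow> inv_into UNIV \<sigma> \<in> Sym n"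
  by (auto simp: Sym_def permutes_inv)

lemma Sym_comp: "\<sigma> \<in> Sym n \<Longrightarrow> \<tau> \<in> Sym n \<Longrightarrow> \<sigma> \<circ> \<tau> \<in> Sym n"
  by (auto simp: Sym_def permutes_compose)

lemma finite_Sym [simp]: "finite (Sym n)"
  by (simp add: Sym_def finite_permutations)

lemma card_Sym: "card (Sym n) = fact n"
  by (simp add: Sym_def card_permutations)

lemma Sym_subset_Sym_inf: "Sym n \<subseteq> Sym_inf"
  by (auto simp: Sym_inf_def)

lemma same_shape_imp_perm:
  assumes "keys m \<subseteq> {..<n}" "keys m' \<subseteq> {..<n}" "shape m = shape m'"
  obtains \<sigma> where "\<sigma> \<in> Sym n" "m = perm_mon \<sigma> m'"
proof -
  have "image_mset (lookup m) (mset_set {..<n}) = image_mset (lookup m') (mset_set {..<n})"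
    using assms by (simp add: image_mset_lessThan_shape)
  then obtain p where p: "p permutes {..<n}" "\<forall>i\<in>{..<n}. lookup m i = lookup m' (p i)"
    using image_mset_eq_implies_permutes[OF finite_lessThan] by metis
  \<comment> \<open>By \<open>lookup_perm_mon\<close> the action reads exponents through the inverse
    permutation, so \<open>p\<close> has to be inverted.\<close>
  define \<sigma> where "\<sigma> = inv_into UNIV p"
  have \<sigma>: "\<sigma> \<in> Sym n" using p(1) by (simp add: \<sigma>_def Sym_def permutes_inv)
  have "m = perm_mon \<sigma> m'"
  proof (rule poly_mapping_eqI)
    fix i
    have "lookup m i = lookup m' (p i)"
    proof (cases "i < n")
      case False
      then have "p i = i" using p(1) by (simp add: permutes_not_in)
      moreover have "i \<notin> keys m" "i \<notin> keys m'" using False assms(1,2) by auto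
      ultimately show ?thesis by (simp add: in_keys_iff)
    qed (use p(2) in auto)
    moreover have "inv_into UNIV \<sigma> = p" unfolding \<sigma>_def by (rule inv_inv_eq[OF permutes_bij[OF p(1)]])
    ultimately show "lookup m i = lookup (perm_mon \<sigma> m') i"
      by (simp only: lookup_perm_mon[OF Sym_bij[OF \<sigma>]])
  qed
  then show ?thesis using \<sigma> that by blast
qed

lemma keys_perm_mon_Sym:
  assumes "\<sigma> \<in> Sym n" "keys m \<subseteq> {..<n}" shows "keys (perm_mon \<sigma> m) \<subseteq> {..<n}"
proof -
  have "\<sigma> ` {..<n} = {..<n}" using assms(1) by (simp add: Sym_def permutes_image)
  then show ?thesis
    unfolding keys_perm_mon[OF Sym_bij[OF assms(1)]] using assms(2) by blast
qed

section \<open>Monomial expansions and the action on polynomials\<close>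

lemma poly_eq_sum_mon: "f = (\<Sum>m\<in>keys f. mon m (lookup f m))"
proof (rule poly_mapping_eqI)
  fix m
  have "lookup (\<Sum>m\<in>keys f. mon m (lookup f m)) m
      = (\<Sum>i\<in>keys f. if i = m then lookup f i else 0)"
    unfolding lookup_sum by (rule sum.cong) (auto simp: lookup_single when_def)
  also have "\<dots> = lookup f m" by (simp add: in_keys_iff)
  finally show "lookup f m = lookup (\<Sum>m\<in>keys f. mon m (lookup f m)) m" by simp
qed

lemma var_power: "(var i :: 'a::comm_semiring_1 inf_poly) ^ e = mon (mon i e) 1"
proof (induction e)
  case (Suc e)
  have "(var i :: 'a inf_poly) ^ Suc e = mon (mon i 1 + mon i e) (1 * 1)"
    unfolding power_Suc Suc by (simp only: var_def mult_single)
  also have "mon i 1 + mon i e = mon i (Suc e)" by (simp flip: single_add)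
  finally show ?case by simp
qed simp

lemma prod_mon: "(\<Prod>i\<in>A. mon (g i) (1 :: 'a::comm_semiring_1)) = mon (\<Sum>i\<in>A. g i) 1"
  for g :: "'i \<Rightarrow> 'b::comm_monoid_add"
  by (induction A rule: infinite_finite_induct) (auto simp: mult_single)

lemma lookup_const_mult [simp]: "lookup (const c * f) m = c * lookup f m"
proof -
  have "const c * f = Poly_Mapping.map ((*) c) f"
    by (simp add: const_def mult_map_scale_conv_mult)
  then show ?thesis by (simp add: Poly_Mapping.map.rep_eq when_def)
qed

lemma const_mult_mon: "const c * mon m a = mon m (c * a)"
  by (simp add: const_def mult_single)

lemma perm_poly_eq_sum: "perm_poly \<sigma> f = (\<Sum>m\<in>keys f. mon (perm_mon \<sigma> m) (lookup f m))"
  unfolding perm_poly_def eval_poly_def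
  by (simp add: var_power prod_mon perm_mon_def const_mult_mon)

lemma lookup_perm_poly:
  assumes "bij \<sigma>"
  shows "lookup (perm_poly \<sigma> f) m = lookup f (perm_mon (inv_into UNIV \<sigma>) m)"
proof -
  have iff: "perm_mon \<sigma> m' = m \<longleftrightarrow> m' = perm_mon (inv_into UNIV \<sigma>) m" for m'
    using perm_mon_inv[OF assms] by metis
  have "lookup (perm_poly \<sigma> f) m
      = (\<Sum>m'\<in>keys f. if m' = perm_mon (inv_into UNIV \<sigma>) m then lookup f m' else 0)"
    unfolding perm_poly_eq_sum lookup_sum
    by (rule sum.cong) (auto simp: lookup_single when_def iff)
  also have "\<dots> = lookup f (perm_mon (inv_into UNIV \<sigma>) m)" by (simp add: in_keys_iff)
  finally show ?thesis .
qed

lemma perm_poly_add: "bij \<sigma> \<Longrightarrow> perm_poly \<sigma> (f + g) = perm_poly \<sigma> f + perm_poly \<sigma> g"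
  by (rule poly_mapping_eqI) (simp add: lookup_perm_poly lookup_add)

lemma perm_poly_inv:
  "bij \<sigma> \<Longrightarrow> perm_poly \<sigma> (perm_poly (inv_into UNIV \<sigma>) f) = f"
  by (rule poly_mapping_eqI)
    (simp add: lookup_perm_poly bij_imp_bij_inv inv_inv_eq perm_mon_inv)

text \<open>The coinvariants of \<open>K[X]\<close> have the partitions as a basis, and \<open>coef f\<close> lists the coordinates
  of the image of \<open>f\<close> there.\<close>

definition coef :: "'a::comm_monoid_add inf_poly \<Rightarrow> nat multiset \<Rightarrow> 'a" where
  "coef f \<mu> = (\<Sum>m\<in>keys f. if shape m = \<mu> then lookup f m else 0)"

lemma coef_superset:
  assumes "finite A" "keys f \<subseteq> A"
  shows "coef f \<mu> = (\<Sum>m\<in>A. if shape m = \<mu> then lookup f m else 0)"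
  unfolding coef_def by (rule sum.mono_neutral_left) (use assms in \<open>auto simp: in_keys_iff\<close>)

lemma coef_0 [simp]: "coef 0 \<mu> = 0"
  by (simp add: coef_def)

lemma coef_add: "coef (f + g) \<mu> = coef f \<mu> + coef g \<mu>"
proof -
  let ?A = "keys f \<union> keys g"
  have "coef (f + g) \<mu> = (\<Sum>m\<in>?A. if shape m = \<mu> then lookup (f + g) m else 0)"
    by (rule coef_superset) (simp_all add: Poly_Mapping.keys_add)
  also have "\<dots> = (\<Sum>m\<in>?A. (if shape m = \<mu> then lookup f m else 0) + (if shape m = \<mu> then lookup g m else 0))"
    by (rule sum.cong) (simp_all add: lookup_add)
  also have "\<dots> = coef f \<mu> + coef g \<mu>"
    unfolding sum.distrib by (subst (1 2) coef_superset[of ?A]) simp_all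
  finally show ?thesis .
qed

lemma coef_sum: "coef (\<Sum>a\<in>A. F a) \<mu> = (\<Sum>a\<in>A. coef (F a) \<mu>)"
  by (induction A rule: infinite_finite_induct) (auto simp: coef_add)

lemma coef_mon: "coef (mon m c) \<mu> = (if shape m = \<mu> then c else 0)"
  by (simp add: coef_def)

lemma coef_const_mult: "coef (const c * f) \<mu> = c * coef f \<mu>" for c :: "'a::comm_semiring_1"
proof -
  have "coef (const c * f) \<mu> = (\<Sum>m\<in>keys f. if shape m = \<mu> then lookup (const c * f) m else 0)"
    by (rule coef_superset) (auto simp: in_keys_iff)
  also have "\<dots> = c * coef f \<mu>"
    unfolding coef_def sum_distrib_left by (rule sum.cong) auto
  finally show ?thesis .
qed

lemma coef_uminus: "coef (- f) \<mu> = - coef f \<mu>" for f :: "'a::ab_group_add inf_poly"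
  using coef_add[of f "- f" \<mu>] by (simp add: eq_neg_iff_add_eq_0 add.commute)

lemma coef_diff: "coef (f - g) \<mu> = coef f \<mu> - coef g \<mu>" for f :: "'a::ab_group_add inf_poly"
  using coef_add[of f "- g" \<mu>] by (simp add: coef_uminus)

lemma coef_nonzeroE:
  assumes "coef f \<mu> \<noteq> 0" obtains m where "m \<in> keys f" "shape m = \<mu>"
proof -
  have "\<exists>m\<in>keys f. shape m = \<mu>"
  proof (rule ccontr)
    assume "\<not> (\<exists>m\<in>keys f. shape m = \<mu>)"
    then have "coef f \<mu> = 0" unfolding coef_def by (intro sum.neutral) auto
    then show False using assms by simp
  qed
  then show thesis using that by blast
qed

lemma coef_perm_poly: "bij \<sigma> \<Longrightarrow> coef (perm_poly \<sigma> f) \<mu> = coef f \<mu>"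
  unfolding perm_poly_eq_sum coef_sum coef_mon by (simp add: shape_perm_mon coef_def)

text \<open>The Reynolds operator without the factor 1/n!. It therefore multiplies the coordinates
  \<open>coef\<close> by n!.\<close>

definition symmetrize :: "nat \<Rightarrow> 'a::comm_semiring_1 inf_poly \<Rightarrow> 'a inf_poly" where
  "symmetrize n f = (\<Sum>\<sigma>\<in>Sym n. perm_poly \<sigma> f)"

lemma coef_symmetrize: "coef (symmetrize n f) \<mu> = fact n * coef f \<mu>"
  by (simp add: symmetrize_def coef_sum coef_perm_poly[OF Sym_bij] card_Sym)

lemma lookup_symmetrize: "lookup (symmetrize n f) m = (\<Sum>\<sigma>\<in>Sym n. lookup f (perm_mon \<sigma> m))"
proof -
  have "lookup (symmetrize n f) m = (\<Sum>\<sigma>\<in>Sym n. lookup f (perm_mon (inv_into UNIV \<sigma>) m))"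
    by (simp add: symmetrize_def lookup_sum lookup_perm_poly[OF Sym_bij])
  also have "\<dots> = (\<Sum>\<sigma>\<in>Sym n. lookup f (perm_mon \<sigma> m))"
    by (rule sum.reindex_bij_witness[of _ "inv_into UNIV" "inv_into UNIV"])
      (auto simp: Sym_inv Sym_bij inv_inv_eq)
  finally show ?thesis .
qed

text \<open>Monomials of equal shape differ by some \<open>\<tau>\<close> in \<open>Sym n\<close>,
  and right translation by \<open>\<tau>\<close> permutes the summands.\<close>

lemma lookup_symmetrize_shape:
  assumes "keys m \<subseteq> {..<n}" "keys m' \<subseteq> {..<n}" "shape m = shape m'"
  shows "lookup (symmetrize n f) m = lookup (symmetrize n f) m'"
proof -
  obtain \<tau> where \<tau>: "\<tau> \<in> Sym n" "m = perm_mon \<tau> m'" by (rule same_shape_imp_perm[OF assms])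
  have "lookup (symmetrize n f) m = (\<Sum>\<sigma>\<in>Sym n. lookup f (perm_mon (\<sigma> \<circ> \<tau>) m'))"
    unfolding lookup_symmetrize \<tau>(2)
    by (rule sum.cong[OF refl]) (simp only: perm_mon_comp Sym_bij[of _ n] \<tau>(1))
  also have "\<dots> = (\<Sum>\<sigma>\<in>Sym n. lookup f (perm_mon \<sigma> m'))"
    by (rule sum.reindex_bij_witness[of _ "\<lambda>\<sigma>. \<sigma> \<circ> inv_into UNIV \<tau>" "\<lambda>\<sigma>. \<sigma> \<circ> \<tau>"])
      (use \<tau>(1) in \<open>auto simp: Sym_comp Sym_inv Sym_bij comp_assoc bij_is_inj
         surj_iff[THEN iffD1, OF bij_is_surj]\<close>)
  finally show ?thesis by (simp add: lookup_symmetrize)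
qed

section \<open>Polynomials in the first n variables and homogeneous polynomials\<close>

lemma polys_in_0: "0 \<in> polys_in n"
  by (simp add: polys_in_def)

lemma polys_in_add: "f \<in> polys_in n \<Longrightarrow> g \<in> polys_in n \<Longrightarrow> f + g \<in> polys_in n"
  using Poly_Mapping.keys_add[of f g] unfolding polys_in_def by blast

lemma polys_in_uminus: "f \<in> polys_in n \<Longrightarrow> - f \<in> polys_in n" for f :: "'a::ab_group_add inf_poly"
  unfolding polys_in_def by (auto simp: in_keys_iff)

lemma polys_in_diff: "f \<in> polys_in n \<Longrightarrow> g \<in> polys_in n \<Longrightarrow> f - g \<in> polys_in n"
  for f :: "'a::ab_group_add inf_poly"
  using polys_in_add[OF _ polys_in_uminus, of f n g] by simp

lemma polys_in_sum: "(\<And>a. a \<in> A \<Longrightarrow> F a \<in> polys_in n) \<Longrightarrow> (\<Sum>a\<in>A. F a) \<in> polys_in n"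
  by (induction A rule: infinite_finite_induct) (auto simp: polys_in_0 polys_in_add)

lemma polys_in_mult: "f \<in> polys_in n \<Longrightarrow> g \<in> polys_in n \<Longrightarrow> f * g \<in> polys_in n"
proof -
  assume f: "f \<in> polys_in n" and g: "g \<in> polys_in n"
  have "keys m \<subseteq> {..<n}" if m: "m \<in> keys (f * g)" for m
  proof -
    obtain a b where "m = a + b" "a \<in> keys f" "b \<in> keys g"
      using subsetD[OF Poly_Mapping.keys_mult m] by auto
    then show ?thesis using f g by (simp add: keys_add_nat polys_in_def)
  qed
  then show ?thesis by (simp add: polys_in_def)
qed

lemma polys_in_mon: "keys m \<subseteq> {..<n} \<Longrightarrow> mon m c \<in> polys_in n"
  by (simp add: polys_in_def)

lemma polys_in_const: "const c \<in> polys_in n"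
  by (simp add: const_def polys_in_mon)

lemma polys_in_mono: "n \<le> n' \<Longrightarrow> f \<in> polys_in n \<Longrightarrow> f \<in> polys_in n'"
  unfolding polys_in_def mem_Collect_eq by (meson lessThan_subset_iff order_trans)

lemma polys_in_perm_poly: "\<sigma> \<in> Sym n \<Longrightarrow> f \<in> polys_in n \<Longrightarrow> perm_poly \<sigma> f \<in> polys_in n"
  unfolding perm_poly_eq_sum
  by (rule polys_in_sum, rule polys_in_mon, rule keys_perm_mon_Sym) (auto simp: polys_in_def)

lemma polys_in_symmetrize: "f \<in> polys_in n \<Longrightarrow> symmetrize n f \<in> polys_in n"
  unfolding symmetrize_def by (rule polys_in_sum) (rule polys_in_perm_poly)

lemma ex_polys_in: "\<exists>n. f \<in> polys_in n"
proof -
  have "finite (\<Union>m\<in>keys f. keys m)" by simp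
  then obtain n where "(\<Union>m\<in>keys f. keys m) \<subseteq> {..<n}"
    by (meson finite_nat_bounded)
  then have "f \<in> polys_in n" unfolding polys_in_def by blast
  then show ?thesis ..
qed

lemma homogeneous_iff_shape: "homogeneous d f \<longleftrightarrow> (\<forall>m\<in>keys f. sum_mset (shape m) = d)"
  by (simp add: homogeneous_def sum_mset_shape)

lemma homogeneous_add: "homogeneous d f \<Longrightarrow> homogeneous d g \<Longrightarrow> homogeneous d (f + g)"
  using Poly_Mapping.keys_add[of f g] unfolding homogeneous_def by blast

lemma homogeneous_uminus: "homogeneous d f \<Longrightarrow> homogeneous d (- f)" for f :: "'a::ab_group_add inf_poly"
  unfolding homogeneous_def by (auto simp: in_keys_iff)

lemma homogeneous_const_mult: "homogeneous d f \<Longrightarrow> homogeneous d (const c * f)"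
  unfolding homogeneous_def by (auto simp: in_keys_iff)

lemma homogeneous_0: "homogeneous d 0"
  by (simp add: homogeneous_def)

lemma homogeneous_sum: "(\<And>a. a \<in> A \<Longrightarrow> homogeneous d (F a)) \<Longrightarrow> homogeneous d (\<Sum>a\<in>A. F a)"
  by (induction A rule: infinite_finite_induct) (auto intro: homogeneous_add homogeneous_0)

lemma homogeneous_perm_poly: "bij \<sigma> \<Longrightarrow> homogeneous d f \<Longrightarrow> homogeneous d (perm_poly \<sigma> f)"
  unfolding perm_poly_eq_sum
  by (rule homogeneous_sum) (auto simp: homogeneous_iff_shape shape_perm_mon)

lemma homogeneous_symmetrize: "homogeneous d f \<Longrightarrow> homogeneous d (symmetrize n f)"
  unfolding symmetrize_def by (rule homogeneous_sum) (auto intro: homogeneous_perm_poly Sym_bij)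

section \<open>Leading partitions of a symmetric homogeneous ideal\<close>

text \<open>The leading term is the one with the fewest parts \<open>\<ge> k\<close>: multiplication by \<open>x_i^k\<close> creates such
  parts wherever it does not hit one, and all those terms are lower.\<close>

definition below :: "nat \<Rightarrow> nat multiset \<Rightarrow> nat multiset \<Rightarrow> bool" where
  "below k \<nu> \<mu> \<longleftrightarrow> big k \<mu> < big k \<nu> \<or> big k \<nu> = big k \<mu> \<and> \<nu> < \<mu>"

lemma below_irrefl [simp]: "\<not> below k \<mu> \<mu>"
  by (simp add: below_def)

lemma below_trans: "below k \<kappa> \<mu> \<Longrightarrow> below k \<mu> \<nu> \<Longrightarrow> below k \<kappa> \<nu>"
  by (auto simp: below_def)

lemma below_total: "\<mu> = \<nu> \<or> below k \<mu> \<nu> \<or> below k \<nu> \<mu>"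
  by (auto simp: below_def)

lemma big_add [simp]: "big k (\<mu> + \<nu>) = big k \<mu> + big k \<nu>"
  by (simp add: big_def)

lemma big_add_mset [simp]: "big k (add_mset e \<mu>) = (if k \<le> e then 1 else 0) + big k \<mu>"
  by (simp add: big_def)

lemma big_empty [simp]: "big k {#} = 0"
  by (simp add: big_def)

lemma big_all: "\<forall>x\<in>#\<mu>. k \<le> x \<Longrightarrow> big k \<mu> = size \<mu>"
  by (induction \<mu>) auto

lemma big_le_size: "big k \<mu> \<le> size \<mu>"
  by (simp add: big_def size_filter_mset_lesseq)

lemma below_add_mset: "below k \<nu> \<mu> \<Longrightarrow> below k (add_mset e \<nu>) (add_mset e \<mu>)"
  by (auto simp: below_def)

text \<open>In a linear order the multiset order is decided by the largest element \<open>e\<close>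
  whose multiplicities differ: a surplus of \<open>A\<close> at \<open>e\<close> would have to be
  outweighed above \<open>e\<close>, where nothing differs.\<close>

lemma less_multiset_topE:
  fixes A B :: "'a::linorder multiset"
  assumes "A < B"
  obtains e where "count A e < count B e" "\<And>y. e < y \<Longrightarrow> count A y = count B y"
proof -
  define E where "E = {y \<in> set_mset (A + B). count A y \<noteq> count B y}"
  have E: "y \<in> E \<longleftrightarrow> count A y \<noteq> count B y" for y
    unfolding E_def by (cases "y \<in># A"; cases "y \<in># B") (auto simp: not_in_iff)
  have finE: "finite E" by (simp add: E_def)
  have "E \<noteq> {}" using assms E by (metis empty_iff multiset_eqI order_less_irrefl)
  define e where "e = Max E"
  have eE: "e \<in> E" using finE \<open>E \<noteq> {}\<close> by (simp add: e_def)
  have above: "count A y = count B y" if "e < y" for y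
    using Max_ge[OF finE, of y] that E by (metis e_def leD)
  have "count A e < count B e"
  proof (rule ccontr)
    assume "\<not> ?thesis"
    then have "count B e < count A e" using eE by (simp add: E)
    then obtain y where "e < y" "count A y < count B y"
      using assms unfolding less_multiset\<^sub>H\<^sub>O by blast
    then show False using above[of y] by simp
  qed
  then show ?thesis using above that by blast
qed

text \<open>Suppose \<open>B < A\<close>, with topmost difference at \<open>e\<close>. As the sizes
  agree, \<open>B\<close> has an element below \<open>e\<close>, for otherwise it would be contained
  in \<open>A\<close>. So all of \<open>D\<close> lies below \<open>e\<close>, and
  \<open>D + B\<close> loses to \<open>C + A\<close> at \<open>e\<close>.\<close>

lemma top_part_le:
  fixes A B C D :: "nat multiset"
  assumes le: "C + A \<le> D + B" and sz: "size A = size B" and top: "\<forall>x\<in>#B. \<forall>y\<in>#D. y \<le> x"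
  shows "A \<le> B"
proof (rule ccontr)
  assume "\<not> A \<le> B"
  then have "B < A" by simp
  then obtain e where at: "count B e < count A e" and above: "\<And>y. e < y \<Longrightarrow> count B y = count A y"
    by (rule less_multiset_topE) blast
  have "\<exists>z\<in>#B. z < e"
  proof (rule ccontr)
    assume none: "\<not> ?thesis"
    have "B \<subseteq># A"
    proof (rule mset_subset_eqI)
      fix y
      consider "y < e" | "y = e" | "e < y" by linarith
      then show "count B y \<le> count A y"
      proof cases
        case 1
        then have "y \<notin># B" using none by blast
        then show ?thesis by (simp add: not_in_iff)
      qed (use at above in simp_all)
    qed
    then have "B = A" using sz by (metis mset_subset_size nat_neq_iff subset_mset.le_imp_less_or_eq)
    then show False using at by simp
  qed
  then obtain z where z: "z \<in># B" "z < e" by blast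
  have D: "count D y = 0" if "e \<le> y" for y
  proof -
    have "y \<notin># D"
    proof
      assume "y \<in># D"
      then have "y \<le> z" using top z(1) by blast
      then show False using z(2) that by simp
    qed
    then show ?thesis by (simp add: not_in_iff)
  qed
  have lt: "count (D + B) e < count (C + A) e" using at D[of e] by simp
  have "D + B < C + A"
    unfolding less_multiset\<^sub>H\<^sub>O
  proof (intro conjI allI impI)
    show "D + B \<noteq> C + A" using lt by (metis less_irrefl)
    fix y assume y: "count (C + A) y < count (D + B) y"
    have "\<not> e < y" using y D[of y] above[of y] by auto
    moreover have "e \<noteq> y" using y lt by auto
    ultimately show "\<exists>x>y. count (D + B) x < count (C + A) x"
      using lt by (intro exI[of _ e]) simp
  qed
  then show False using le by simp
qed

lemma count_image_add: "count (image_mset (\<lambda>x. x + M) A) y = (if y < M then 0 else count A (y - M))"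
  for A :: "nat multiset"
  by (induction A) auto

text \<open>If \<open>e\<close> is the topmost difference of \<open>A\<close> and \<open>B\<close>,
  then \<open>e + M\<close> is that of the two sides: the unshifted summands agree there because
  \<open>e + M > e\<close>.\<close>

lemma shift_swap_less:
  fixes A B :: "nat multiset"
  assumes "A < B" "M > 0"
  shows "image_mset (\<lambda>x. x + M) A + B < image_mset (\<lambda>x. x + M) B + A"
proof -
  obtain e where at: "count A e < count B e" and above: "\<And>y. e < y \<Longrightarrow> count A y = count B y"
    using assms(1) by (rule less_multiset_topE) blast
  let ?l = "image_mset (\<lambda>x. x + M) A + B" and ?r = "image_mset (\<lambda>x. x + M) B + A"
  have eq: "count ?l y = count ?r y" if "e + M < y" for y
  proof -
    have "e < y" "e < y - M" using that by linarith+
    then show ?thesis using above[of y] above[of "y - M"] by (simp add: count_image_add)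
  qed
  have lt: "count ?l (e + M) < count ?r (e + M)"
    using at above[of "e + M"] assms(2) by (simp add: count_image_add)
  show ?thesis
    unfolding less_multiset\<^sub>H\<^sub>O
  proof (intro conjI allI impI)
    show "?l \<noteq> ?r" using lt by (metis less_irrefl)
    fix y assume y: "count ?r y < count ?l y"
    have "\<not> e + M < y" using y eq[of y] by (metis less_irrefl)
    moreover have "e + M \<noteq> y" using y lt by auto
    ultimately have "y < e + M" by linarith
    then show "\<exists>x>y. count ?l x < count ?r x" using lt by blast
  qed
qed

text \<open>Adding \<open>A + B\<close> to both sides splits the claim into the hypothesis and the
  swap inequality. It shows that raising the largest parts of the leading partition beats raising
  any equally many parts of a partition at most as large, and that a tie comes only from the leading
  partition itself.\<close>

lemma raise_le:
  fixes A B C D :: "nat multiset"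
  assumes le: "C + A \<le> D + B" and sz: "size A = size B" and top: "\<forall>x\<in>#B. \<forall>y\<in>#D. y \<le> x"
    and M: "M > 0"
  shows "C + image_mset (\<lambda>x. x + M) A \<le> D + image_mset (\<lambda>x. x + M) B"
    and "C + image_mset (\<lambda>x. x + M) A = D + image_mset (\<lambda>x. x + M) B \<Longrightarrow> C + A = D + B"
proof -
  let ?s = "image_mset (\<lambda>x. x + M)"
  have "A \<le> B" by (rule top_part_le[OF le sz top])
  have swap: "?s A + B \<le> ?s B + A"
  proof (cases "A = B")
    case False
    then have "A < B" using \<open>A \<le> B\<close> by simp
    then show ?thesis using shift_swap_less[OF _ M] less_imp_le by blast
  qed simp
  have l: "(C + ?s A) + (A + B) = (C + A) + (?s A + B)" and r: "(D + ?s B) + (A + B) = (D + B) + (?s B + A)"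
    by (simp_all add: ac_simps)
  have "(C + ?s A) + (A + B) \<le> (D + ?s B) + (A + B)"
    unfolding l r by (rule add_mono[OF le swap])
  then show "C + ?s A \<le> D + ?s B" by (rule add_le_imp_le_right)
  assume eq: "C + ?s A = D + ?s B"
  show "C + A = D + B"
  proof (rule ccontr)
    assume "C + A \<noteq> D + B"
    then have "(C + A) + (?s A + B) < (D + B) + (?s B + A)"
      using le by (intro add_less_le_mono[OF _ swap]) simp
    then show False unfolding l[symmetric] r[symmetric] eq by simp
  qed
qed

locale sym_hom_ideal =
  fixes I :: "'k::field_char_0 inf_poly set"
  assumes I_0: "0 \<in> I"
    and I_add: "f \<in> I \<Longrightarrow> g \<in> I \<Longrightarrow> f + g \<in> I"
    and I_mult: "f \<in> I \<Longrightarrow> f * g \<in> I"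
    and I_perm: "\<sigma> \<in> Sym_inf \<Longrightarrow> f \<in> I \<Longrightarrow> perm_poly \<sigma> f \<in> I"
    and I_hom: "f \<in> I \<Longrightarrow> homogeneous_part d f \<in> I"
begin

lemma I_sum: "(\<And>a. a \<in> A \<Longrightarrow> F a \<in> I) \<Longrightarrow> (\<Sum>a\<in>A. F a) \<in> I"
  by (induction A rule: infinite_finite_induct) (auto simp: I_0 I_add)

lemma I_mult_left: "f \<in> I \<Longrightarrow> g * f \<in> I"
  using I_mult by (simp add: mult.commute)

lemma I_uminus: "f \<in> I \<Longrightarrow> - f \<in> I"
  using I_mult[of f "- 1"] by simp

lemma I_diff: "f \<in> I \<Longrightarrow> g \<in> I \<Longrightarrow> f - g \<in> I"
  using I_add[OF _ I_uminus, of f g] by simp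

lemma I_symmetrize: "f \<in> I \<Longrightarrow> symmetrize n f \<in> I"
  unfolding symmetrize_def by (rule I_sum) (use I_perm Sym_subset_Sym_inf in blast)

text \<open>Leading terms are taken in the coinvariants, after all cancellation among monomials of
  one shape, and over all of \<open>I\<close> at once, without a bound on the number of
  variables.\<close>

definition leading :: "nat \<Rightarrow> nat multiset set" where
  "leading k = {\<mu>. \<exists>f\<in>I. coef f \<mu> \<noteq> 0 \<and> (\<forall>\<nu>. coef f \<nu> \<noteq> 0 \<longrightarrow> \<nu> = \<mu> \<or> below k \<nu> \<mu>)}"

lemma leadingI:
  "f \<in> I \<Longrightarrow> coef f \<mu> \<noteq> 0 \<Longrightarrow> (\<And>\<nu>. coef f \<nu> \<noteq> 0 \<Longrightarrow> \<nu> = \<mu> \<or> below k \<nu> \<mu>) \<Longrightarrow> \<mu> \<in> leading k"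
  unfolding leading_def by blast

lemma leading_no_zero: "\<mu> \<in> leading k \<Longrightarrow> 0 \<notin># \<mu>"
proof -
  assume "\<mu> \<in> leading k"
  then obtain f where "f \<in> I" "coef f \<mu> \<noteq> 0" unfolding leading_def mem_Collect_eq by blast
  from this(2) obtain m where "shape m = \<mu>" by (rule coef_nonzeroE)
  then show ?thesis using zero_notin_shape by blast
qed

text \<open>Since variable \<open>n\<close> does not occur in \<open>f\<close>, multiplying by its
  power adds the part \<open>e\<close> to every shape. This map of shapes is injective and respects
  \<open>below\<close>, so the coordinates are merely relabelled.\<close>

lemma leading_add_mset:
  assumes "\<mu> \<in> leading k" "e > 0"
  shows "add_mset e \<mu> \<in> leading k"
proof -
  obtain f where f: "f \<in> I" "coef f \<mu> \<noteq> 0" "\<And>\<nu>. coef f \<nu> \<noteq> 0 \<Longrightarrow> \<nu> = \<mu> \<or> below k \<nu> \<mu>"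
    using assms(1) unfolding leading_def by blast
  obtain n where n: "f \<in> polys_in n" using ex_polys_in by blast
  define g where "g = f * mon (mon n e) 1"
  have sh: "shape (m + mon n e) = add_mset e (shape m)" if "m \<in> keys f" for m
  proof -
    have "keys m \<inter> keys (mon n e) = {}" using that n by (auto simp: polys_in_def)
    then show ?thesis using assms(2) by (simp add: shape_add_disjoint shape_single)
  qed
  have "g = (\<Sum>m\<in>keys f. mon (m + mon n e) (lookup f m))"
    unfolding g_def by (subst poly_eq_sum_mon[of f]) (simp add: sum_distrib_right mult_single)
  then have cg: "coef g \<nu> = (\<Sum>m\<in>keys f. if add_mset e (shape m) = \<nu> then lookup f m else 0)" for \<nu>
    by (simp add: coef_sum coef_mon sh cong: sum.cong)
  have cadd: "coef g (add_mset e \<nu>) = coef f \<nu>" for \<nu>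
    unfolding cg by (simp add: coef_def)
  show ?thesis
  proof (rule leadingI[of g])
    show "g \<in> I" unfolding g_def by (rule I_mult[OF f(1)])
    show "coef g (add_mset e \<mu>) \<noteq> 0" using f(2) by (simp add: cadd)
    fix \<nu> assume nz: "coef g \<nu> \<noteq> 0"
    have "\<exists>m\<in>keys f. add_mset e (shape m) = \<nu>"
    proof (rule ccontr)
      assume "\<not> ?thesis"
      then have "coef g \<nu> = 0" unfolding cg by (intro sum.neutral) auto
      then show False using nz by simp
    qed
    then obtain \<nu>' where \<nu>': "\<nu> = add_mset e \<nu>'" by blast
    then have "\<nu>' = \<mu> \<or> below k \<nu>' \<mu>" using f(3) nz by (simp add: cadd)
    then show "\<nu> = add_mset e \<mu> \<or> below k \<nu> (add_mset e \<mu>)"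
      using \<nu>' below_add_mset by blast
  qed
qed

lemma leading_add:
  assumes "\<mu> \<in> leading k" "0 \<notin># \<rho>" shows "\<mu> + \<rho> \<in> leading k"
  using assms(2) by (induction \<rho>) (auto simp: assms(1) leading_add_mset)

end

lemma lookup_indicator: "finite A \<Longrightarrow> lookup (\<Sum>a\<in>A. mon a k) j = (if j \<in> A then k else 0)"
proof -
  assume "finite A"
  have "lookup (\<Sum>a\<in>A. mon a k) j = (\<Sum>a\<in>A. if a = j then k else 0)"
    unfolding lookup_sum by (rule sum.cong) (auto simp: lookup_single when_def)
  then show ?thesis using \<open>finite A\<close> by simp
qed

text \<open>\<open>A\<close> may leave the support of \<open>m\<close>; the zeros found there turn
  into new parts \<open>k\<close>.\<close>

lemma shape_add_indicator:
  assumes "finite A" "k > 0"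
  shows "shape (m + (\<Sum>a\<in>A. mon a k))
    = image_mset (lookup m) (mset_set (keys m - A)) + image_mset (\<lambda>x. x + k) (image_mset (lookup m) (mset_set A))"
proof -
  let ?s = "\<Sum>a\<in>A. mon a k"
  have k: "keys (m + ?s) = (keys m - A) \<union> A"
    using assms by (auto simp: in_keys_iff lookup_add lookup_indicator)
  have "mset_set (keys (m + ?s)) = mset_set (keys m - A) + mset_set A"
    unfolding k by (rule mset_set_Union) (use assms in auto)
  moreover have "image_mset (lookup (m + ?s)) (mset_set (keys m - A)) = image_mset (lookup m) (mset_set (keys m - A))"
    by (rule image_mset_cong) (use assms in \<open>auto simp: lookup_add lookup_indicator\<close>)
  moreover have "image_mset (lookup (m + ?s)) (mset_set A) = image_mset (\<lambda>a. lookup m a + k) (mset_set A)"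
    by (rule image_mset_cong) (use assms in \<open>auto simp: lookup_add lookup_indicator\<close>)
  ultimately show ?thesis by (simp add: shape_def multiset.map_comp o_def)
qed

text \<open>Turns a choice of parts of a partition into a choice of positions in a monomial. A
  submultiset of \<open>mset_set S\<close> has multiplicities at most 1 and is thus a set.\<close>

lemma submset_image_mset_set:
  assumes "T \<subseteq># image_mset f (mset_set S)" "finite S"
  obtains A where "A \<subseteq> S" "T = image_mset f (mset_set A)"
proof -
  obtain R where "image_mset f (mset_set S) = T + R"
    using assms(1) by (metis subset_mset.add_diff_inverse)
  from image_mset_eq_plusD[OF this] obtain B C
    where BC: "mset_set S = B + C" "T = image_mset f B" by blast
  have cnt: "count B x \<le> (if x \<in> S then 1 else 0)" for x
  proof -
    have "count B x \<le> count (mset_set S) x" by (simp add: BC(1))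
    also have "\<dots> = (if x \<in> S then 1 else 0)" using assms(2) by (simp add: count_mset_set')
    finally show ?thesis .
  qed
  have "B = mset_set (set_mset B)"
  proof (rule multiset_eqI)
    fix x
    show "count B x = count (mset_set (set_mset B)) x"
    proof (cases "x \<in># B")
      case True
      then have "count B x \<ge> 1" by (simp add: Suc_le_eq)
      moreover have "count B x \<le> 1" using cnt[of x] by (simp split: if_splits)
      ultimately have "count B x = 1" by linarith
      then show ?thesis using True by simp
    qed (simp add: not_in_iff)
  qed
  moreover have "set_mset B \<subseteq> S"
  proof
    fix x assume "x \<in># B"
    then have "count B x \<noteq> 0" by simp
    then show "x \<in> S" using cnt[of x] by (metis le_zero_eq)
  qed
  ultimately show ?thesis using that BC(2) by simp
qed

lemma sum_if_const: "finite S \<Longrightarrow> (\<Sum>x\<in>S. if P x then c else 0) = of_nat (card {x \<in> S. P x}) * c"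
  for c :: "'a::comm_semiring_1"
proof -
  assume "finite S"
  then have "(\<Sum>x\<in>S. if P x then c else 0) = (\<Sum>x | x \<in> S \<and> P x. c)" by (rule sum.inter_filter[symmetric])
  then show ?thesis by simp
qed

lemma big_0I: "\<forall>x\<in>#\<mu>. x < k \<Longrightarrow> big k \<mu> = 0"
  by (induction \<mu>) auto

lemma big_less_size: "x \<in># \<mu> \<Longrightarrow> x < k \<Longrightarrow> big k \<mu> < size \<mu>"
proof -
  assume "x \<in># \<mu>" "x < k"
  then obtain \<nu> where "\<mu> = add_mset x \<nu>" by (meson multi_member_split)
  then show ?thesis using \<open>x < k\<close> big_le_size[of k \<nu>] by simp
qed

text \<open>The offset 2 keeps variables 0 and 1 free for the factor
  \<open>(var 0 ^ p - var 1 ^ p) ^ k\<close>.\<close>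

lemma shape_sum_mon:
  assumes "\<And>l. l < n \<Longrightarrow> r l > 0"
  shows "keys (\<Sum>l<n. mon (l + 2) (r l)) \<subseteq> {2..<n + 2}
    \<and> shape (\<Sum>l<n. mon (l + 2) (r l)) = image_mset r (mset_set {..<n})"
  using assms
proof (induction n)
  case (Suc n)
  let ?v = "\<Sum>l<n. mon (l + 2) (r l)"
  have IH: "keys ?v \<subseteq> {2..<n + 2}" "shape ?v = image_mset r (mset_set {..<n})"
    using Suc by auto
  have "keys ?v \<inter> keys (mon (n + 2) (r n)) = {}" using IH(1) by auto
  then have "shape (?v + mon (n + 2) (r n)) = image_mset r (mset_set {..<n}) + {#r n#}"
    using Suc.prems[of n] by (subst shape_add_disjoint) (simp_all only: shape_single IH(2) lessI, simp)
  moreover have "keys (?v + mon (n + 2) (r n)) \<subseteq> {2..<Suc n + 2}"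
    unfolding keys_add_nat using IH(1) by (force split: if_splits)
  ultimately show ?case by (simp only: sum.lessThan_Suc) (simp add: lessThan_Suc)
qed simp

lemma finite_partitions: "finite {\<mu>. 0 \<notin># \<mu> \<and> sum_mset \<mu> = (d::nat)}"
proof (rule finite_subset)
  have size: "size \<mu> \<le> sum_mset \<mu>" if "0 \<notin># \<mu>" for \<mu> :: "nat multiset"
    using that by (induction \<mu>) auto
  have elem: "x \<le> sum_mset \<mu>" if "x \<in># \<mu>" for x and \<mu> :: "nat multiset"
    using that by (auto dest!: multi_member_split)
  show "{\<mu>. 0 \<notin># \<mu> \<and> sum_mset \<mu> = d} \<subseteq> mset ` {xs. set xs \<subseteq> {..d} \<and> length xs \<le> d}"
  proof
    fix \<mu> assume "\<mu> \<in> {\<mu>. 0 \<notin># \<mu> \<and> sum_mset \<mu> = d}"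
    then have \<mu>: "0 \<notin># \<mu>" "sum_mset \<mu> = d" by auto
    obtain xs where xs: "mset xs = \<mu>" using ex_mset by blast
    have "set xs \<subseteq> {..d}" using elem \<mu>(2) xs by auto
    moreover have "length xs \<le> d" using size[OF \<mu>(1)] \<mu>(2) xs by auto
    ultimately show "\<mu> \<in> mset ` {xs. set xs \<subseteq> {..d} \<and> length xs \<le> d}" using xs by blast
  qed
  show "finite (mset ` {xs. set xs \<subseteq> {..d} \<and> length xs \<le> d})"
    by (intro finite_imageI finite_lists_length_le) simp
qed

lemma homogeneous_homogeneous_part: "homogeneous d (homogeneous_part d f)"
  unfolding homogeneous_part_def by (rule homogeneous_sum) (auto simp: homogeneous_def)

lemma coef_homogeneous_part:
  "coef (homogeneous_part d f) \<mu> = (if sum_mset \<mu> = d then coef f \<mu> else 0)"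
proof -
  have "coef (homogeneous_part d f) \<mu>
      = (\<Sum>m | m \<in> keys f \<and> mon_degree m = d. if shape m = \<mu> then lookup f m else 0)"
    by (simp add: homogeneous_part_def coef_sum coef_mon)
  also have "\<dots> = (\<Sum>m\<in>keys f. if mon_degree m = d then (if shape m = \<mu> then lookup f m else 0) else 0)"
    by (simp add: sum.inter_filter)
  also have "\<dots> = (if sum_mset \<mu> = d then coef f \<mu> else 0)"
    unfolding coef_def by (cases "sum_mset \<mu> = d") (auto intro!: sum.cong sum.neutral simp: sum_mset_shape)
  finally show ?thesis .
qed

lemma coef_homogeneous: "homogeneous d f \<Longrightarrow> coef f \<mu> \<noteq> 0 \<Longrightarrow> sum_mset \<mu> = d"
  unfolding homogeneous_iff_shape by (erule coef_nonzeroE) blast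

lemma finite_coef_support: "finite {\<mu>. coef f \<mu> \<noteq> 0}"
proof (rule finite_subset)
  show "{\<mu>. coef f \<mu> \<noteq> 0} \<subseteq> shape ` keys f"
  proof
    fix \<mu> assume "\<mu> \<in> {\<mu>. coef f \<mu> \<noteq> 0}"
    then have "coef f \<mu> \<noteq> 0" by simp
    then show "\<mu> \<in> shape ` keys f" by (rule coef_nonzeroE) blast
  qed
qed simp

lemma below_max:
  assumes "finite A" "A \<noteq> {}" shows "\<exists>\<mu>\<in>A. \<forall>\<nu>\<in>A. \<nu> = \<mu> \<or> below k \<nu> \<mu>"
  using assms
proof (induction A rule: finite_ne_induct)
  case (insert \<nu> A)
  then obtain \<mu> where \<mu>: "\<mu> \<in> A" "\<forall>\<nu>\<in>A. \<nu> = \<mu> \<or> below k \<nu> \<mu>" by blast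
  show ?case
  proof (cases "below k \<nu> \<mu>")
    case False
    then have \<nu>: "\<nu> = \<mu> \<or> below k \<mu> \<nu>" using below_total by metis
    have "\<kappa> = \<nu> \<or> below k \<kappa> \<nu>" if "\<kappa> \<in> insert \<nu> A" for \<kappa>
    proof (cases "\<kappa> = \<nu>")
      case False
      then have "\<kappa> = \<mu> \<or> below k \<kappa> \<mu>" using that \<mu>(2) by simp
      then show ?thesis using \<nu> below_trans[of k \<kappa> \<mu> \<nu>] by auto
    qed simp
    then show ?thesis by (intro bexI[of _ \<nu>]) simp_all
  next
    case True
    then show ?thesis using \<mu> by (intro bexI[of _ \<mu>]) simp_all
  qed
qed simp

text \<open>The symmetrization has equal coefficients on monomials of equal shape, so its coordinate
  at \<open>shape m\<close> is a positive integer times a nonzero coefficient. Hence every monomial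
  that occurs is visible in the coordinates of \<open>f\<close>.\<close>

lemma coef_symmetrize_nonzero:
  fixes f :: "'a::field_char_0 inf_poly"
  assumes f: "f \<in> polys_in n" and m: "m \<in> keys (symmetrize n f)"
  shows "coef f (shape m) \<noteq> 0"
proof -
  define g where "g = symmetrize n f"
  have kn: "keys m' \<subseteq> {..<n}" if "m' \<in> keys g" for m'
    using polys_in_symmetrize[OF f] that unfolding g_def polys_in_def by blast
  have "coef g (shape m) = (\<Sum>m'\<in>keys g. if shape m' = shape m then lookup g m else 0)"
    unfolding coef_def
  proof (rule sum.cong[OF refl])
    fix m' assume "m' \<in> keys g"
    then have "shape m' = shape m \<Longrightarrow> lookup g m' = lookup g m"
      unfolding g_def using lookup_symmetrize_shape[OF kn kn] m unfolding g_def by blast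
    then show "(if shape m' = shape m then lookup g m' else 0) = (if shape m' = shape m then lookup g m else 0)"
      by simp
  qed
  also have "\<dots> = of_nat (card {m' \<in> keys g. shape m' = shape m}) * lookup g m"
    by (rule sum_if_const) simp
  also have "\<dots> \<noteq> 0"
  proof -
    have "card {m' \<in> keys g. shape m' = shape m} \<noteq> 0" using m by (auto simp: g_def)
    moreover have "lookup g m \<noteq> 0" using m by (simp add: in_keys_iff g_def)
    ultimately show ?thesis by simp
  qed
  finally show ?thesis by (auto simp: g_def coef_symmetrize)
qed

context sym_hom_ideal
begin

text \<open>Multiplication by the elementary symmetric polynomial of degree \<open>size T\<close> in the \<open>x_i^k\<close>.\<close>

lemma leading_raise:
  assumes lead: "R + T \<in> leading k" and k: "k > 0"
    and large: "\<forall>x\<in>#T. k \<le> x" and top: "\<forall>x\<in>#T. \<forall>y\<in>#R. y \<le> x"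
  shows "R + image_mset (\<lambda>x. x + k) T \<in> leading k"
proof -
  let ?s = "image_mset (\<lambda>x. x + k)"
  define \<mu> \<mu>' where "\<mu> = R + T" and "\<mu>' = R + ?s T"
  obtain f where f: "f \<in> I" "coef f \<mu> \<noteq> 0" "\<And>\<nu>. coef f \<nu> \<noteq> 0 \<Longrightarrow> \<nu> = \<mu> \<or> below k \<nu> \<mu>"
    using lead unfolding leading_def \<mu>_def by blast
  obtain n where n: "f \<in> polys_in n" using ex_polys_in by blast
  \<comment> \<open>After symmetrizing, coefficients depend only on the shape, and only shapes with
    nonzero coordinate occur, so no cancelling pairs can interfere with the multiplication.\<close>
  define g where "g = symmetrize n f"
  have g: "g \<in> I" "g \<in> polys_in n"
    unfolding g_def by (rule I_symmetrize[OF f(1)], rule polys_in_symmetrize[OF n])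
  have cg: "coef g \<nu> = fact n * coef f \<nu>" for \<nu> by (simp add: g_def coef_symmetrize)
  have kn: "keys m \<subseteq> {..<n}" if "m \<in> keys g" for m using g(2) that by (simp add: polys_in_def)
  have same: "lookup g m = lookup g m'" if "m \<in> keys g" "m' \<in> keys g" "shape m = shape m'" for m m'
    unfolding g_def by (rule lookup_symmetrize_shape[OF kn[OF that(1)] kn[OF that(2)] that(3)])
  have keys_g: "shape m = \<mu> \<or> below k (shape m) \<mu>" if "m \<in> keys g" for m
    using f(3)[OF coef_symmetrize_nonzero[OF n]] that unfolding g_def by blast
  define \<A> where "\<A> = {A. A \<subseteq> {..<n} \<and> card A = size T}"
  have fin\<A>: "finite \<A>" unfolding \<A>_def by (rule finite_subset[of _ "Pow {..<n}"]) auto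
  define ind where "ind A = (\<Sum>a\<in>A. mon a k)" for A :: "nat set"
  define h where "h = g * (\<Sum>A\<in>\<A>. mon (ind A) 1)"
  have "h = (\<Sum>m\<in>keys g. \<Sum>A\<in>\<A>. mon (m + ind A) (lookup g m))"
    unfolding h_def by (subst poly_eq_sum_mon[of g]) (simp add: sum_product mult_single)
  then have ch: "coef h \<nu> = (\<Sum>m\<in>keys g. \<Sum>A\<in>\<A>. if shape (m + ind A) = \<nu> then lookup g m else 0)" for \<nu>
    by (simp add: coef_sum coef_mon)
  have big\<mu>': "big k \<mu>' = big k \<mu>"
  proof -
    have "big k (?s T) = size T" using big_all[of "?s T" k] by simp
    moreover have "big k T = size T" using large by (rule big_all)
    ultimately show ?thesis by (simp add: \<mu>_def \<mu>'_def)
  qed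
  \<comment> \<open>The first half bounds all shapes of \<open>h\<close> by \<open>\<mu>'\<close>;
    the second says that \<open>\<mu>'\<close> arises only from monomials of shape
    \<open>\<mu>\<close>, which all carry the same coefficient.\<close>
  have shape_h: "(shape (m + ind A) = \<mu>' \<or> below k (shape (m + ind A)) \<mu>') \<and>
      (shape (m + ind A) = \<mu>' \<longrightarrow> shape m = \<mu>)" if m: "m \<in> keys g" and A: "A \<in> \<A>" for m A
  proof -
    have finA: "finite A" and cA: "card A = size T" using A finite_subset by (auto simp: \<A>_def)
    define B C where "B = image_mset (lookup m) (mset_set A)"
      and "C = image_mset (lookup m) (mset_set (keys m - A))"
    have sh: "shape (m + ind A) = C + ?s B"
      unfolding ind_def B_def C_def by (rule shape_add_indicator[OF finA k])
    have szB: "size B = size T" by (simp add: B_def cA)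
    have "mset_set ((keys m - A) \<union> A) = mset_set (keys m - A) + mset_set A"
      by (rule mset_set_Union) (use finA in auto)
    moreover have "mset_set (keys m \<union> (A - keys m)) = mset_set (keys m) + mset_set (A - keys m)"
      by (rule mset_set_Union) (use finA in auto)
    moreover have "(keys m - A) \<union> A = keys m \<union> (A - keys m)" by blast
    ultimately have un: "mset_set (keys m - A) + mset_set A = mset_set (keys m) + mset_set (A - keys m)"
      by simp
    have CB: "C + B = shape m + image_mset (lookup m) (mset_set (A - keys m))"
      using arg_cong[OF un, of "image_mset (lookup m)"]
      by (simp add: B_def C_def shape_def)
    have z: "big k (image_mset (lookup m) (mset_set (A - keys m))) = 0"
      by (rule big_0I) (use finA k in \<open>auto simp: in_keys_iff\<close>)
    have bigm: "big k (shape m) = big k C + big k B"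
      using arg_cong[OF CB, of "big k"] z by simp
    have bigsB: "big k (?s B) = size B" using big_all[of "?s B" k] by simp
    have m\<mu>: "big k \<mu> \<le> big k (shape m)" using keys_g[OF m] by (auto simp: below_def)
    show ?thesis
    proof (cases "big k B = size B")
      case False
      \<comment> \<open>Some raised exponent was below \<open>k\<close> and has become large, so the
        product has more large parts than \<open>m\<close>, hence more than
        \<open>\<mu>'\<close>.\<close>
      then have "big k \<mu>' < big k (C + ?s B)"
        using big_le_size[of k B] m\<mu> bigm bigsB big\<mu>' by simp
      then show ?thesis unfolding sh by (auto simp: below_def)
    next
      case True
      have "A \<subseteq> keys m"
      proof
        fix a assume "a \<in> A"
        then have "lookup m a \<in># B" using finA by (simp add: B_def)
        then have "\<not> lookup m a < k" using big_less_size[of "lookup m a" B k] True by auto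
        then have "lookup m a \<noteq> 0" using k by linarith
        then show "a \<in> keys m" by (simp add: in_keys_iff)
      qed
      then have diff: "A - keys m = {}" by blast
      have CB': "C + B = shape m" using CB unfolding diff by simp
      have bigh: "big k (C + ?s B) = big k (shape m)" using bigm True bigsB by simp
      show ?thesis
      proof (cases "big k (shape m) = big k \<mu>")
        case False
        then have "big k \<mu>' < big k (C + ?s B)" using m\<mu> bigh big\<mu>' by simp
        then show ?thesis unfolding sh by (auto simp: below_def)
      next
        case eq: True
        have "C + B \<le> R + T"
          using keys_g[OF m] eq unfolding CB' \<mu>_def[symmetric] by (auto simp: below_def)
        note r = raise_le[OF this szB top k]
        have r1: "C + ?s B \<le> \<mu>'" unfolding \<mu>'_def by (rule r(1))
        have r2: "C + ?s B = \<mu>' \<Longrightarrow> shape m = \<mu>"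
          unfolding \<mu>'_def \<mu>_def CB'[symmetric] by (rule r(2))
        have "C + ?s B = \<mu>' \<or> below k (C + ?s B) \<mu>'"
        proof (cases "C + ?s B = \<mu>'")
          case False
          then have "C + ?s B < \<mu>'" using r1 by simp
          moreover have "big k (C + ?s B) = big k \<mu>'" unfolding bigh eq big\<mu>' ..
          ultimately show ?thesis by (simp only: below_def simp_thms)
        qed simp
        then show ?thesis unfolding sh using r2 by blast
      qed
    qed
  qed
  show ?thesis
    unfolding \<mu>'_def[symmetric]
  proof (rule leadingI[of h])
    show "h \<in> I" unfolding h_def by (rule I_mult[OF g(1)])
    show "\<nu> = \<mu>' \<or> below k \<nu> \<mu>'" if nz: "coef h \<nu> \<noteq> 0" for \<nu>
    proof -
      have "\<exists>m\<in>keys g. \<exists>A\<in>\<A>. shape (m + ind A) = \<nu>"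
      proof (rule ccontr)
        assume "\<not> ?thesis"
        then have "coef h \<nu> = 0" unfolding ch by (intro sum.neutral ballI) auto
        then show False using nz by simp
      qed
      then show ?thesis using shape_h by blast
    qed
    have "coef g \<mu> \<noteq> 0" using f(2) by (simp add: cg)
    then obtain m0 where m0: "m0 \<in> keys g" "shape m0 = \<mu>" by (rule coef_nonzeroE)
    \<comment> \<open>A witness that \<open>\<mu>'\<close> is attained: the positions in
      \<open>m0\<close> that carry the parts \<open>T\<close>.\<close>
    have "T \<subseteq># image_mset (lookup m0) (mset_set (keys m0))"
      using m0(2) by (simp add: shape_def[symmetric] \<mu>_def)
    then obtain A0 where A0: "A0 \<subseteq> keys m0" "T = image_mset (lookup m0) (mset_set A0)"
      by (rule submset_image_mset_set) simp
    have A0\<A>: "A0 \<in> \<A>" using A0 kn[OF m0(1)] by (auto simp: \<A>_def)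
    have finA0: "finite A0" by (rule finite_subset[OF A0(1)]) simp
    have "mset_set ((keys m0 - A0) \<union> A0) = mset_set (keys m0 - A0) + mset_set A0"
      by (rule mset_set_Union) (use finA0 in auto)
    moreover have "(keys m0 - A0) \<union> A0 = keys m0" using A0(1) by blast
    ultimately have "mset_set (keys m0) = mset_set (keys m0 - A0) + mset_set A0" by simp
    then have "R + T = image_mset (lookup m0) (mset_set (keys m0 - A0)) + T"
      using m0(2) A0(2) by (simp add: shape_def \<mu>_def)
    then have hit: "shape (m0 + ind A0) = \<mu>'"
      unfolding ind_def shape_add_indicator[OF finA0 k] A0(2)[symmetric] \<mu>'_def by simp
    \<comment> \<open>All contributions to \<open>\<mu>'\<close> equal the one nonzero coefficient
      \<open>lookup g m0\<close>, so the coordinate is a positive count times it.\<close>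
    have "coef h \<mu>' = (\<Sum>m\<in>keys g. \<Sum>A\<in>\<A>. if shape (m + ind A) = \<mu>' then lookup g m0 else 0)"
      unfolding ch
    proof (intro sum.cong refl)
      fix m A assume "m \<in> keys g" "A \<in> \<A>"
      then show "(if shape (m + ind A) = \<mu>' then lookup g m else 0)
          = (if shape (m + ind A) = \<mu>' then lookup g m0 else 0)"
        using shape_h[of m A] same[of m m0] m0 by (cases "shape (m + ind A) = \<mu>'") simp_all
    qed
    also have "\<dots> = (\<Sum>x\<in>keys g \<times> \<A>. if shape (fst x + ind (snd x)) = \<mu>' then lookup g m0 else 0)"
      by (simp add: sum.cartesian_product case_prod_beta)
    also have "\<dots> = of_nat (card {x \<in> keys g \<times> \<A>. shape (fst x + ind (snd x)) = \<mu>'}) * lookup g m0"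
      by (rule sum_if_const) (simp add: fin\<A>)
    also have "\<dots> \<noteq> 0"
    proof -
      have "(m0, A0) \<in> {x \<in> keys g \<times> \<A>. shape (fst x + ind (snd x)) = \<mu>'}"
        using m0 A0\<A> hit by simp
      moreover have "finite {x \<in> keys g \<times> \<A>. shape (fst x + ind (snd x)) = \<mu>'}"
        by (simp add: fin\<A>)
      ultimately have "card {x \<in> keys g \<times> \<A>. shape (fst x + ind (snd x)) = \<mu>'} > 0"
        unfolding card_gt_0_iff by blast
      moreover have "lookup g m0 \<noteq> 0" using m0 by (simp add: in_keys_iff)
      ultimately show ?thesis by simp
    qed
    finally show "coef h \<mu>' \<noteq> 0" .
  qed
qed

end

lemma image_nth_mset_set: "image_mset ((!) xs) (mset_set {..<length xs}) = mset xs"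
proof -
  have "mset_set {..<length xs} = mset [0..<length xs]" by (simp add: lessThan_atLeast0)
  then have "image_mset ((!) xs) (mset_set {..<length xs}) = mset (map ((!) xs) [0..<length xs])" by simp
  then show ?thesis by (simp only: map_nth)
qed

lemma ex_submultiset_size:
  assumes "n \<le> size A" obtains B where "B \<subseteq># A" "size B = n"
proof -
  obtain xs where xs: "mset xs = A" using ex_mset by blast
  have "mset (take n xs) + mset (drop n xs) = A"
    unfolding xs[symmetric] mset_append[symmetric] append_take_drop_id ..
  then have "mset (take n xs) \<subseteq># A" by (metis mset_subset_eq_add_left)
  moreover have "size (mset (take n xs)) = n" using assms by (simp add: xs[symmetric])
  ultimately show ?thesis by (rule that)
qed

context sym_hom_ideal
begin

text \<open>Expand the binomial. Up to the common parts \<open>\<rho>\<close>, the term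
  \<open>i = 0\<close> has the single part \<open>a + p * k\<close>, and the term
  \<open>i > 0\<close> has the two parts \<open>p * i\<close> and \<open>p * (k - i) + a\<close>.
  The latter part is large, since \<open>a \<ge> k\<close>. If \<open>p * i \<ge> k\<close>, there
  is one more large part; otherwise the numbers of large parts agree and both parts are smaller than
  \<open>a + p * k\<close>. Either way the term \<open>i = 0\<close> leads.\<close>

lemma leading_large:
  fixes p q k a :: nat
  assumes mem: "(var 0 ^ p - var 1 ^ p) ^ k * (\<Prod>l<Suc q. var (l + 2) ^ k) \<in> I"
    and pos: "p > 0" "k > 0"
    and a: "a \<ge> k" and \<rho>: "size \<rho> = Suc q" "\<forall>x\<in>#\<rho>. k \<le> x"
  shows "add_mset (a + p * k) \<rho> \<in> leading k"
proof -
  obtain rs where rs: "mset rs = \<rho>" using ex_mset by blast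
  have len: "length rs = Suc q" using rs \<rho>(1) by (metis size_mset)
  have rk: "k \<le> rs ! l" if "l < Suc q" for l
    using that rs \<rho>(2) len by (metis nth_mem set_mset_mset)
  define v where "v = (\<Sum>l<Suc q. mon (l + 2) (rs ! l))"
  have v: "keys v \<subseteq> {2..<Suc q + 2}" "shape v = \<rho>"
    using shape_sum_mon[of "Suc q" "(!) rs"] rk pos(2) image_nth_mset_set[of rs]
    unfolding v_def len rs by (metis less_le_trans)+
  define mm where "mm i = mon 0 (p * i) + mon 1 (p * (k - i) + a) + v" for i
  define cc where "cc i = (of_nat (k choose i) * (- 1) ^ (k - i) :: 'k)" for i
  \<comment> \<open>The cofactor that lifts the exponents \<open>k\<close> of the variables from 2
    on to the prescribed parts \<open>rs\<close> and supplies \<open>a\<close> to variable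
    1.\<close>
  define w where "w = mon 1 a + (\<Sum>l<Suc q. mon (l + 2) (rs ! l - k))"
  define F where "F = ((var 0 ^ p - var 1 ^ p) ^ k * (\<Prod>l<Suc q. var (l + 2) ^ k)) * (mon w 1 :: 'k inf_poly)"
  have FI: "F \<in> I" unfolding F_def by (rule I_mult[OF mem])
  have binom: "((var 0 ^ p - var 1 ^ p) ^ k :: 'k inf_poly)
      = (\<Sum>i\<le>k. mon (mon 0 (p * i) + mon 1 (p * (k - i))) (cc i))"
  proof -
    have "((var 0 ^ p - var 1 ^ p) ^ k :: 'k inf_poly) = (var 0 ^ p + - (var 1 ^ p)) ^ k" by simp
    also have "\<dots> = (\<Sum>i\<le>k. of_nat (k choose i) * (var 0 ^ p) ^ i * (- (var 1 ^ p)) ^ (k - i))"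
      by (rule binomial_ring)
    also have "\<dots> = (\<Sum>i\<le>k. mon (mon 0 (p * i) + mon 1 (p * (k - i))) (cc i))"
    proof (rule sum.cong[OF refl])
      fix i
      have "(- (var 1 ^ p)) ^ (k - i) = (const ((- 1) ^ (k - i)) * var 1 ^ (p * (k - i)) :: 'k inf_poly)"
      proof -
        have "const ((- 1) ^ j) = ((- 1) ^ j :: 'k inf_poly)" for j
          by (cases "even j") (simp_all add: const_def single_uminus)
        then show ?thesis by (subst power_minus) (simp add: power_mult)
      qed
      moreover have "(of_nat (k choose i) :: 'k inf_poly) = const (of_nat (k choose i))"
        by (simp add: const_def)
      moreover have "(var 0 ^ p) ^ i = (var 0 ^ (p * i) :: 'k inf_poly)" by (simp add: power_mult)
      ultimately show "of_nat (k choose i) * (var 0 ^ p) ^ i * (- (var 1 ^ p)) ^ (k - i)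
          = (mon (mon 0 (p * i) + mon 1 (p * (k - i))) (cc i) :: 'k inf_poly)"
        by (simp only: var_power const_def mult_single cc_def) (simp add: ac_simps)
    qed
    finally show ?thesis .
  qed
  have prod: "(\<Prod>l<Suc q. var (l + 2) ^ k) * mon w 1 = (mon (mon 1 a + v) 1 :: 'k inf_poly)"
  proof -
    have sv: "(\<Sum>l<Suc q. mon (l + 2) k) + (\<Sum>l<Suc q. mon (l + 2) (rs ! l - k)) = v"
      unfolding v_def sum.distrib[symmetric]
    proof (rule sum.cong[OF refl])
      fix l assume "l \<in> {..<Suc q}"
      then show "mon (l + 2) k + mon (l + 2) (rs ! l - k) = mon (l + 2) (rs ! l)"
        using rk[of l] by (simp only: single_add[symmetric] le_add_diff_inverse lessThan_iff)
    qed
    have e: "(\<Sum>l<Suc q. mon (l + 2) k) + w = mon 1 a + v"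
      unfolding w_def sv[symmetric] by (rule add.left_commute)
    show ?thesis by (simp only: var_power prod_mon mult_single e mult_1)
  qed
  have "F = (\<Sum>i\<le>k. mon (mm i) (cc i))"
    unfolding F_def mult.assoc prod unfolding binom sum_distrib_right
  proof (rule sum.cong[OF refl])
    fix i
    have "mon 0 (p * i) + mon 1 (p * (k - i)) + (mon 1 a + v) = mm i"
      unfolding mm_def by (simp only: single_add ac_simps)
    then show "mon (mon 0 (p * i) + mon 1 (p * (k - i))) (cc i) * mon (mon 1 a + v) 1 = mon (mm i) (cc i)"
      by (simp only: mult_single mult_1_right)
  qed
  then have cF: "coef F \<nu> = (\<Sum>i\<le>k. if shape (mm i) = \<nu> then cc i else 0)" for \<nu>
    by (simp only: coef_sum coef_mon)
  have shape_mm: "shape (mm i) = (if i = 0 then {#} else {#p * i#}) + {#p * (k - i) + a#} + \<rho>" for i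
  proof -
    have a0: "p * (k - i) + a \<noteq> 0" using a pos(2) by simp
    have pi: "p * i = 0 \<longleftrightarrow> i = 0" using pos(1) by simp
    have d1: "keys (mon 0 (p * i)) \<inter> keys (mon (1::nat) (p * (k - i) + a)) = {}" by simp
    have d2: "keys (mon 0 (p * i) + mon 1 (p * (k - i) + a)) \<inter> keys v = {}"
      unfolding keys_add_nat using v(1) by (auto split: if_splits)
    show ?thesis
      unfolding mm_def shape_add_disjoint[OF d2] shape_add_disjoint[OF d1] v(2) shape_single
      using a0 pi by (simp only: if_False)
  qed
  define \<mu> where "\<mu> = add_mset (a + p * k) \<rho>"
  have mm0: "shape (mm 0) = \<mu>" by (simp add: shape_mm \<mu>_def add.commute)
  have below_mm: "below k (shape (mm i)) \<mu>" if i: "0 < i" "i \<le> k" for i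
  proof (cases "k \<le> p * i")
    case True
    then show ?thesis using i a by (simp add: below_def shape_mm \<mu>_def)
  next
    case False
    have "p * (k - i) < p * k" using i pos by simp
    moreover have "p * i \<le> p * k" using i by simp
    \<comment> \<open>One element dominates both: \<open>p * i < k \<le> a\<close> and
      \<open>p * (k - i) < p * k\<close>.\<close>
    ultimately have "{#p * i, p * (k - i) + a#} < {#a + p * k#}" using False a by auto
    then have "{#p * i, p * (k - i) + a#} + \<rho> < {#a + p * k#} + \<rho>" by (rule add_strict_right_mono)
    moreover have "shape (mm i) = {#p * i, p * (k - i) + a#} + \<rho>" using i by (simp add: shape_mm)
    moreover have "big k ({#p * i, p * (k - i) + a#} + \<rho>) = big k ({#a + p * k#} + \<rho>)"
      using False a by simp
    ultimately show ?thesis unfolding below_def \<mu>_def by simp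
  qed
  have c\<mu>: "coef F \<mu> = cc 0"
  proof -
    have "coef F \<mu> = (\<Sum>i\<le>k. if i = 0 then cc i else 0)"
      unfolding cF
    proof (rule sum.cong[OF refl])
      fix i assume "i \<in> {..k}"
      then show "(if shape (mm i) = \<mu> then cc i else 0) = (if i = 0 then cc i else 0)"
        using mm0 below_mm[of i] by (cases "i = 0") auto
    qed
    then show ?thesis by simp
  qed
  show ?thesis
    unfolding \<mu>_def[symmetric]
  proof (rule leadingI[OF FI])
    show "coef F \<mu> \<noteq> 0" by (simp add: c\<mu> cc_def)
    fix \<nu> assume nz: "coef F \<nu> \<noteq> 0"
    have "\<exists>i\<le>k. shape (mm i) = \<nu>"
    proof (rule ccontr)
      assume "\<not> ?thesis"
      then have "coef F \<nu> = 0" unfolding cF by (intro sum.neutral ballI) auto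
      then show False using nz by simp
    qed
    then obtain i where "i \<le> k" "shape (mm i) = \<nu>" by blast
    then show "\<nu> = \<mu> \<or> below k \<nu> \<mu>"
      using mm0 below_mm[of i] by (cases "i = 0") auto
  qed
qed

lemma leading_many_large:
  fixes p q k :: nat
  assumes mem: "(var 0 ^ p - var 1 ^ p) ^ k * (\<Prod>l<Suc q. var (l + 2) ^ k) \<in> I"
    and pos: "p > 0" "k > 0" and \<mu>: "0 \<notin># \<mu>" "q + 2 \<le> big k \<mu>" "x \<in># \<mu>" "k + p * k \<le> x"
  shows "\<mu> \<in> leading k"
proof -
  obtain \<nu> where \<nu>: "\<mu> = add_mset x \<nu>" using \<mu>(3) by (meson multi_member_split)
  have "k \<le> x" using \<mu>(4) by linarith
  then have "Suc q \<le> size (filter_mset (\<lambda>x. k \<le> x) \<nu>)"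
    using \<mu>(2) by (simp add: \<nu> big_def)
  then obtain \<rho> where \<rho>: "\<rho> \<subseteq># filter_mset (\<lambda>x. k \<le> x) \<nu>" "size \<rho> = Suc q"
    by (rule ex_submultiset_size)
  have "\<forall>x\<in>#\<rho>. k \<le> x" using mset_subset_eqD[OF \<rho>(1)] by auto
  \<comment> \<open>The role of \<open>a\<close> is played by \<open>x - p * k\<close>, which is at
    least \<open>k\<close> by the bound on \<open>x\<close>. Parts outside \<open>\<rho>\<close> are
    put back by \<open>leading_add\<close>.\<close>
  then have "add_mset ((x - p * k) + p * k) \<rho> \<in> leading k"
    using \<mu>(4) by (intro leading_large[OF mem pos _ \<rho>(2)]) auto
  then have "add_mset x \<rho> \<in> leading k" using \<mu>(4) by simp
  moreover have "\<rho> \<subseteq># \<nu>" using \<rho>(1) multiset_filter_subset subset_mset.order_trans by blast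
  then obtain \<tau> where \<tau>: "\<nu> = \<rho> + \<tau>" by (metis subset_mset.add_diff_inverse)
  moreover have "0 \<notin># \<tau>" using \<mu>(1) by (simp add: \<nu> \<tau>)
  ultimately have "add_mset x \<rho> + \<tau> \<in> leading k" by (intro leading_add)
  then show ?thesis by (simp add: \<nu> \<tau>)
qed

text \<open>Otherwise the greatest partition in the support would itself be leading. This is the
  linear independence of nonleading partitions modulo \<open>I\<close>.\<close>

lemma nonleading_coef_unique:
  assumes "f \<in> I" "\<And>\<nu>. \<nu> \<in> leading k \<Longrightarrow> coef f \<nu> = 0"
  shows "coef f \<nu> = 0"
proof (rule ccontr)
  assume "coef f \<nu> \<noteq> 0"
  then have "{\<mu>. coef f \<mu> \<noteq> 0} \<noteq> {}" by blast
  from below_max[OF finite_coef_support this]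
  obtain \<mu> where "coef f \<mu> \<noteq> 0" "\<And>\<nu>. coef f \<nu> \<noteq> 0 \<Longrightarrow> \<nu> = \<mu> \<or> below k \<nu> \<mu>" by blast
  then have "\<mu> \<in> leading k" by (rule leadingI[OF assms(1)])
  then show False using assms(2) \<open>coef f \<mu> \<noteq> 0\<close> by blast
qed

lemma leading_homogeneous:
  assumes "\<mu> \<in> leading k" "sum_mset \<mu> = d"
  obtains f where "f \<in> I" "homogeneous d f" "coef f \<mu> \<noteq> 0"
    "\<And>\<nu>. coef f \<nu> \<noteq> 0 \<Longrightarrow> \<nu> = \<mu> \<or> below k \<nu> \<mu>"
proof -
  obtain f where f: "f \<in> I" "coef f \<mu> \<noteq> 0" "\<And>\<nu>. coef f \<nu> \<noteq> 0 \<Longrightarrow> \<nu> = \<mu> \<or> below k \<nu> \<mu>"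
    using assms(1) unfolding leading_def mem_Collect_eq by blast
  show ?thesis
  proof (rule that[of "homogeneous_part d f"])
    show "homogeneous_part d f \<in> I" by (rule I_hom[OF f(1)])
    show "homogeneous d (homogeneous_part d f)" by (rule homogeneous_homogeneous_part)
    show "coef (homogeneous_part d f) \<mu> \<noteq> 0" using f(2) assms(2) by (simp add: coef_homogeneous_part)
    show "\<nu> = \<mu> \<or> below k \<nu> \<mu>" if "coef (homogeneous_part d f) \<nu> \<noteq> 0" for \<nu>
      using that f(3)[of \<nu>] by (simp add: coef_homogeneous_part split: if_splits)
  qed
qed

text \<open>Division by leading terms in degree \<open>d\<close>. Only finitely many leading
  partitions have this degree, and one fixed element of \<open>I\<close> for each suffices; these
  use finitely many variables. So one \<open>n0\<close> serves all \<open>f\<close>, and this is why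
  the dimensions become stationary.\<close>

lemma reduce_leading:
  "\<exists>n0. \<forall>n\<ge>n0. \<forall>f. f \<in> polys_in n \<longrightarrow> homogeneous d f \<longrightarrow>
     (\<exists>h\<in>I. h \<in> polys_in n \<and> homogeneous d h \<and> (\<forall>\<nu>\<in>leading k. coef (f - h) \<nu> = 0))"
proof -
  define L where "L = {\<mu> \<in> leading k. sum_mset \<mu> = d}"
  have finL: "finite L"
    by (rule finite_subset[OF _ finite_partitions[of d]]) (use leading_no_zero in \<open>auto simp: L_def\<close>)
  have "\<forall>\<mu>\<in>L. \<exists>g. g \<in> I \<and> homogeneous d g \<and> coef g \<mu> \<noteq> 0 \<and>
      (\<forall>\<nu>. coef g \<nu> \<noteq> 0 \<longrightarrow> \<nu> = \<mu> \<or> below k \<nu> \<mu>)"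
  proof
    fix \<mu> assume "\<mu> \<in> L"
    then have "\<mu> \<in> leading k" "sum_mset \<mu> = d" by (simp_all add: L_def)
    then show "\<exists>g. g \<in> I \<and> homogeneous d g \<and> coef g \<mu> \<noteq> 0 \<and>
      (\<forall>\<nu>. coef g \<nu> \<noteq> 0 \<longrightarrow> \<nu> = \<mu> \<or> below k \<nu> \<mu>)"
      by (rule leading_homogeneous) blast
  qed
  from bchoice[OF this] obtain G where G: "\<And>\<mu>. \<mu> \<in> L \<Longrightarrow> G \<mu> \<in> I" "\<And>\<mu>. \<mu> \<in> L \<Longrightarrow> homogeneous d (G \<mu>)"
    "\<And>\<mu>. \<mu> \<in> L \<Longrightarrow> coef (G \<mu>) \<mu> \<noteq> 0"
    "\<And>\<mu> \<nu>. \<mu> \<in> L \<Longrightarrow> coef (G \<mu>) \<nu> \<noteq> 0 \<Longrightarrow> \<nu> = \<mu> \<or> below k \<nu> \<mu>" by metis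
  define N where "N \<mu> = (SOME n. G \<mu> \<in> polys_in n)" for \<mu>
  have N: "G \<mu> \<in> polys_in (N \<mu>)" for \<mu> unfolding N_def by (rule someI_ex[OF ex_polys_in])
  \<comment> \<open>The sum is a convenient common upper bound of the finitely many
    \<open>N \<mu>\<close>.\<close>
  define n0 where "n0 = (\<Sum>\<mu>\<in>L. N \<mu>)"
  have n0: "G \<mu> \<in> polys_in n" if "\<mu> \<in> L" "n0 \<le> n" for \<mu> n
  proof (rule polys_in_mono[OF _ N])
    have "N \<mu> \<le> n0" unfolding n0_def using finL that(1) by (intro member_le_sum) auto
    then show "N \<mu> \<le> n" using that(2) by simp
  qed
  \<comment> \<open>The downward closure, inside \<open>L\<close>, of the leading partitions still
    present in \<open>f\<close>. The support alone need not shrink, since subtracting a multiple of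
    \<open>G \<mu>\<close> may create new lower terms.\<close>
  define S where "S f = {\<nu> \<in> L. \<exists>\<nu>'\<in>L. coef f \<nu>' \<noteq> 0 \<and> (\<nu> = \<nu>' \<or> below k \<nu> \<nu>')}" for f :: "'k inf_poly"
  have "\<exists>h\<in>I. h \<in> polys_in n \<and> homogeneous d h \<and> (\<forall>\<nu>\<in>leading k. coef (f - h) \<nu> = 0)"
    if n: "n0 \<le> n" and "f \<in> polys_in n" "homogeneous d f" for n f
    using that(2,3)
  proof (induction "card (S f)" arbitrary: f rule: less_induct)
    case less
    show ?case
    proof (cases "\<exists>\<nu>\<in>L. coef f \<nu> \<noteq> 0")
      case False
      have "coef f \<nu> = 0" if "\<nu> \<in> leading k" for \<nu>
        using False that coef_homogeneous[OF less.prems(2), of \<nu>] by (auto simp: L_def)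
      then show ?thesis
        by (intro bexI[of _ 0]) (auto simp: I_0 polys_in_0 homogeneous_0)
    next
      case True
      then have ne: "{\<nu> \<in> L. coef f \<nu> \<noteq> 0} \<noteq> {}" by blast
      have "finite {\<nu> \<in> L. coef f \<nu> \<noteq> 0}" using finL by simp
      from below_max[OF this ne, of k] obtain \<mu> where \<mu>: "\<mu> \<in> L" "coef f \<mu> \<noteq> 0"
        and max: "\<And>\<nu>. \<nu> \<in> L \<Longrightarrow> coef f \<nu> \<noteq> 0 \<Longrightarrow> \<nu> = \<mu> \<or> below k \<nu> \<mu>" by auto
      define g where "g = const (coef f \<mu> / coef (G \<mu>) \<mu>) * G \<mu>"
      have g: "g \<in> I" "g \<in> polys_in n" "homogeneous d g"
        unfolding g_def
        by (auto intro: I_mult_left G(1) polys_in_mult polys_in_const n0 homogeneous_const_mult G(2) \<mu> n)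
      have cg: "coef g \<nu> = coef f \<mu> / coef (G \<mu>) \<mu> * coef (G \<mu>) \<nu>" for \<nu>
        by (simp only: g_def coef_const_mult)
      have c0: "coef (f - g) \<mu> = 0" using G(3)[OF \<mu>(1)] by (simp add: coef_diff cg)
      have c1: "below k \<nu> \<mu>" if "\<nu> \<in> L" "coef (f - g) \<nu> \<noteq> 0" for \<nu>
      proof -
        have "\<nu> \<noteq> \<mu>" using that(2) c0 by blast
        moreover have "coef f \<nu> \<noteq> 0 \<or> coef (G \<mu>) \<nu> \<noteq> 0" using that(2) by (auto simp: coef_diff cg)
        ultimately show ?thesis using max[OF that(1)] G(4)[OF \<mu>(1)] by metis
      qed
      have "S (f - g) \<subset> S f"
      proof
        show "S (f - g) \<subseteq> S f"
        proof
          fix \<nu> assume "\<nu> \<in> S (f - g)"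
          then obtain \<nu>' where \<nu>: "\<nu> \<in> L" "\<nu>' \<in> L" "coef (f - g) \<nu>' \<noteq> 0" "\<nu> = \<nu>' \<or> below k \<nu> \<nu>'"
            unfolding S_def mem_Collect_eq by metis
          have "below k \<nu> \<mu>" using c1[OF \<nu>(2,3)] \<nu>(4) below_trans[of k \<nu> \<nu>' \<mu>] by metis
          then show "\<nu> \<in> S f" using \<mu> \<nu>(1) unfolding S_def mem_Collect_eq by metis
        qed
        have "\<mu> \<in> S f" using \<mu> unfolding S_def mem_Collect_eq by metis
        moreover have "\<mu> \<notin> S (f - g)"
        proof
          assume "\<mu> \<in> S (f - g)"
          then obtain \<nu>' where \<nu>: "\<nu>' \<in> L" "coef (f - g) \<nu>' \<noteq> 0" "\<mu> = \<nu>' \<or> below k \<mu> \<nu>'"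
            unfolding S_def mem_Collect_eq by metis
          have "below k \<mu> \<mu>" using c1[OF \<nu>(1,2)] \<nu>(3) below_trans[of k \<mu> \<nu>' \<mu>] by metis
          then show False by simp
        qed
        ultimately show "S (f - g) \<noteq> S f" by blast
      qed
      then have "card (S (f - g)) < card (S f)" using finL by (intro psubset_card_mono) (auto simp: S_def)
      moreover have "f - g \<in> polys_in n" by (rule polys_in_diff[OF less.prems(1) g(2)])
      moreover have "homogeneous d (f - g)"
        using homogeneous_add[OF less.prems(2) homogeneous_uminus[OF g(3)]] by simp
      ultimately obtain h where h: "h \<in> I" "h \<in> polys_in n" "homogeneous d h"
        "\<forall>\<nu>\<in>leading k. coef (f - g - h) \<nu> = 0"
        using less.hyps[of "f - g"] by metis
      have "\<forall>\<nu>\<in>leading k. coef (f - (g + h)) \<nu> = 0" using h(4) by (simp add: algebra_simps)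
      then show ?thesis
        using I_add[OF g(1) h(1)] polys_in_add[OF g(2) h(2)] homogeneous_add[OF g(3) h(3)] by metis
    qed
  qed
  then show ?thesis by metis
qed

end

section \<open>The generating function of the nonleading partitions\<close>

context sym_hom_ideal
begin

definition standard :: "nat \<Rightarrow> nat multiset set" where
  "standard k = {\<mu>. 0 \<notin># \<mu> \<and> \<mu> \<notin> leading k}"

text \<open>All partitions with \<open>j\<close> large parts, and the leading ones among them, both
  satisfy the closure conditions with \<open>K = M = k\<close>; the set in question is their
  difference.\<close>

lemma rational_gf_big_eq:
  assumes k: "k > 0"
  shows "rational_fps (gf sum_mset {\<mu>. 0 \<notin># \<mu> \<and> big k \<mu> = j \<and> \<mu> \<notin> leading k})"
proof -
  let ?P = "{\<mu>. 0 \<notin># \<mu> \<and> big k \<mu> = j}" and ?L = "{\<mu> \<in> leading k. 0 \<notin># \<mu> \<and> big k \<mu> = j}"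
  have big_raise: "big k (image_mset (\<lambda>x. x + k) T) = big k T" if "\<forall>x\<in>#T. k \<le> x" for T
    using big_all[of "image_mset (\<lambda>x. x + k) T" k] big_all[OF that] by simp
  have P: "rational_fps (gf sum_mset ?P)"
  proof (rule rational_gf_partitions[OF k k, of _ j])
    show "add_mset e \<mu> \<in> ?P" if "\<mu> \<in> ?P" "0 < e" "e < k" for \<mu> e using that by simp
    show "A + image_mset (\<lambda>x. x + k) T \<in> ?P" if "A + T \<in> ?P" "\<forall>x\<in>#T. k \<le> x" for A T
      using that big_raise[OF that(2)] k by auto
  qed simp
  have L: "rational_fps (gf sum_mset ?L)"
  proof (rule rational_gf_partitions[OF k k, of _ j])
    show "add_mset e \<mu> \<in> ?L" if "\<mu> \<in> ?L" "0 < e" "e < k" for \<mu> e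
      using that leading_add_mset by simp
    show "A + image_mset (\<lambda>x. x + k) T \<in> ?L"
      if "A + T \<in> ?L" "\<forall>x\<in>#T. k \<le> x" "\<forall>x\<in>#T. \<forall>y\<in>#A. y \<le> x" for A T
      using that(1) big_raise[OF that(2)] k leading_raise[OF _ k that(2,3)] by auto
  qed simp
  have fin: "finite {\<mu> \<in> ?P. sum_mset \<mu> = d}" for d
    by (rule finite_subset[OF _ finite_partitions[of d]]) auto
  have "gf sum_mset (?P - ?L) = gf sum_mset ?P - gf sum_mset ?L"
    by (rule gf_Diff[OF fin]) auto
  moreover have "?P - ?L = {\<mu>. 0 \<notin># \<mu> \<and> big k \<mu> = j \<and> \<mu> \<notin> leading k}" by auto
  ultimately show ?thesis using rational_fps_diff[OF P L] by simp
qed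

text \<open>Encoding with threshold \<open>B\<close> leaves no part to raise, so the raising
  condition holds only for empty \<open>T\<close> and is trivial. Adding parts below
  \<open>B\<close> preserves leadingness and the lower bound on \<open>big k\<close>.\<close>

lemma rational_gf_bounded_parts:
  assumes B: "B > 0"
  shows "rational_fps (gf sum_mset
    {\<mu>. 0 \<notin># \<mu> \<and> q \<le> big k \<mu> \<and> (\<forall>x\<in>#\<mu>. x < B) \<and> \<mu> \<notin> leading k})"
proof -
  let ?P = "{\<mu>. 0 \<notin># \<mu> \<and> q \<le> big k \<mu> \<and> (\<forall>x\<in>#\<mu>. x < B)}"
  let ?L = "{\<mu> \<in> leading k. 0 \<notin># \<mu> \<and> q \<le> big k \<mu> \<and> (\<forall>x\<in>#\<mu>. x < B)}"
  have T: "T = {#}" if "\<forall>x\<in>#A + T. x < B" "\<forall>x\<in>#T. B \<le> x" for A T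
  proof (rule ccontr)
    assume "T \<noteq> {#}"
    then obtain x where "x \<in># T" by blast
    then have "x < B" "B \<le> x" using that by auto
    then show False by simp
  qed
  have P: "rational_fps (gf sum_mset ?P)"
  proof (rule rational_gf_partitions[OF B B, of _ 0])
    show "0 \<notin># \<mu> \<and> big B \<mu> = 0" if "\<mu> \<in> ?P" for \<mu> using that big_0I[of \<mu> B] by simp
    show "add_mset e \<mu> \<in> ?P" if "\<mu> \<in> ?P" "0 < e" "e < B" for \<mu> e using that by simp
    show "A + image_mset (\<lambda>x. x + B) T \<in> ?P" if "A + T \<in> ?P" "\<forall>x\<in>#T. B \<le> x" for A T
      using that(1) T[OF _ that(2), of A] by simp
  qed
  have L: "rational_fps (gf sum_mset ?L)"
  proof (rule rational_gf_partitions[OF B B, of _ 0])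
    show "0 \<notin># \<mu> \<and> big B \<mu> = 0" if "\<mu> \<in> ?L" for \<mu> using that big_0I[of \<mu> B] by simp
    show "add_mset e \<mu> \<in> ?L" if "\<mu> \<in> ?L" "0 < e" "e < B" for \<mu> e
      using that leading_add_mset by simp
    show "A + image_mset (\<lambda>x. x + B) T \<in> ?L" if "A + T \<in> ?L" "\<forall>x\<in>#T. B \<le> x" for A T
      using that(1) T[OF _ that(2), of A] by simp
  qed
  have fin: "finite {\<mu> \<in> ?P. sum_mset \<mu> = d}" for d
    by (rule finite_subset[OF _ finite_partitions[of d]]) auto
  have "gf sum_mset (?P - ?L) = gf sum_mset ?P - gf sum_mset ?L"
    by (rule gf_Diff[OF fin]) auto
  moreover have "?P - ?L = {\<mu>. 0 \<notin># \<mu> \<and> q \<le> big k \<mu> \<and> (\<forall>x\<in>#\<mu>. x < B) \<and> \<mu> \<notin> leading k}" by auto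
  ultimately show ?thesis using rational_fps_diff[OF P L] by simp
qed

theorem rational_gf_standard:
  assumes mem: "(var 0 ^ p - var 1 ^ p) ^ k * (\<Prod>l<Suc q. var (l + 2) ^ k) \<in> I"
    and pos: "p > 0" "k > 0"
  shows "rational_fps (gf sum_mset (standard k))"
proof -
  define P where "P j = {\<mu>. 0 \<notin># \<mu> \<and> big k \<mu> = j \<and> \<mu> \<notin> leading k}" for j
  define Q where "Q = {\<mu>. 0 \<notin># \<mu> \<and> q + 2 \<le> big k \<mu> \<and> (\<forall>x\<in>#\<mu>. x < k + p * k) \<and> \<mu> \<notin> leading k}"
  have fin: "finite {\<mu> \<in> A. sum_mset \<mu> = d}" if "A \<subseteq> {\<mu>. 0 \<notin># \<mu>}" for A and d :: nat
    by (rule finite_subset[OF _ finite_partitions[of d]]) (use that in auto)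
  have "standard k = (\<Union>j<q + 2. P j) \<union> Q"
  proof (intro equalityI subsetI)
    fix \<mu> assume \<mu>: "\<mu> \<in> standard k"
    show "\<mu> \<in> (\<Union>j<q + 2. P j) \<union> Q"
    proof (cases "big k \<mu> < q + 2")
      case True
      then show ?thesis using \<mu> by (auto simp: standard_def P_def)
    next
      case False
      then have "x < k + p * k" if "x \<in># \<mu>" for x
        using leading_many_large[OF mem pos, of \<mu> x] that \<mu> by (force simp: standard_def)
      then show ?thesis using \<mu> False by (simp add: standard_def Q_def)
    qed
  qed (auto simp: standard_def P_def Q_def)
  moreover have "gf sum_mset ((\<Union>j<q + 2. P j) \<union> Q) = gf sum_mset (\<Union>j<q + 2. P j) + gf sum_mset Q"
    by (rule gf_Un_disjoint; (rule fin)?) (auto simp: P_def Q_def)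
  moreover have "gf sum_mset (\<Union>j<q + 2. P j) = (\<Sum>j<q + 2. gf sum_mset (P j))"
    by (rule gf_UN_disjoint; (rule fin)?) (auto simp: P_def)
  moreover have "rational_fps (gf sum_mset (P j))" for j
    unfolding P_def by (rule rational_gf_big_eq[OF pos(2)])
  moreover have "rational_fps (gf sum_mset Q)"
    unfolding Q_def by (rule rational_gf_bounded_parts) (use pos in simp)
  ultimately show ?thesis by (simp add: rational_fps_add rational_fps_sum)
qed

end

section \<open>A Nullstellensatz in countably many variables\<close>

definition is_ideal :: "'a::comm_ring_1 set \<Rightarrow> bool" where
  "is_ideal P \<longleftrightarrow> 0 \<in> P \<and> (\<forall>f\<in>P. \<forall>g\<in>P. f + g \<in> P) \<and> (\<forall>f\<in>P. \<forall>g. g * f \<in> P)"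

lemma is_ideal_simps:
  assumes "is_ideal P"
  shows "0 \<in> P" "f \<in> P \<Longrightarrow> g \<in> P \<Longrightarrow> f + g \<in> P" "f \<in> P \<Longrightarrow> g * f \<in> P" "f \<in> P \<Longrightarrow> f * g \<in> P"
    "f \<in> P \<Longrightarrow> - f \<in> P" "f \<in> P \<Longrightarrow> g \<in> P \<Longrightarrow> f - g \<in> P"
proof -
  show 1: "0 \<in> P" "f \<in> P \<Longrightarrow> g \<in> P \<Longrightarrow> f + g \<in> P" "f \<in> P \<Longrightarrow> g * f \<in> P" for f g
    using assms unfolding is_ideal_def by blast+
  show "f \<in> P \<Longrightarrow> f * g \<in> P" using 1(3)[of f g] by (simp add: mult.commute)
  show 2: "f \<in> P \<Longrightarrow> - f \<in> P" for f using 1(3)[of f "- 1"] by simp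
  show "f \<in> P \<Longrightarrow> g \<in> P \<Longrightarrow> f - g \<in> P" using 1(2)[OF _ 2, of f g] by simp
qed

lemma is_ideal_sum: "is_ideal P \<Longrightarrow> (\<And>a. a \<in> A \<Longrightarrow> F a \<in> P) \<Longrightarrow> (\<Sum>a\<in>A. F a) \<in> P"
  by (induction A rule: infinite_finite_induct) (auto simp: is_ideal_simps)

text \<open>Zorn's lemma for ideals that contain no power of \<open>f\<close>. Such a maximal
  \<open>P\<close> corresponds to a maximal ideal of the localization at \<open>f\<close>; the last
  property says that \<open>g\<close> outside \<open>P\<close> becomes invertible there.\<close>

lemma ex_maximal_ideal_avoiding:
  assumes J: "is_ideal J" and f: "\<And>n. f ^ n \<notin> J"
  obtains P where "is_ideal P" "J \<subseteq> P" "\<And>n. f ^ n \<notin> P"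
    "\<And>g. g \<notin> P \<Longrightarrow> \<exists>n h. f ^ n - h * g \<in> P"
proof -
  define \<A> where "\<A> = {P. is_ideal P \<and> J \<subseteq> P \<and> (\<forall>n. f ^ n \<notin> P)}"
  have "\<exists>P\<in>\<A>. \<forall>Q\<in>\<A>. P \<subseteq> Q \<longrightarrow> Q = P"
  proof (rule subset_Zorn_nonempty)
    show "\<A> \<noteq> {}" using J f unfolding \<A>_def by blast
    fix C assume ne: "C \<noteq> {}" and ch: "subset.chain \<A> C"
    have CA: "C \<subseteq> \<A>" and tot: "P \<subseteq> Q \<or> Q \<subseteq> P" if "P \<in> C" "Q \<in> C" for P Q
      using ch that unfolding subset.chain_def by auto
    have ideal: "is_ideal P" if "P \<in> C" for P using CA that unfolding \<A>_def by blast
    obtain P0 where P0: "P0 \<in> C" using ne by blast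
    have "is_ideal (\<Union>C)"
      unfolding is_ideal_def
    proof (intro conjI ballI allI)
      show "0 \<in> \<Union>C" using P0 is_ideal_simps(1)[OF ideal[OF P0]] by blast
    next
      fix a b assume "a \<in> \<Union>C" "b \<in> \<Union>C"
      then obtain P Q where PQ: "P \<in> C" "a \<in> P" "Q \<in> C" "b \<in> Q" by blast
      have "\<exists>R\<in>C. a \<in> R \<and> b \<in> R" using tot[OF PQ(1,3)] PQ by blast
      then obtain R where "R \<in> C" "a \<in> R" "b \<in> R" by blast
      then show "a + b \<in> \<Union>C" using is_ideal_simps(2)[OF ideal] by blast
    next
      fix a b assume "a \<in> \<Union>C"
      then obtain P where "P \<in> C" "a \<in> P" by blast
      then show "b * a \<in> \<Union>C" using is_ideal_simps(3)[OF ideal] by blast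
    qed
    moreover have "J \<subseteq> \<Union>C" using P0 CA unfolding \<A>_def by blast
    moreover have "f ^ n \<notin> \<Union>C" for n using CA unfolding \<A>_def by blast
    ultimately show "\<Union>C \<in> \<A>" unfolding \<A>_def by blast
  qed
  then obtain P where P: "P \<in> \<A>" and max: "\<And>Q. Q \<in> \<A> \<Longrightarrow> P \<subseteq> Q \<Longrightarrow> Q = P" by blast
  have iP: "is_ideal P" and JP: "J \<subseteq> P" and fP: "\<And>n. f ^ n \<notin> P" using P unfolding \<A>_def by blast+
  note id = is_ideal_simps[OF iP]
  have "\<exists>n h. f ^ n - h * g \<in> P" if g: "g \<notin> P" for g
  proof (rule ccontr)
    assume no: "\<not> ?thesis"
    \<comment> \<open>The ideal generated by \<open>P\<close> and \<open>g\<close>.\<close>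
    define Q where "Q = {y. \<exists>h. y - h * g \<in> P}"
    have "is_ideal Q"
      unfolding is_ideal_def
    proof (intro conjI ballI allI)
      show "0 \<in> Q" unfolding Q_def using id(1) by (auto intro: exI[of _ 0])
    next
      fix a b assume "a \<in> Q" "b \<in> Q"
      then obtain h h' where "a - h * g \<in> P" "b - h' * g \<in> P" unfolding Q_def by blast
      then have "(a - h * g) + (b - h' * g) \<in> P" by (rule id(2))
      moreover have "(a - h * g) + (b - h' * g) = (a + b) - (h + h') * g" by (simp add: algebra_simps)
      ultimately show "a + b \<in> Q" unfolding Q_def by auto
    next
      fix a b assume "a \<in> Q"
      then obtain h where "a - h * g \<in> P" unfolding Q_def by blast
      then have "b * (a - h * g) \<in> P" by (rule id(3))
      moreover have "b * (a - h * g) = b * a - (b * h) * g" by (simp add: algebra_simps)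
      ultimately show "b * a \<in> Q" unfolding Q_def by auto
    qed
    moreover have PQ: "P \<subseteq> Q"
    proof
      fix y assume "y \<in> P"
      then have "y - 0 * g \<in> P" by simp
      then show "y \<in> Q" unfolding Q_def by blast
    qed
    moreover have "f ^ n \<notin> Q" for n using no unfolding Q_def by blast
    ultimately have "Q \<in> \<A>" using JP unfolding \<A>_def by blast
    then have "Q = P" using PQ by (rule max)
    moreover have "g \<in> Q"
    proof -
      have "g - 1 * g \<in> P" using id(1) by simp
      then show ?thesis unfolding Q_def by blast
    qed
    ultimately show False using g by simp
  qed
  then show ?thesis using that iP JP fP by blast
qed

text \<open>More vectors than coordinates are linearly dependent; Gaussian elimination removes one
  coordinate at a time.\<close>

lemma nontrivial_relation:
  fixes h :: "'c \<Rightarrow> 'm \<Rightarrow> 'a::field"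
  assumes "finite F" "finite T" "card F < card T"
  shows "\<exists>d. (\<exists>c\<in>T. d c \<noteq> 0) \<and> (\<forall>m\<in>F. (\<Sum>c\<in>T. d c * h c m) = 0)"
  using assms
proof (induction F arbitrary: T h rule: finite_induct)
  case empty
  then have "T \<noteq> {}" by auto
  then show ?case by (intro exI[of _ "\<lambda>_. 1"]) auto
next
  case (insert m F)
  show ?case
  proof (cases "\<forall>c\<in>T. h c m = 0")
    case True
    obtain d where "\<exists>c\<in>T. d c \<noteq> 0" "\<forall>m\<in>F. (\<Sum>c\<in>T. d c * h c m) = 0"
      using insert.IH[of T h] insert.prems insert.hyps by auto
    then show ?thesis using True by (intro exI[of _ d]) auto
  next
    case False
    then obtain c0 where c0: "c0 \<in> T" "h c0 m \<noteq> 0" by blast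
    define T' where "T' = T - {c0}"
    define h' where "h' c m' = h c m' - h c m / h c0 m * h c0 m'" for c m'
    have T: "T = insert c0 T'" "c0 \<notin> T'" "finite T'" using c0 insert.prems(1) by (auto simp: T'_def)
    have "card F < card T'" using insert.prems(2) insert.hyps T by simp
    then obtain d where d: "\<exists>c\<in>T'. d c \<noteq> 0" "\<And>m'. m' \<in> F \<Longrightarrow> (\<Sum>c\<in>T'. d c * h' c m') = 0"
      using insert.IH[of T' h'] T(3) by auto
    \<comment> \<open>The coefficient of the pivot vector that turns a relation among the reduced
      vectors \<open>h'\<close> into one among the original vectors.\<close>
    define e where "e = - (\<Sum>c\<in>T'. d c * (h c m / h c0 m))"
    define d' where "d' = d(c0 := e)"
    have dT: "(\<Sum>c\<in>T'. d' c * y c) = (\<Sum>c\<in>T'. d c * y c)" for y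
      by (rule sum.cong) (use T(2) in \<open>auto simp: d'_def\<close>)
    have key: "(\<Sum>c\<in>T. d' c * h c m') = (\<Sum>c\<in>T'. d c * h' c m')" for m'
    proof -
      have "(\<Sum>c\<in>T. d' c * h c m') = e * h c0 m' + (\<Sum>c\<in>T'. d c * h c m')"
        unfolding T(1) using T(2,3) by (simp add: dT) (simp add: d'_def)
      also have "\<dots> = (\<Sum>c\<in>T'. d c * h' c m')"
        by (simp add: e_def h'_def right_diff_distrib sum_subtractf sum_distrib_right mult.assoc)
      finally show ?thesis .
    qed
    have "\<exists>c\<in>T. d' c \<noteq> 0" using d(1) T by (auto simp: d'_def)
    moreover have "(\<Sum>c\<in>T. d' c * h c m') = 0" if "m' \<in> insert m F" for m'
    proof (cases "m' = m")
      case True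
      have "h' c m = 0" for c using c0(2) by (simp add: h'_def)
      then show ?thesis unfolding key True by simp
    qed (use that d(2) key in auto)
    ultimately show ?thesis by (intro exI[of _ d']) blast
  qed
qed

lemma countable_exponents: "countable (UNIV :: (nat \<Rightarrow>\<^sub>0 nat) set)"
proof -
  have "(UNIV :: (nat \<Rightarrow>\<^sub>0 nat) set) \<subseteq> Poly_Mapping.nth ` (UNIV :: nat list set)"
    using Poly_Mapping.nth_idem by (metis rangeI subsetI)
  then show ?thesis by (rule countable_subset) simp
qed

lemma uncountable_fibre:
  assumes "uncountable (UNIV :: 'c set)" "countable (range F)"
  obtains y where "infinite {c :: 'c. F c = y}"
proof -
  have "\<exists>y. infinite {c. F c = y}"
  proof (rule ccontr)
    assume "\<not> ?thesis"
    then have "countable {c. F c = y}" for y by (simp add: countable_finite)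
    then have "countable (\<Union>y\<in>range F. {c. F c = y})" using assms(2) by (intro countable_UN) auto
    moreover have "(\<Union>y\<in>range F. {c. F c = y}) = UNIV" by auto
    ultimately show False using assms(1) by simp
  qed
  then show ?thesis using that by blast
qed

definition subst_poly :: "'a::comm_ring_1 inf_poly \<Rightarrow> 'a poly \<Rightarrow> 'a inf_poly" where
  "subst_poly x u = poly (map_poly const u) x"

lemma const_0 [simp]: "const 0 = 0" and const_1 [simp]: "const 1 = 1"
  and const_add: "const (a + b) = const a + const b"
  and const_mult: "const (a * b) = const a * const b"
  and const_uminus: "const (- c) = - const c"
  for a b :: "'a::comm_semiring_1" and c :: "'b::comm_ring_1"
  by (simp_all add: const_def single_add mult_single single_uminus)

lemma subst_poly_pCons: "subst_poly x (pCons a u) = const a + x * subst_poly x u"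
  by (simp add: subst_poly_def map_poly_pCons)

lemma subst_poly_0 [simp]: "subst_poly x 0 = 0"
  by (simp add: subst_poly_def)

lemma subst_poly_1 [simp]: "subst_poly x 1 = 1"
  by (simp add: one_pCons subst_poly_pCons)

lemma subst_poly_add: "subst_poly x (u + v) = subst_poly x u + subst_poly x v"
  by (induction u v rule: poly_induct2) (auto simp: subst_poly_pCons const_add algebra_simps)

lemma subst_poly_sum: "subst_poly x (\<Sum>a\<in>A. F a) = (\<Sum>a\<in>A. subst_poly x (F a))"
  by (induction A rule: infinite_finite_induct) (auto simp: subst_poly_add)

lemma subst_poly_smult: "subst_poly x (smult c u) = const c * subst_poly x u"
  by (induction u) (auto simp: subst_poly_pCons const_mult algebra_simps)

lemma subst_poly_linear: "subst_poly x ([:- c, 1:] * u) = (x - const c) * subst_poly x u"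
proof -
  have "[:- c, 1:] * u = smult (- c) u + pCons 0 u" by simp
  then show ?thesis
    by (simp only: subst_poly_add subst_poly_smult subst_poly_pCons) (simp add: const_uminus algebra_simps)
qed

lemma subst_poly_prod:
  "finite A \<Longrightarrow> subst_poly x (\<Prod>c\<in>A. [:- c, 1:]) = (\<Prod>c\<in>A. x - const c)"
  by (induction A rule: finite_induct) (simp_all add: subst_poly_linear del: mult_pCons_left)

lemma subst_poly_prod_mset:
  "subst_poly x (\<Prod>c\<in>#A. [:- c, 1:]) = (\<Prod>c\<in>#A. x - const c)"
  by (induction A) (simp_all only: image_mset_empty prod_mset_empty image_mset_add_mset
      prod_mset.add_mset subst_poly_1 subst_poly_linear)

text \<open>If no \<open>x - const c\<close> lies in \<open>P\<close>, each has an inverse modulo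
  \<open>P\<close> up to a power of \<open>f\<close>. By uncountability, infinitely many
  \<open>c\<close> share the exponent and the support of the inverse, so these inverses satisfy a
  linear relation. Clearing denominators gives a nonzero univariate \<open>u\<close> with
  \<open>u(x)\<close> in \<open>P\<close>, and one of its linear factors must lie in
  \<open>P\<close>.\<close>

lemma ex_root_mod_ideal:
  fixes x f :: "'a::alg_closed_field inf_poly"
  assumes unc: "uncountable (UNIV :: 'a set)" and iP: "is_ideal P" and fP: "\<And>n. f ^ n \<notin> P"
    and max: "\<And>g. g \<notin> P \<Longrightarrow> \<exists>n h. f ^ n - h * g \<in> P"
  shows "\<exists>c. x - const c \<in> P"
proof (rule ccontr)
  assume none: "\<not> ?thesis"
  note id = is_ideal_simps[OF iP]
  \<comment> \<open>Elements outside \<open>P\<close> are units once \<open>f\<close> is inverted,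
    so their product cannot lie in \<open>P\<close>.\<close>
  have prime: "a \<in> P \<or> b \<in> P" if "a * b \<in> P" for a b
  proof (rule ccontr)
    assume "\<not> ?thesis"
    then obtain n h n' h' where h: "f ^ n - h * a \<in> P" "f ^ n' - h' * b \<in> P" using max by metis
    have "f ^ (n + n') = (f ^ n - h * a) * f ^ n' + (h * a) * (f ^ n' - h' * b) + (h * h') * (a * b)"
      by (simp add: algebra_simps power_add)
    also have "\<dots> \<in> P" by (intro id(2) id(4)[OF h(1)] id(3)[OF h(2)] id(3)[OF that])
    finally show False using fP by blast
  qed
  have "\<forall>c. \<exists>nh. f ^ fst nh - snd nh * (x - const c) \<in> P"
    using none max by (metis fst_conv snd_conv)
  then obtain nh where nh: "\<And>c. f ^ fst (nh c) - snd (nh c) * (x - const c) \<in> P" by metis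
  define N where "N c = fst (nh c)" for c
  define h where "h c = snd (nh c)" for c
  have Nh: "f ^ N c - h c * (x - const c) \<in> P" for c using nh by (simp add: N_def h_def)
  \<comment> \<open>Only the support of \<open>h c\<close> is recorded: finite sets of monomials are
    countable in number, whereas the coefficients come from an uncountable field.\<close>
  have "range (\<lambda>c. (N c, keys (h c))) \<subseteq> UNIV \<times> {A. finite A \<and> A \<subseteq> UNIV}" by auto
  moreover have "countable (UNIV \<times> {A. finite A \<and> A \<subseteq> (UNIV :: (nat \<Rightarrow>\<^sub>0 nat) set)} :: (nat \<times> _) set)"
    by (intro countable_SIGMA countable_Collect_finite_subset countable_exponents) auto
  ultimately have "countable (range (\<lambda>c. (N c, keys (h c))))" by (rule countable_subset)
  from uncountable_fibre[OF unc this] obtain y where "infinite {c. (N c, keys (h c)) = y}" .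
  moreover obtain n F where "y = (n, F)" by (cases y)
  ultimately have inf: "infinite {c. (N c, keys (h c)) = (n, F)}" by simp
  from infinite_arbitrarily_large[OF inf, of "Suc (card F)"]
  obtain T where T: "finite T" "card T = Suc (card F)" "T \<subseteq> {c. (N c, keys (h c)) = (n, F)}"
    by blast
  have hT: "N c = n" "keys (h c) = F" if "c \<in> T" for c using T(3) that by auto
  have "T \<noteq> {}" using T(2) by auto
  then have finF: "finite F" using hT(2) finite_keys by blast
  obtain d c0 where d: "c0 \<in> T" "d c0 \<noteq> 0" "\<And>m. m \<in> F \<Longrightarrow> (\<Sum>c\<in>T. d c * lookup (h c) m) = 0"
    using nontrivial_relation[OF finF T(1), of "\<lambda>c. lookup (h c)"] T(2) by auto
  have rel: "(\<Sum>c\<in>T. const (d c) * h c) = 0"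
  proof (rule poly_mapping_eqI)
    fix m
    have "(\<Sum>c\<in>T. d c * lookup (h c) m) = 0"
    proof (cases "m \<in> F")
      case False
      then have "m \<notin> keys (h c)" if "c \<in> T" for c using hT(2)[OF that] by simp
      then have "lookup (h c) m = 0" if "c \<in> T" for c using that by (simp add: in_keys_iff)
      then show ?thesis by simp
    qed (rule d(3))
    then show "lookup (\<Sum>c\<in>T. const (d c) * h c) m = lookup 0 m" by (simp add: lookup_sum)
  qed
  \<comment> \<open>The numerator of the sum of the fractions d_c / (x - c) over \<open>T\<close>.
    At \<open>c0\<close> all summands but its own vanish, so it is nonzero.\<close>
  define u where "u = (\<Sum>c\<in>T. smult (d c) (\<Prod>b\<in>T - {c}. [:- b, 1:]))"
  have "poly u c0 = (\<Sum>c\<in>T. if c = c0 then d c * (\<Prod>b\<in>T - {c}. c0 - b) else 0)"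
    unfolding u_def poly_sum
  proof (rule sum.cong[OF refl])
    fix c assume "c \<in> T"
    show "poly (smult (d c) (\<Prod>b\<in>T - {c}. [:- b, 1:])) c0
        = (if c = c0 then d c * (\<Prod>b\<in>T - {c}. c0 - b) else 0)"
    proof (cases "c = c0")
      case False
      then have "c0 \<in> T - {c}" using d(1) by simp
      then have "(\<Prod>b\<in>T - {c}. c0 - b) = 0" using T(1) by (intro prod_zero) auto
      then show ?thesis using False by (simp add: poly_prod)
    qed (simp add: poly_prod)
  qed
  also have "\<dots> = d c0 * (\<Prod>b\<in>T - {c0}. c0 - b)" using T(1) d(1) by simp
  also have "\<dots> \<noteq> 0" using d(2) T(1) by auto
  finally have "u \<noteq> 0" by auto
  have "f ^ n * subst_poly x u \<in> P"
  proof -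
    have su: "subst_poly x u = (\<Sum>c\<in>T. const (d c) * (\<Prod>b\<in>T - {c}. x - const b))"
      using T(1) by (simp add: u_def subst_poly_sum subst_poly_smult subst_poly_prod)
    \<comment> \<open>Modulo \<open>P\<close>, \<open>f ^ n\<close> may be replaced by
      \<open>h c * (x - const c)\<close>, which completes the product; summing over \<open>c\<close>
      then brings in \<open>rel\<close>.\<close>
    have "f ^ n * (const (d c) * (\<Prod>b\<in>T - {c}. x - const b))
        - const (d c) * h c * (\<Prod>b\<in>T. x - const b) \<in> P" if c: "c \<in> T" for c
    proof -
      have rm: "(\<Prod>b\<in>T. x - const b) = (x - const c) * (\<Prod>b\<in>T - {c}. x - const b)"
        by (rule prod.remove[OF T(1) c])
      have "f ^ n * (const (d c) * (\<Prod>b\<in>T - {c}. x - const b))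
          - const (d c) * h c * (\<Prod>b\<in>T. x - const b)
        = (const (d c) * (\<Prod>b\<in>T - {c}. x - const b)) * (f ^ N c - h c * (x - const c))"
        unfolding rm hT(1)[OF c] by (simp add: algebra_simps)
      then show ?thesis using id(3)[OF Nh] by simp
    qed
    then have "(\<Sum>c\<in>T. f ^ n * (const (d c) * (\<Prod>b\<in>T - {c}. x - const b))
        - const (d c) * h c * (\<Prod>b\<in>T. x - const b)) \<in> P"
      by (rule is_ideal_sum[OF iP])
    moreover have "(\<Sum>c\<in>T. const (d c) * h c * (\<Prod>b\<in>T. x - const b)) = 0"
      unfolding sum_distrib_right[symmetric] rel by simp
    ultimately show ?thesis by (simp add: su sum_distrib_left sum_subtractf)
  qed
  then have uP: "subst_poly x u \<in> P" using prime fP by blast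
  obtain A where A: "u = smult (lead_coeff u) (\<Prod>a\<in>#A. [:- a, 1:])"
    using alg_closed_imp_factorization[OF \<open>u \<noteq> 0\<close>] by blast
  define l where "l = lead_coeff u"
  have "l \<noteq> 0" using \<open>u \<noteq> 0\<close> by (simp add: l_def)
  have "const l * (\<Prod>a\<in>#A. x - const a) \<in> P"
    using uP by (subst (asm) A) (simp only: subst_poly_smult subst_poly_prod_mset l_def)
  then have "const (inverse l) * (const l * (\<Prod>a\<in>#A. x - const a)) \<in> P" by (rule id(3))
  moreover have "const (inverse l) * (const l * (\<Prod>a\<in>#A. x - const a)) = (\<Prod>a\<in>#A. x - const a)"
    using \<open>l \<noteq> 0\<close> by (simp add: mult.assoc[symmetric] const_mult[symmetric])
  ultimately have "(\<Prod>a\<in>#A. x - const a) \<in> P" by simp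
  \<comment> \<open>By primality a product in \<open>P\<close> would have a factor in
    \<open>P\<close>; the empty product is \<open>f ^ 0\<close>.\<close>
  moreover have "(\<Prod>a\<in>#B. x - const a) \<notin> P" for B
  proof (induction B)
    case empty
    then show ?case using fP[of 0] by simp
  next
    case (add b B)
    then show ?case using prime none by (auto dest: prime)
  qed
  ultimately show False by blast
qed

lemma const_power: "const (c ^ e) = const c ^ e" for c :: "'a::comm_semiring_1"
  by (induction e) (simp_all add: const_mult)

lemma const_sum: "const (\<Sum>a\<in>A. F a) = (\<Sum>a\<in>A. const (F a))" for F :: "'b \<Rightarrow> 'a::comm_semiring_1"
  by (induction A rule: infinite_finite_induct) (simp_all add: const_add)

lemma const_prod: "const (\<Prod>a\<in>A. F a) = (\<Prod>a\<in>A. const (F a))" for F :: "'b \<Rightarrow> 'a::comm_semiring_1"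
  by (induction A rule: infinite_finite_induct) (simp_all add: const_mult)

lemma ideal_mult_cong:
  assumes "is_ideal P" "x - x' \<in> P" "y - y' \<in> P" shows "x * y - x' * y' \<in> P"
proof -
  have "x * y - x' * y' = (x - x') * y + x' * (y - y')" by (simp add: algebra_simps)
  then show ?thesis using assms by (simp add: is_ideal_simps)
qed

lemma ideal_power_cong:
  assumes "is_ideal P" "x - x' \<in> P" shows "x ^ e - x' ^ e \<in> P"
proof (induction e)
  case (Suc e)
  show ?case unfolding power_Suc by (rule ideal_mult_cong[OF assms Suc])
qed (simp add: is_ideal_simps[OF assms(1)])

lemma ideal_prod_cong:
  assumes "is_ideal P" "\<And>i. i \<in> A \<Longrightarrow> x i - x' i \<in> P" shows "(\<Prod>i\<in>A. x i) - (\<Prod>i\<in>A. x' i) \<in> P"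
  using assms(2)
  by (induction A rule: infinite_finite_induct)
    (simp_all add: is_ideal_simps[OF assms(1)] ideal_mult_cong[OF assms(1)])

text \<open>Modulo \<open>P\<close> every variable is the constant \<open>a i\<close>, so every
  polynomial is congruent to its value at \<open>a\<close>.\<close>

lemma ideal_eval_cong:
  fixes P :: "'a::comm_ring_1 inf_poly set"
  assumes P: "is_ideal P" and a: "\<And>i. var i - const (a i) \<in> P"
  shows "g - const (eval_poly (\<lambda>c. c) a g) \<in> P"
proof -
  have "g = (\<Sum>m\<in>keys g. const (lookup g m) * (\<Prod>i\<in>keys m. var i ^ lookup m i))"
  proof -
    have "(\<Prod>i\<in>keys m. var i ^ lookup m i) = (mon m 1 :: 'a inf_poly)" for m
      by (simp only: var_power prod_mon poly_eq_sum_mon[symmetric])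
    then show ?thesis using poly_eq_sum_mon[of g] by (simp only: const_mult_mon mult_1_right)
  qed
  moreover have "const (eval_poly (\<lambda>c. c) a g)
      = (\<Sum>m\<in>keys g. const (lookup g m) * (\<Prod>i\<in>keys m. const (a i) ^ lookup m i))"
    by (simp add: eval_poly_def const_sum const_mult const_prod const_power)
  ultimately have "g - const (eval_poly (\<lambda>c. c) a g) = (\<Sum>m\<in>keys g. const (lookup g m) *
      ((\<Prod>i\<in>keys m. var i ^ lookup m i) - (\<Prod>i\<in>keys m. const (a i) ^ lookup m i)))"
    by (simp only: right_diff_distrib sum_subtractf)
  also have "\<dots> \<in> P"
    by (intro is_ideal_sum[OF P] is_ideal_simps(3)[OF P] ideal_prod_cong[OF P] ideal_power_cong[OF P] a)
  finally show ?thesis .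
qed

text \<open>The point consists of the residues of the variables modulo a maximal \<open>P\<close>
  avoiding powers of \<open>f\<close>. The ideal is returned with the point, so that nonvanishing of
  \<open>f\<close> can be used in the form \<open>f \<notin> P\<close>.\<close>

lemma ex_point_avoiding:
  fixes f :: "'a::alg_closed_field inf_poly"
  assumes unc: "uncountable (UNIV :: 'a set)" and J: "is_ideal J" and f: "\<And>n. f ^ n \<notin> J"
  obtains P a where "is_ideal P" "f \<notin> P" "\<And>i. var i - const (a i) \<in> P"
    "\<And>g. g \<in> J \<Longrightarrow> eval_poly (\<lambda>c. c) a g = 0"
proof -
  obtain P where P: "is_ideal P" "J \<subseteq> P" "\<And>n. f ^ n \<notin> P" "\<And>g. g \<notin> P \<Longrightarrow> \<exists>n h. f ^ n - h * g \<in> P"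
    by (rule ex_maximal_ideal_avoiding[OF J f]) blast
  have "\<forall>i. \<exists>c. var i - const c \<in> P"
    using ex_root_mod_ideal[OF unc P(1,3,4)] by blast
  then obtain a where a: "\<And>i. var i - const (a i) \<in> P" by metis
  show ?thesis
  proof (rule that[OF P(1) _ a])
    show "f \<notin> P" using P(3)[of 1] by simp
    fix g assume g: "g \<in> J"
    define c where "c = eval_poly (\<lambda>c. c) a g"
    \<comment> \<open>The value \<open>c\<close> of \<open>g\<close> lies in \<open>P\<close> as a
      constant; a nonzero constant would be a unit there.\<close>
    have "g - (g - const c) \<in> P"
      using is_ideal_simps(6)[OF P(1)] ideal_eval_cong[OF P(1) a] g P(2) unfolding c_def by blast
    then have "const c \<in> P" by simp
    then have "const (inverse c) * const c \<in> P" by (rule is_ideal_simps(3)[OF P(1)])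
    then have "const (inverse c * c) \<in> P" by (simp add: const_mult)
    moreover have "1 \<notin> P" using P(3)[of 0] by simp
    ultimately show "eval_poly (\<lambda>c. c) a g = 0" unfolding c_def[symmetric] by (cases "c = 0") simp_all
  qed
qed

section \<open>Passage between the field and its algebraic closure\<close>

abbreviation map_coef :: "('a::zero \<Rightarrow> 'b::zero) \<Rightarrow> 'a inf_poly \<Rightarrow> 'b inf_poly" where
  "map_coef \<equiv> Poly_Mapping.map"

lemma lookup_map_coef: "\<phi> 0 = 0 \<Longrightarrow> lookup (map_coef \<phi> f) m = \<phi> (lookup f m)"
  by (simp add: Poly_Mapping.map.rep_eq when_def)

text \<open>Kept apart from \<open>coef_hom\<close> because linear functionals on the closure are
  additive but in general not multiplicative.\<close>

locale additive_map =
  fixes \<phi> :: "'a::comm_monoid_add \<Rightarrow> 'b::comm_monoid_add"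
  assumes map_0: "\<phi> 0 = 0" and map_add: "\<phi> (x + y) = \<phi> x + \<phi> y"
begin

lemma map_coef_0: "map_coef \<phi> 0 = 0"
  by (rule poly_mapping_eqI) (simp add: lookup_map_coef[of \<phi>, OF map_0] map_0)

lemma map_coef_add: "map_coef \<phi> (f + g) = map_coef \<phi> f + map_coef \<phi> g"
  by (rule poly_mapping_eqI) (simp add: lookup_map_coef[of \<phi>, OF map_0] lookup_add map_add)

lemma map_coef_sum: "map_coef \<phi> (\<Sum>a\<in>A. F a) = (\<Sum>a\<in>A. map_coef \<phi> (F a))"
  by (induction A rule: infinite_finite_induct) (simp_all add: map_coef_0 map_coef_add)

lemma map_coef_mon: "map_coef \<phi> (mon m c) = mon m (\<phi> c)"
  by (rule poly_mapping_eqI) (simp add: lookup_map_coef[of \<phi>, OF map_0] lookup_single when_def map_0)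

end

lemma mult_eq_sum_mon:
  "f * g = (\<Sum>m\<in>keys f. \<Sum>m'\<in>keys g. mon (m + m') (lookup f m * lookup g m'))"
  for f g :: "'a::comm_semiring_1 inf_poly"
  by (subst (1) poly_eq_sum_mon[of f], subst (1) poly_eq_sum_mon[of g])
    (simp add: sum_product mult_single)

locale coef_hom = additive_map \<phi> for \<phi> :: "'a::comm_ring_1 \<Rightarrow> 'b::comm_ring_1" +
  assumes map_1: "\<phi> 1 = 1" and map_mult: "\<phi> (x * y) = \<phi> x * \<phi> y"
begin

lemma map_coef_1: "map_coef \<phi> 1 = 1"
  using map_coef_mon[of 0 1] by (simp add: map_1)

lemma map_coef_mult: "map_coef \<phi> (f * g) = map_coef \<phi> f * map_coef \<phi> g"
proof -
  have "map_coef \<phi> (f * g) = (\<Sum>m\<in>keys f. \<Sum>m'\<in>keys g. mon m (\<phi> (lookup f m)) * mon m' (\<phi> (lookup g m')))"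
    unfolding mult_eq_sum_mon[of f g] by (simp only: map_coef_sum map_coef_mon map_mult mult_single)
  also have "\<dots> = (\<Sum>m\<in>keys f. mon m (\<phi> (lookup f m))) * (\<Sum>m'\<in>keys g. mon m' (\<phi> (lookup g m')))"
    by (simp only: sum_product)
  also have "(\<Sum>m\<in>keys f. mon m (\<phi> (lookup f m))) = map_coef \<phi> f"
    by (subst (3) poly_eq_sum_mon[of f]) (simp only: map_coef_sum map_coef_mon)
  also have "(\<Sum>m\<in>keys g. mon m (\<phi> (lookup g m))) = map_coef \<phi> g"
    by (subst (3) poly_eq_sum_mon[of g]) (simp only: map_coef_sum map_coef_mon)
  finally show ?thesis .
qed

lemma map_coef_power: "map_coef \<phi> (f ^ e) = map_coef \<phi> f ^ e"
  by (induction e) (simp_all add: map_coef_1 map_coef_mult)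

lemma map_coef_prod: "map_coef \<phi> (\<Prod>a\<in>A. F a) = (\<Prod>a\<in>A. map_coef \<phi> (F a))"
  by (induction A rule: infinite_finite_induct) (simp_all add: map_coef_1 map_coef_mult)

lemma map_coef_var: "map_coef \<phi> (var i) = var i"
  unfolding var_def by (simp only: map_coef_mon map_1)

lemma map_coef_diff: "map_coef \<phi> (f - g) = map_coef \<phi> f - map_coef \<phi> g"
  using map_coef_add[of "f - g" g] by (simp add: algebra_simps)

end

lemma coef_hom_to_ac: "coef_hom (to_ac :: 'a::field \<Rightarrow> 'a alg_closure)"
  by unfold_locales simp_all

lemma eval_poly_map_coef:
  assumes "\<And>c. \<phi> c = 0 \<longleftrightarrow> c = 0"
  shows "eval_poly (\<lambda>c. c) a (map_coef \<phi> g) = eval_poly \<phi> a g"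
proof -
  have 0: "\<phi> 0 = 0" using assms by simp
  have "keys (map_coef \<phi> g) = keys g"
    by (rule Set.set_eqI) (simp add: in_keys_iff lookup_map_coef[of \<phi>, OF 0] assms)
  then show ?thesis unfolding eval_poly_def by (simp only: lookup_map_coef[of \<phi>, OF 0])
qed

definition ac_functional :: "('k::field alg_closure \<Rightarrow> 'k) \<Rightarrow> bool" where
  "ac_functional \<theta> \<longleftrightarrow> (\<forall>x y. \<theta> (x + y) = \<theta> x + \<theta> y) \<and> (\<forall>c x. \<theta> (to_ac c * x) = c * \<theta> x)"

lemma ac_functional_additive: "ac_functional \<theta> \<Longrightarrow> additive_map \<theta>"
  unfolding ac_functional_def by unfold_locales (metis mult_zero_left to_ac_0, blast)

text \<open>The set \<open>{1}\<close> is independent over the base field, so prescribing the value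
  1 there extends linearly. The functional is then a left inverse of \<open>to_ac\<close>.\<close>

lemma ex_ac_functional: "\<exists>\<theta> :: 'k::field alg_closure \<Rightarrow> 'k. ac_functional \<theta> \<and> \<theta> 1 = 1"
proof -
  interpret vector_space_pair "\<lambda>c (x :: 'k alg_closure). to_ac c * x" "(*) :: 'k \<Rightarrow> 'k \<Rightarrow> 'k"
    by unfold_locales (simp_all add: algebra_simps)
  have "vs1.independent {1}" by simp
  from linear_independent_extend[OF this, of "\<lambda>_. 1"] obtain \<theta>
    where \<theta>: "Vector_Spaces.linear (\<lambda>c (x :: 'k alg_closure). to_ac c * x) ((*) :: 'k \<Rightarrow> 'k \<Rightarrow> 'k) \<theta>" "\<theta> 1 = 1"
    by auto
  interpret l: Vector_Spaces.linear "\<lambda>c (x :: 'k alg_closure). to_ac c * x" "(*) :: 'k \<Rightarrow> 'k \<Rightarrow> 'k" \<theta>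
    by (rule \<theta>(1))
  show ?thesis using \<theta>(2) l.add l.scale unfolding ac_functional_def by blast
qed

text \<open>The extension of \<open>I\<close> to the algebraic closure, described by functionals so that it
  visibly contracts back to \<open>I\<close>.\<close>

definition ac_ideal :: "'k::field inf_poly set \<Rightarrow> 'k alg_closure inf_poly set" where
  "ac_ideal I = {g. \<forall>\<theta>. ac_functional \<theta> \<longrightarrow> map_coef \<theta> g \<in> I}"

text \<open>For a scalar \<open>b\<close> of the closure, mapping x to \<theta>(b x) is again a
  functional. Expanding \<open>h\<close> into monomials thus writes the image of
  \<open>h * g\<close> under \<open>\<theta>\<close> as a combination of images of \<open>g\<close>,
  all in \<open>I\<close>.\<close>

lemma is_ideal_ac_ideal:
  assumes I: "is_ideal I" shows "is_ideal (ac_ideal I)"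
  unfolding is_ideal_def
proof (intro conjI ballI allI)
  show "0 \<in> ac_ideal I"
    unfolding ac_ideal_def
    by (simp add: additive_map.map_coef_0[OF ac_functional_additive] is_ideal_simps(1)[OF I])
next
  fix f g assume "f \<in> ac_ideal I" "g \<in> ac_ideal I"
  then show "f + g \<in> ac_ideal I"
    unfolding ac_ideal_def
    by (simp add: additive_map.map_coef_add[OF ac_functional_additive] is_ideal_simps(2)[OF I])
next
  fix g h assume g: "g \<in> ac_ideal I"
  show "h * g \<in> ac_ideal I"
    unfolding ac_ideal_def mem_Collect_eq
  proof (intro allI impI)
    fix \<theta> :: "'a alg_closure \<Rightarrow> 'a" assume \<theta>: "ac_functional \<theta>"
    interpret additive_map \<theta> by (rule ac_functional_additive[OF \<theta>])
    define \<psi> where "\<psi> b x = \<theta> (b * x)" for b x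
    have \<psi>: "ac_functional (\<psi> b)" for b
    proof -
      have "\<theta> (b * (to_ac c * x)) = c * \<theta> (b * x)" for c x
        using \<theta> unfolding ac_functional_def mult.left_commute[of b "to_ac c" x] by blast
      then show ?thesis using \<theta> unfolding ac_functional_def \<psi>_def by (simp add: distrib_left)
    qed
    have eq: "map_coef (\<psi> b) g = (\<Sum>m'\<in>keys g. mon m' (\<psi> b (lookup g m')))" for b
      by (subst (1) poly_eq_sum_mon[of g])
        (simp only: additive_map.map_coef_sum[OF ac_functional_additive[OF \<psi>]]
          additive_map.map_coef_mon[OF ac_functional_additive[OF \<psi>]])
    have "map_coef \<theta> (h * g) = (\<Sum>m\<in>keys h. mon m 1 * map_coef (\<psi> (lookup h m)) g)"
      unfolding mult_eq_sum_mon[of h g] eq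
      by (simp add: map_coef_sum map_coef_mon sum_distrib_left mult_single \<psi>_def)
    also have "\<dots> \<in> I"
      by (intro is_ideal_sum[OF I] is_ideal_simps(3)[OF I])
        (use g \<psi> in \<open>simp add: ac_ideal_def\<close>)
    finally show "map_coef \<theta> (h * g) \<in> I" .
  qed
qed

lemma map_coef_to_ac_ac_ideal:
  assumes I: "is_ideal I"
  shows "map_coef to_ac g \<in> ac_ideal I \<longleftrightarrow> g \<in> I"
proof
  have eq: "map_coef \<theta> (map_coef to_ac g) = const (\<theta> 1) * g" if \<theta>: "ac_functional \<theta>" for \<theta>
  proof (rule poly_mapping_eqI)
    fix m
    have "\<theta> 0 = 0" using additive_map.map_0[OF ac_functional_additive[OF \<theta>]] .
    moreover have "\<theta> (to_ac c) = c * \<theta> 1" for c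
      using \<theta> unfolding ac_functional_def by (metis mult_1_right)
    ultimately show "lookup (map_coef \<theta> (map_coef to_ac g)) m = lookup (const (\<theta> 1) * g) m"
      by (simp add: lookup_map_coef)
  qed
  show "g \<in> I" if "map_coef to_ac g \<in> ac_ideal I"
  proof -
    obtain \<theta> :: "'a alg_closure \<Rightarrow> 'a" where \<theta>: "ac_functional \<theta>" "\<theta> 1 = 1" using ex_ac_functional by blast
    then have "map_coef \<theta> (map_coef to_ac g) \<in> I" using that by (simp add: ac_ideal_def)
    then show ?thesis using \<theta> by (simp add: eq)
  qed
  show "map_coef to_ac g \<in> ac_ideal I" if "g \<in> I"
    using that is_ideal_simps(3)[OF I] by (simp add: ac_ideal_def eq)
qed

text \<open>The product \<open>F\<close> vanishes on \<open>Delta_set p\<close> by its first factor,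
  and on \<open>H_set q\<close> because one of \<open>q + 1\<close> chosen coordinates must be zero.
  So a power of it lies in the extended ideal, and the power descends to \<open>I\<close> because
  \<open>F\<close> has coefficients in the base field.\<close>

lemma Delta_H_power_mem:
  fixes I :: "'k::field inf_poly set"
  assumes unc: "uncountable (UNIV :: 'k alg_closure set)" and I: "is_ideal I"
    and sub: "zero_locus I \<subseteq> Delta_set p \<union> H_set q"
  obtains k where "k > 0" "(var 0 ^ p - var 1 ^ p) ^ k * (\<Prod>l<Suc q. var (l + 2) ^ k) \<in> I"
proof -
  interpret coef_hom "to_ac :: 'k \<Rightarrow> 'k alg_closure" by (rule coef_hom_to_ac)
  define f where "f = (var 0 ^ p - var 1 ^ p) * (\<Prod>l<Suc q. var (l + 2) :: 'k inf_poly)"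
  define F where "F = (var 0 ^ p - var 1 ^ p) * (\<Prod>l<Suc q. var (l + 2) :: 'k alg_closure inf_poly)"
  have fF: "map_coef to_ac f = F"
    unfolding f_def F_def by (simp only: map_coef_mult map_coef_diff map_coef_power map_coef_prod map_coef_var)
  have "\<exists>n. F ^ n \<in> ac_ideal I"
  proof (rule ccontr)
    assume "\<not> ?thesis"
    then have "F ^ n \<notin> ac_ideal I" for n by blast
    then obtain P a where
      P: "is_ideal P" "F \<notin> P" "\<And>i. var i - const (a i) \<in> P"
      "\<And>g. g \<in> ac_ideal I \<Longrightarrow> eval_poly (\<lambda>c. c) a g = 0"
      by (rule ex_point_avoiding[OF unc is_ideal_ac_ideal[OF I]]) blast
    have "eval_poly to_ac a g = 0" if "g \<in> I" for g
    proof -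
      have "eval_poly (\<lambda>c. c) a (map_coef to_ac g) = 0"
        by (rule P(4)) (simp add: map_coef_to_ac_ac_ideal[OF I] that)
      then show ?thesis by (simp add: eval_poly_map_coef)
    qed
    then have "a \<in> zero_locus I" by (simp add: zero_locus_def)
    then consider "a \<in> Delta_set p" | "a \<in> H_set q" using sub by blast
    then have "F \<in> P"
    proof cases
      case 1
      then have e: "const (a 0) ^ p = const (a 1) ^ p"
        unfolding Delta_set_def mem_Collect_eq const_power[symmetric] by metis
      have "(var 0 ^ p - const (a 0) ^ p) - (var 1 ^ p - const (a 1) ^ p) \<in> P"
        by (rule is_ideal_simps(6)[OF P(1)]; rule ideal_power_cong[OF P(1) P(3)])
      then have "var 0 ^ p - var 1 ^ p \<in> P" unfolding e by simp
      then show ?thesis unfolding F_def by (rule is_ideal_simps(4)[OF P(1)])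
    next
      case 2
      then obtain \<sigma> b where \<sigma>: "\<sigma> \<in> Sym_inf" "a = b \<circ> inv_into UNIV \<sigma>" "\<forall>i\<ge>q. b i = 0"
        unfolding H_set_def by blast
      then have "bij \<sigma>" using Sym_bij by (auto simp: Sym_inf_def)
      then have inj: "inj (inv_into UNIV \<sigma>)" using bij_imp_bij_inv bij_is_inj by blast
      \<comment> \<open>Pigeonhole: otherwise \<open>q + 1\<close> distinct positions would be moved
        by the inverse of \<open>\<sigma>\<close> into the \<open>q\<close> places where
        \<open>b\<close> may be nonzero.\<close>
      have "\<exists>l<Suc q. a (l + 2) = 0"
      proof (rule ccontr)
        assume no: "\<not> ?thesis"
        define \<iota> where "\<iota> l = inv_into UNIV \<sigma> (l + 2)" for l
        have "\<iota> ` {..<Suc q} \<subseteq> {..<q}"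
        proof
          fix y assume "y \<in> \<iota> ` {..<Suc q}"
          then obtain l where l: "l < Suc q" "y = \<iota> l" by auto
          then have "b y \<noteq> 0" using no \<sigma>(2) by (auto simp: \<iota>_def)
          then show "y \<in> {..<q}" using \<sigma>(3) by (metis lessThan_iff not_le)
        qed
        moreover have "inj_on \<iota> {..<Suc q}"
          using inj by (auto simp: \<iota>_def inj_on_def)
        ultimately have "card {..<Suc q} \<le> card {..<q}" by (intro card_inj_on_le) auto
        then show False by simp
      qed
      then obtain l where l: "l < Suc q" "a (l + 2) = 0" by blast
      then have "var (l + 2) \<in> P" using P(3)[of "l + 2"] by simp
      then have "(\<Prod>l\<in>{..<Suc q} - {l}. var (l + 2)) * var (l + 2) \<in> P" by (rule is_ideal_simps(3)[OF P(1)])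
      also have "(\<Prod>l\<in>{..<Suc q} - {l}. var (l + 2)) * var (l + 2) = (\<Prod>l<Suc q. var (l + 2) :: 'k alg_closure inf_poly)"
        using l(1) by (subst prod.remove[of "{..<Suc q}" l]) (simp_all add: mult.commute)
      finally show ?thesis unfolding F_def by (rule is_ideal_simps(3)[OF P(1)])
    qed
    then show False using P(2) by blast
  qed
  then obtain n where "F ^ n \<in> ac_ideal I" by blast
  then have "map_coef to_ac (f ^ n) \<in> ac_ideal I" by (simp add: map_coef_power fF)
  then have "f ^ n \<in> I" by (simp add: map_coef_to_ac_ac_ideal[OF I])
  \<comment> \<open>One more factor makes the exponent positive, as the threshold \<open>k\<close>
    must be.\<close>
  then have "f * f ^ n \<in> I" by (rule is_ideal_simps(3)[OF I])
  then have mem: "f ^ Suc n \<in> I" by simp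
  have eq: "f ^ k = (var 0 ^ p - var 1 ^ p) ^ k * (\<Prod>l<Suc q. var (l + 2) ^ k)" for k
    unfolding f_def by (simp only: power_mult_distrib prod_power_distrib)
  show ?thesis by (rule that[OF _ mem[unfolded eq]]) simp
qed

section \<open>The Hilbert series of the invariants\<close>

text \<open>Zero coordinates leave no monomial for the symmetrization. Elements of
  \<open>K[X_n]\<close> with equal coordinates therefore have equal symmetrizations.\<close>

lemma symmetrize_eq_0:
  fixes f :: "'a::field_char_0 inf_poly"
  assumes "f \<in> polys_in n" "\<And>\<mu>. coef f \<mu> = 0" shows "symmetrize n f = 0"
proof -
  have "keys (symmetrize n f) = {}" using coef_symmetrize_nonzero[OF assms(1)] assms(2) by blast
  then show ?thesis by (metis in_keys_iff empty_iff lookup_zero poly_mapping_eqI)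
qed

lemma symmetrize_const_mult: "symmetrize n (const c * f) = const c * symmetrize n f"
  by (rule poly_mapping_eqI) (simp add: lookup_symmetrize sum_distrib_left)

lemma symmetrize_sum: "symmetrize n (\<Sum>a\<in>A. F a) = (\<Sum>a\<in>A. symmetrize n (F a))"
  by (rule poly_mapping_eqI) (simp add: lookup_symmetrize lookup_sum sum.swap[of _ A])

lemma symmetrize_diff: "symmetrize n (f - g) = symmetrize n f - symmetrize n g"
  for f :: "'a::comm_ring_1 inf_poly"
  by (rule poly_mapping_eqI) (simp add: lookup_symmetrize lookup_minus sum_subtractf)

lemma perm_poly_symmetrize:
  assumes \<sigma>: "\<sigma> \<in> Sym n" shows "perm_poly \<sigma> (symmetrize n f) = symmetrize n f"
proof (rule poly_mapping_eqI)
  fix m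
  let ?\<tau> = "inv_into UNIV \<sigma>"
  have \<tau>: "?\<tau> \<in> Sym n" by (rule Sym_inv[OF \<sigma>])
  have id: "\<sigma> \<circ> ?\<tau> = id" "?\<tau> \<circ> \<sigma> = id"
    using Sym_bij[OF \<sigma>] by (auto simp: bij_is_inj surj_iff[THEN iffD1, OF bij_is_surj])
  have "lookup (perm_poly \<sigma> (symmetrize n f)) m = (\<Sum>\<rho>\<in>Sym n. lookup f (perm_mon (\<rho> \<circ> ?\<tau>) m))"
    unfolding lookup_perm_poly[OF Sym_bij[OF \<sigma>]] lookup_symmetrize
    by (rule sum.cong[OF refl]) (simp only: perm_mon_comp Sym_bij[of _ n] \<tau>)
  also have "\<dots> = (\<Sum>\<rho>\<in>Sym n. lookup f (perm_mon \<rho> m))"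
    by (rule sum.reindex_bij_witness[of _ "\<lambda>\<rho>. \<rho> \<circ> \<sigma>" "\<lambda>\<rho>. \<rho> \<circ> ?\<tau>"])
      (simp_all add: Sym_comp \<sigma> \<tau> comp_assoc id)
  finally show "lookup (perm_poly \<sigma> (symmetrize n f)) m = lookup (symmetrize n f) m"
    by (simp only: lookup_symmetrize)
qed

lemma ex_mon_shape:
  "0 \<notin># \<mu> \<Longrightarrow> \<exists>m. keys m \<subseteq> {..<size \<mu>} \<and> shape m = \<mu>"
proof (induction \<mu>)
  case empty
  then show ?case by (intro exI[of _ 0]) simp
next
  case (add x \<mu>)
  then obtain m where m: "keys m \<subseteq> {..<size \<mu>}" "shape m = \<mu>" by auto
  have "x \<noteq> 0" using add.prems by auto
  have "keys m \<inter> keys (mon (size \<mu>) x) = {}" using m(1) by auto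
  then have "shape (m + mon (size \<mu>) x) = add_mset x \<mu>"
    using \<open>x \<noteq> 0\<close> by (simp add: shape_add_disjoint shape_single m(2))
  moreover have "keys (m + mon (size \<mu>) x) \<subseteq> {..<size (add_mset x \<mu>)}"
    unfolding keys_add_nat using m(1) by (auto split: if_splits)
  ultimately show ?case by blast
qed

lemma size_le_sum_mset: "0 \<notin># \<mu> \<Longrightarrow> size \<mu> \<le> sum_mset \<mu>" for \<mu> :: "nat multiset"
  by (induction \<mu>) auto

lemma polys_in_1: "1 \<in> polys_in n"
  by (simp add: polys_in_def)

section \<open>The quotient ring and its scalars\<close>

lemma poly_ring_simps [simp]:
  "carrier (poly_ring n) = polys_in n"
  "monoid.mult (poly_ring n) = (*)" "\<one>\<^bsub>poly_ring n\<^esub> = 1"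
  "\<zero>\<^bsub>poly_ring n\<^esub> = 0" "add (poly_ring n) = (+)"
  by (simp_all add: poly_ring_def ring_of_type_algebra_def fun_eq_iff)

lemma cring_poly_ring: "cring (poly_ring n :: 'a::comm_ring_1 inf_poly ring)"
proof (rule cringI)
  show "abelian_group (poly_ring n :: 'a inf_poly ring)"
  proof (rule abelian_groupI)
    fix f :: "'a inf_poly" assume "f \<in> carrier (poly_ring n)"
    then show "\<exists>g\<in>carrier (poly_ring n). g \<oplus>\<^bsub>poly_ring n\<^esub> f = \<zero>\<^bsub>poly_ring n\<^esub>"
      by (intro bexI[of _ "- f"]) (simp_all add: polys_in_uminus)
  qed (simp_all add: polys_in_add polys_in_0 ac_simps)
  show "comm_monoid (poly_ring n :: 'a inf_poly ring)"
    by (rule comm_monoidI) (simp_all add: polys_in_1 polys_in_mult ac_simps)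
qed (simp_all add: algebra_simps)

lemma poly_ring_uminus:
  assumes "f \<in> polys_in n" shows "\<ominus>\<^bsub>poly_ring n\<^esub> f = - (f :: 'a::comm_ring_1 inf_poly)"
proof -
  interpret cring "poly_ring n :: 'a inf_poly ring" by (rule cring_poly_ring)
  show ?thesis by (rule minus_equality) (use assms in \<open>simp_all add: polys_in_uminus\<close>)
qed

lemma subfield_const: "subfield (const ` UNIV) (poly_ring n :: 'a::field inf_poly ring)"
proof -
  interpret cring "poly_ring n :: 'a inf_poly ring" by (rule cring_poly_ring)
  have sub: "subring (const ` UNIV) (poly_ring n :: 'a inf_poly ring)"
  proof (rule subringI)
    fix h :: "'a inf_poly" assume "h \<in> const ` UNIV"
    then show "\<ominus>\<^bsub>poly_ring n\<^esub> h \<in> const ` UNIV"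
      by (auto simp: poly_ring_uminus polys_in_const const_uminus[symmetric])
  qed (auto simp: polys_in_const const_mult[symmetric] const_add[symmetric] const_1[symmetric]
        simp del: const_1)
  show ?thesis
  proof (rule subfieldI)
    show "subcring (const ` UNIV) (poly_ring n :: 'a inf_poly ring)"
      by (rule subcringI[OF sub]) (simp add: mult.commute)
    show "Units (poly_ring n \<lparr> carrier := const ` UNIV \<rparr>) = const ` UNIV - {\<zero>\<^bsub>poly_ring n :: 'a inf_poly ring\<^esub>}"
    proof (intro equalityI subsetI)
      fix x :: "'a inf_poly" assume "x \<in> Units (poly_ring n \<lparr> carrier := const ` UNIV \<rparr>)"
      then obtain y where "x \<in> const ` UNIV" "y * x = 1" unfolding Units_def by auto
      then show "x \<in> const ` UNIV - {\<zero>\<^bsub>poly_ring n :: 'a inf_poly ring\<^esub>}" by auto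
    next
      fix x :: "'a inf_poly" assume "x \<in> const ` UNIV - {\<zero>\<^bsub>poly_ring n :: 'a inf_poly ring\<^esub>}"
      then obtain c where c1: "x = const c" "x \<noteq> 0" by auto
      then have c: "x = const c" "c \<noteq> 0" by auto
      have "const (inverse c) * const c = 1" "const c * const (inverse c) = 1"
        using c(2) by (simp_all flip: const_mult)
      then show "x \<in> Units (poly_ring n \<lparr> carrier := const ` UNIV \<rparr>)"
        unfolding Units_def using c(1) by auto
    qed
  qed
qed

text \<open>Mirrors \<open>ring.combine\<close> before passing to cosets, including the truncation
  to the shorter list.\<close>

definition lin_comb :: "'a::comm_ring_1 list \<Rightarrow> 'a inf_poly list \<Rightarrow> 'a inf_poly" where
  "lin_comb cs fs = sum_list (map2 (\<lambda>c f. const c * f) cs fs)"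

lemma lin_comb_simps [simp]:
  "lin_comb [] fs = 0" "lin_comb cs [] = 0"
  "lin_comb (c # cs) (f # fs) = const c * f + lin_comb cs fs"
  by (simp_all add: lin_comb_def)

lemma lin_comb_induct:
  assumes "P 0" "\<And>c f g. f \<in> set fs \<Longrightarrow> P g \<Longrightarrow> P (const c * f + g)"
  shows "P (lin_comb cs fs)"
  using assms(2)
proof (induction fs arbitrary: cs)
  case (Cons f fs)
  then show ?case by (cases cs) (simp_all add: assms(1))
qed (simp add: assms(1))

context sym_hom_ideal
begin

lemma is_ideal_I: "is_ideal I"
  unfolding is_ideal_def using I_0 I_add I_mult_left by blast

lemma ideal_trunc: "ideal (trunc I n) (poly_ring n)"
proof (rule idealI)
  interpret cring "poly_ring n :: 'k inf_poly ring" by (rule cring_poly_ring)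
  show "ring (poly_ring n :: 'k inf_poly ring)" by (rule ring_axioms)
  show "subgroup (trunc I n) (add_monoid (poly_ring n))"
  proof (rule add.subgroupI)
    show "trunc I n \<noteq> {}" using I_0 polys_in_0 by (auto simp: trunc_def)
    show "\<ominus>\<^bsub>poly_ring n\<^esub> a \<in> trunc I n" if "a \<in> trunc I n" for a
      using that by (simp add: trunc_def poly_ring_uminus I_uminus polys_in_uminus)
  qed (auto simp: trunc_def I_add polys_in_add)
qed (simp_all add: trunc_def I_mult I_mult_left polys_in_mult)

lemma trunc_add: "f \<in> trunc I n \<Longrightarrow> g \<in> trunc I n \<Longrightarrow> f + g \<in> trunc I n"
  by (simp add: trunc_def I_add polys_in_add)

lemma trunc_diff: "f \<in> trunc I n \<Longrightarrow> g \<in> trunc I n \<Longrightarrow> f - g \<in> trunc I n"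
  by (simp add: trunc_def I_diff polys_in_diff)

abbreviation coset :: "nat \<Rightarrow> 'k inf_poly \<Rightarrow> 'k inf_poly set" where
  "coset n f \<equiv> trunc I n +>\<^bsub>poly_ring n\<^esub> f"

lemma mem_coset: "g \<in> coset n f \<longleftrightarrow> g - f \<in> trunc I n"
  by (auto simp: a_r_coset_def' algebra_simps) (metis add.commute diff_add_cancel)

lemma coset_eq_iff: "coset n f = coset n g \<longleftrightarrow> f - g \<in> trunc I n" if "f \<in> polys_in n" "g \<in> polys_in n"
proof
  assume "coset n f = coset n g"
  moreover have "f - f \<in> trunc I n" by (simp add: trunc_def I_0 polys_in_0)
  then have "f \<in> coset n f" by (simp only: mem_coset)
  ultimately show "f - g \<in> trunc I n" by (simp add: mem_coset)
next
  assume fg: "f - g \<in> trunc I n"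
  have "h - f \<in> trunc I n \<longleftrightarrow> h - g \<in> trunc I n" for h
  proof
    assume "h - f \<in> trunc I n"
    then have "(h - f) + (f - g) \<in> trunc I n" using fg by (rule trunc_add)
    then show "h - g \<in> trunc I n" by simp
  next
    assume "h - g \<in> trunc I n"
    then have "(h - g) - (f - g) \<in> trunc I n" using fg by (rule trunc_diff)
    then show "h - f \<in> trunc I n" by simp
  qed
  then show "coset n f = coset n g" by (auto simp: mem_coset)
qed

lemma ring_quot: "ring (quot I n)"
  unfolding quot_def by (rule ideal.quotient_is_ring[OF ideal_trunc])

lemma coset_hom: "coset n \<in> ring_hom (poly_ring n) (quot I n)"
  unfolding quot_def by (rule ideal.rcos_ring_hom[OF ideal_trunc])

lemma carrier_quot: "carrier (quot I n) = coset n ` polys_in n"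
  by (auto simp: quot_def FactRing_def A_RCOSETS_def' a_r_coset_def')

lemma zero_quot: "\<zero>\<^bsub>quot I n\<^esub> = coset n 0"
proof -
  have "trunc I n = coset n 0" by (auto simp: mem_coset)
  then show ?thesis by (simp add: quot_def FactRing_def)
qed

lemma coset_in_carrier: "f \<in> polys_in n \<Longrightarrow> coset n f \<in> carrier (quot I n)"
  by (simp add: carrier_quot)

lemma coset_mult: "f \<in> polys_in n \<Longrightarrow> g \<in> polys_in n \<Longrightarrow> coset n f \<otimes>\<^bsub>quot I n\<^esub> coset n g = coset n (f * g)"
  using ring_hom_mult[OF coset_hom, of f n g] by simp

lemma coset_add: "f \<in> polys_in n \<Longrightarrow> g \<in> polys_in n \<Longrightarrow> coset n f \<oplus>\<^bsub>quot I n\<^esub> coset n g = coset n (f + g)"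
  using ring_hom_add[OF coset_hom, of f n g] by simp

text \<open>The constants form a subfield of \<open>poly_ring n\<close>, and its image under a ring
  homomorphism is a subfield once the target is not the zero ring.\<close>

lemma subfield_scalars:
  assumes "1 \<notin> I" shows "subfield (scalars I n) (quot I n)"
proof -
  interpret ring_hom_ring "poly_ring n" "quot I n" "coset n"
    using ideal.rcos_ring_hom_ring[OF ideal_trunc] by (simp add: quot_def)
  have "\<one>\<^bsub>quot I n\<^esub> = coset n 1" using ring_hom_one[OF coset_hom, of n] by simp
  moreover have "coset n 1 \<noteq> coset n 0"
    using assms by (subst coset_eq_iff) (simp_all add: polys_in_1 polys_in_0 trunc_def)
  ultimately have "\<one>\<^bsub>quot I n\<^esub> \<noteq> \<zero>\<^bsub>quot I n\<^esub>" by (simp add: zero_quot)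
  from img_is_subfield(2)[OF subfield_const this] show ?thesis
    by (simp add: scalars_def image_image)
qed

lemma combine_cosets:
  assumes "set fs \<subseteq> polys_in n"
  shows "ring.combine (quot I n) (map (\<lambda>c. coset n (const c)) cs) (map (coset n) fs) = coset n (lin_comb cs fs)"
proof -
  interpret Q: ring "quot I n" by (rule ring_quot)
  show ?thesis using assms
  proof (induction fs arbitrary: cs)
    case (Cons f fs)
    show ?case
    proof (cases cs)
      case (Cons c cs')
      have "lin_comb cs' fs \<in> polys_in n"
        by (rule lin_comb_induct)
          (use Cons.prems in \<open>auto intro!: polys_in_add polys_in_mult polys_in_const simp: polys_in_0\<close>)
      then show ?thesis
        using Cons.prems Cons.IH[of cs'] \<open>cs = c # cs'\<close>
        by (simp add: coset_mult coset_add polys_in_const polys_in_mult)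
    qed (simp add: zero_quot)
  qed (simp add: zero_quot)
qed

end

lemma coef_lin_comb:
  assumes "distinct ms" "\<And>\<mu> \<nu>. \<mu> \<in> set ms \<Longrightarrow> coef (b \<mu>) \<nu> = (if \<nu> = \<mu> then r else 0)"
  shows "i < length cs \<Longrightarrow> i < length ms \<Longrightarrow> coef (lin_comb cs (map b ms)) (ms ! i) = cs ! i * r"
    and "\<nu> \<notin> set ms \<Longrightarrow> coef (lin_comb cs (map b ms)) \<nu> = 0"
proof -
  have out: "\<nu> \<notin> set ms \<Longrightarrow> coef (lin_comb cs (map b ms)) \<nu> = 0"
    if "\<And>\<mu> \<nu>. \<mu> \<in> set ms \<Longrightarrow> coef (b \<mu>) \<nu> = (if \<nu> = \<mu> then r else 0)" for cs ms \<nu>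
    using that
  proof (induction ms arbitrary: cs)
    case (Cons \<mu> ms)
    then show ?case by (cases cs) (simp_all add: coef_add coef_const_mult)
  qed simp
  then show "\<nu> \<notin> set ms \<Longrightarrow> coef (lin_comb cs (map b ms)) \<nu> = 0" using assms(2) .
  show "i < length cs \<Longrightarrow> i < length ms \<Longrightarrow> coef (lin_comb cs (map b ms)) (ms ! i) = cs ! i * r"
    using assms
  proof (induction ms arbitrary: cs i)
    case (Cons \<mu> ms)
    obtain c cs' where cs: "cs = c # cs'" using Cons.prems(1) by (cases cs) auto
    have b: "coef (b \<kappa>) \<nu> = (if \<nu> = \<kappa> then r else 0)" if "\<kappa> \<in> set ms" for \<kappa> \<nu>
      using Cons.prems(4) that by simp
    show ?case
    proof (cases i)
      case 0
      have "\<mu> \<notin> set ms" using Cons.prems(3) by simp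
      then show ?thesis using out[OF b, of ms \<mu> cs'] Cons.prems(4)[of \<mu> \<mu>]
        by (simp add: cs 0 coef_add coef_const_mult)
    next
      case (Suc j)
      have "ms ! j \<noteq> \<mu>" using Cons.prems(2,3) Suc by auto
      then show ?thesis using Cons.IH[of j cs'] Cons.prems b Suc
        by (simp add: cs coef_add coef_const_mult)
    qed
  qed simp
qed

lemma lin_comb_map_distinct:
  "distinct ms \<Longrightarrow> lin_comb (map c ms) (map b ms) = (\<Sum>\<mu>\<in>set ms. const (c \<mu>) * b \<mu>)"
  by (induction ms) simp_all

context sym_hom_ideal
begin

text \<open>The symmetrized monomials \<open>b \<mu>\<close>, one for each nonleading
  \<open>\<mu>\<close> of degree \<open>d\<close>, give a basis of the invariants. Independence is
  \<open>nonleading_coef_unique\<close>. For spanning, an invariant class is up to n! the class of a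
  symmetrization, which depends only on coordinates, and these can be reduced to nonleading ones. By
  \<open>d \<le> n\<close> every partition of \<open>d\<close> has a monomial in \<open>n\<close>
  variables.\<close>

lemma card_standard_eq_dim:
  assumes red: "\<And>f. f \<in> polys_in n \<Longrightarrow> homogeneous d f \<Longrightarrow>
     \<exists>h\<in>I. h \<in> polys_in n \<and> homogeneous d h \<and> (\<forall>\<nu>\<in>leading k. coef (f - h) \<nu> = 0)"
    and dn: "d \<le> n" and one: "1 \<notin> I"
  shows "ring.dim (quot I n) (scalars I n) (quot_invariants I n \<inter> quot_graded I n d)
    = card {\<mu> \<in> standard k. sum_mset \<mu> = d}"
proof -
  interpret Q: ring "quot I n" by (rule ring_quot)
  note K = subfield_scalars[OF one, of n]
  define S where "S = {\<mu> \<in> standard k. sum_mset \<mu> = d}"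
  have finS: "finite S"
    by (rule finite_subset[OF _ finite_partitions[of d]]) (auto simp: S_def standard_def)
  obtain ms where ms: "set ms = S" "distinct ms" using finite_distinct_list[OF finS] by blast
  have "\<exists>m. keys m \<subseteq> {..<n} \<and> shape m = \<mu>" if "\<mu> \<in> S" for \<mu>
  proof -
    have "0 \<notin># \<mu>" "sum_mset \<mu> = d" using that by (auto simp: S_def standard_def)
    then have "size \<mu> \<le> n" using size_le_sum_mset[of \<mu>] dn by simp
    then have n: "{..<size \<mu>} \<subseteq> {..<n}" by simp
    obtain m where m: "keys m \<subseteq> {..<size \<mu>}" "shape m = \<mu>"
      using ex_mon_shape[OF \<open>0 \<notin># \<mu>\<close>] by blast
    show ?thesis using order_trans[OF m(1) n] m(2) by blast
  qed
  then obtain rep where rep: "\<And>\<mu>. \<mu> \<in> S \<Longrightarrow> keys (rep \<mu>) \<subseteq> {..<n}" "\<And>\<mu>. \<mu> \<in> S \<Longrightarrow> shape (rep \<mu>) = \<mu>"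
    by metis
  define b where "b \<mu> = symmetrize n (mon (rep \<mu>) 1 :: 'k inf_poly)" for \<mu>
  have b_in: "b \<mu> \<in> polys_in n" if "\<mu> \<in> S" for \<mu>
    unfolding b_def by (intro polys_in_symmetrize polys_in_mon rep(1) that)
  have b_hom: "homogeneous d (b \<mu>)" if "\<mu> \<in> S" for \<mu>
    unfolding b_def
    by (rule homogeneous_symmetrize) (use rep(2)[OF that] that in \<open>simp add: homogeneous_iff_shape S_def\<close>)
  have b_coef: "coef (b \<mu>) \<nu> = (if \<nu> = \<mu> then fact n else 0)" if "\<mu> \<in> S" for \<mu> \<nu>
    using rep(2)[OF that] by (auto simp: b_def coef_symmetrize coef_mon)
  define Us where "Us = map (coset n) (map b ms)"
  have bms: "set (map b ms) \<subseteq> polys_in n" using b_in ms(1) by auto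
  have Us_in: "set Us \<subseteq> carrier (quot I n)"
    using bms coset_in_carrier unfolding Us_def by auto
  have comb: "Q.combine (map (\<lambda>c. coset n (const c)) cs) Us = coset n (lin_comb cs (map b ms))" for cs
    unfolding Us_def by (rule combine_cosets[OF bms])
  have Ks: "\<exists>cs. Ks = map (\<lambda>c. coset n (const c)) cs" if "set Ks \<subseteq> scalars I n" for Ks
    using that unfolding ex_map_conv scalars_def by blast
  have w_in: "lin_comb cs (map b ms) \<in> polys_in n" for cs
    by (rule lin_comb_induct) (use bms in \<open>auto intro!: polys_in_add polys_in_mult polys_in_const simp: polys_in_0\<close>)
  have indep: "Q.independent (scalars I n) Us"
  proof (rule Q.trivial_combine_imp_independent[OF K Us_in])
    fix Ks assume Ks': "set Ks \<subseteq> scalars I n" and 0: "Q.combine Ks Us = \<zero>\<^bsub>quot I n\<^esub>"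
    obtain cs where cs: "Ks = map (\<lambda>c. coset n (const c)) cs" using Ks[OF Ks'] by blast
    define w where "w = lin_comb cs (map b ms)"
    have "coset n w = coset n 0" using 0 unfolding cs comb zero_quot w_def .
    then have "w - 0 \<in> trunc I n" using coset_eq_iff[OF w_in[of cs] polys_in_0] unfolding w_def by blast
    then have wI: "w \<in> I" by (simp add: trunc_def)
    have "coef w \<nu> = 0" if "\<nu> \<in> leading k" for \<nu>
    proof -
      have "\<nu> \<notin> S" using that by (simp add: S_def standard_def)
      then show ?thesis unfolding w_def by (intro coef_lin_comb(2)[OF ms(2)]) (auto simp: ms(1) b_coef)
    qed
    then have w0: "coef w \<nu> = 0" for \<nu> by (rule nonleading_coef_unique[OF wI])
    have "cs ! i = 0" if "i < length cs" "i < length ms" for i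
    proof -
      have "coef w (ms ! i) = cs ! i * fact n"
        unfolding w_def by (rule coef_lin_comb(1)[OF ms(2) _ that]) (simp add: ms(1) b_coef)
      then show ?thesis using w0[of "ms ! i"] by simp
    qed
    then show "set (take (length Us) Ks) \<subseteq> {\<zero>\<^bsub>quot I n\<^esub>}"
      by (auto simp: cs Us_def in_set_conv_nth zero_quot)
  qed
  have span: "Q.Span (scalars I n) Us = quot_invariants I n \<inter> quot_graded I n d"
  proof (intro equalityI subsetI)
    fix C assume "C \<in> Q.Span (scalars I n) Us"
    then obtain cs where C: "C = coset n (lin_comb cs (map b ms))"
      unfolding Q.Span_eq_combine_set[OF K Us_in] using Ks comb by blast
    define w where "w = lin_comb cs (map b ms)"
    have hom: "homogeneous d w"
      unfolding w_def by (rule lin_comb_induct)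
        (use b_hom ms(1) in \<open>auto intro!: homogeneous_add homogeneous_const_mult simp: homogeneous_0\<close>)
    have inv: "perm_poly \<sigma> w = w" if \<sigma>: "\<sigma> \<in> Sym n" for \<sigma>
      unfolding w_def
    proof (rule lin_comb_induct)
      show "perm_poly \<sigma> 0 = (0 :: 'k inf_poly)"
        by (simp add: perm_poly_eq_sum)
      fix c and f g :: "'k inf_poly" assume f: "f \<in> set (map b ms)" and g: "perm_poly \<sigma> g = g"
      have "perm_poly \<sigma> f = f" using f perm_poly_symmetrize[OF \<sigma>] by (auto simp: b_def)
      moreover have "perm_poly \<sigma> (const c * f) = const c * perm_poly \<sigma> f"
        by (rule poly_mapping_eqI) (simp add: lookup_perm_poly[OF Sym_bij[OF \<sigma>]])
      ultimately show "perm_poly \<sigma> (const c * f + g) = const c * f + g"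
        using g by (simp add: perm_poly_add[OF Sym_bij[OF \<sigma>]])
    qed
    have sub: "perm_poly \<sigma> ` coset n w \<subseteq> coset n w" if \<sigma>: "\<sigma> \<in> Sym n" for \<sigma>
    proof
      fix y assume "y \<in> perm_poly \<sigma> ` coset n w"
      then obtain z where z: "z - w \<in> trunc I n" "y = perm_poly \<sigma> z" by (auto simp: mem_coset)
      have "perm_poly \<sigma> (z - w + w) = perm_poly \<sigma> (z - w) + perm_poly \<sigma> w"
        by (rule perm_poly_add[OF Sym_bij[OF \<sigma>]])
      then have "y - w = perm_poly \<sigma> (z - w)" using z(2) inv[OF \<sigma>] by simp
      moreover have "perm_poly \<sigma> (z - w) \<in> trunc I n"
        using z(1) polys_in_perm_poly[OF \<sigma>] I_perm subsetD[OF Sym_subset_Sym_inf \<sigma>] by (auto simp: trunc_def)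
      ultimately show "y \<in> coset n w" by (simp add: mem_coset)
    qed
    have "perm_poly \<sigma> ` coset n w = coset n w" if \<sigma>: "\<sigma> \<in> Sym n" for \<sigma>
    proof (rule equalityI[OF sub[OF \<sigma>]], rule subsetI)
      fix y assume "y \<in> coset n w"
      then have "perm_poly (inv_into UNIV \<sigma>) y \<in> coset n w" using sub[OF Sym_inv[OF \<sigma>]] by blast
      then have "perm_poly \<sigma> (perm_poly (inv_into UNIV \<sigma>) y) \<in> perm_poly \<sigma> ` coset n w" by (rule imageI)
      then show "y \<in> perm_poly \<sigma> ` coset n w" by (simp add: perm_poly_inv[OF Sym_bij[OF \<sigma>]])
    qed
    then have "C \<in> quot_invariants I n"
      unfolding quot_invariants_def using C coset_in_carrier[OF w_in] by (simp add: w_def)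
    moreover have "C \<in> quot_graded I n d"
      unfolding quot_graded_def using C w_in hom by (auto simp: w_def)
    ultimately show "C \<in> quot_invariants I n \<inter> quot_graded I n d" by blast
  next
    fix C assume "C \<in> quot_invariants I n \<inter> quot_graded I n d"
    then obtain f where f: "C = coset n f" "f \<in> polys_in n" "homogeneous d f"
      and inv: "\<And>\<sigma>. \<sigma> \<in> Sym n \<Longrightarrow> perm_poly \<sigma> ` C = C"
      unfolding quot_invariants_def quot_graded_def by blast
    \<comment> \<open>Invariance of the coset says that every
      \<open>perm_poly \<sigma> f - f\<close> lies in \<open>I\<close>; summing over
      \<open>Sym n\<close> gives the claim.\<close>
    have sym: "symmetrize n f - const (fact n) * f \<in> I"
    proof -
      have "perm_poly \<sigma> f - f \<in> I" if "\<sigma> \<in> Sym n" for \<sigma>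
      proof -
        have "f - f \<in> trunc I n" by (simp add: trunc_def I_0 polys_in_0)
        then have "f \<in> C" unfolding f(1) mem_coset .
        then have "perm_poly \<sigma> f \<in> C" using inv[OF that] by blast
        then show ?thesis unfolding f(1) mem_coset by (simp add: trunc_def)
      qed
      then have "(\<Sum>\<sigma>\<in>Sym n. perm_poly \<sigma> f - f) \<in> I" by (rule I_sum)
      moreover have "(\<Sum>\<sigma>\<in>Sym n. perm_poly \<sigma> f - f) = symmetrize n f - const (fact n) * f"
      proof -
        have "const (of_nat (fact n) :: 'k) = of_nat (fact n)"
          by (simp only: const_def single_of_nat)
        then have "const (fact n :: 'k) = fact n" by simp
        then show ?thesis by (simp add: sum_subtractf symmetrize_def card_Sym)
      qed
      ultimately show ?thesis by simp
    qed
    obtain h where h: "h \<in> I" "h \<in> polys_in n" "homogeneous d h" "\<And>\<nu>. \<nu> \<in> leading k \<Longrightarrow> coef (f - h) \<nu> = 0"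
      using red[OF f(2,3)] by blast
    \<comment> \<open>\<open>e\<close> compares the reduced \<open>f - h\<close> with the
      combination of representatives that has the same coordinates, so its symmetrization
      vanishes.\<close>
    define e where "e = (f - h) - (\<Sum>\<mu>\<in>S. const (coef (f - h) \<mu>) * mon (rep \<mu>) 1)"
    have hom: "homogeneous d (f - h)"
      using homogeneous_add[OF f(3) homogeneous_uminus[OF h(3)]] by simp
    have "coef e \<nu> = 0" for \<nu>
    proof -
      have "coef e \<nu> = coef (f - h) \<nu> - (\<Sum>\<mu>\<in>S. if \<mu> = \<nu> then coef (f - h) \<mu> else 0)"
        unfolding e_def coef_diff[of "f - h"] coef_sum
        by (rule arg_cong[where f = "\<lambda>x. coef (f - h) \<nu> - x"], rule sum.cong[OF refl])
          (simp add: coef_const_mult coef_mon rep(2))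
      also have "\<dots> = 0"
      proof (cases "\<nu> \<in> S")
        case False
        have "coef (f - h) \<nu> = 0"
        proof (rule ccontr)
          assume nz: "coef (f - h) \<nu> \<noteq> 0"
          then have "\<nu> \<notin> leading k" using h(4) by blast
          moreover have "sum_mset \<nu> = d" by (rule coef_homogeneous[OF hom nz])
          moreover have "0 \<notin># \<nu>" using nz by (rule coef_nonzeroE) (use zero_notin_shape in blast)
          ultimately show False using False by (simp add: S_def standard_def)
        qed
        then show ?thesis using False finS by simp
      qed (use finS in simp)
      finally show ?thesis .
    qed
    moreover have "e \<in> polys_in n"
      unfolding e_def
      by (intro polys_in_diff polys_in_sum polys_in_mult polys_in_const polys_in_mon rep(1) f(2) h(2))
    ultimately have "symmetrize n e = 0" by (intro symmetrize_eq_0)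
    then have symf: "symmetrize n f - symmetrize n h = (\<Sum>\<mu>\<in>S. const (coef (f - h) \<mu>) * b \<mu>)"
      unfolding e_def b_def by (simp add: symmetrize_diff symmetrize_sum symmetrize_const_mult)
    define c where "c \<mu> = coef (f - h) \<mu> / fact n" for \<mu>
    define w where "w = lin_comb (map c ms) (map b ms)"
    have inv_fact: "const (inverse (fact n)) * (const (fact n) * y) = y" for y :: "'k inf_poly"
      unfolding mult.assoc[symmetric] const_mult[symmetric] by simp
    have w: "w = const (inverse (fact n)) * (\<Sum>\<mu>\<in>S. const (coef (f - h) \<mu>) * b \<mu>)"
      unfolding w_def lin_comb_map_distinct[OF ms(2)] ms(1) sum_distrib_left
      by (rule sum.cong[OF refl]) (simp add: c_def field_simps const_mult mult.assoc[symmetric] flip: const_mult)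
    \<comment> \<open>After division by n!, what remains of \<open>w - f\<close> is the invariance
      error \<open>sym\<close> and the symmetrization of \<open>h\<close>, both in
      \<open>I\<close>.\<close>
    have "w - f = const (inverse (fact n)) * ((symmetrize n f - const (fact n) * f) - symmetrize n h)"
      unfolding w symf[symmetric] by (simp add: right_diff_distrib inv_fact)
    also have "\<dots> \<in> I" by (rule I_mult_left, rule I_diff[OF sym], rule I_symmetrize[OF h(1)])
    finally have "w - f \<in> trunc I n" using w_in f(2) by (simp add: trunc_def w_def polys_in_diff)
    then have "coset n w = C" using w_in f(2) unfolding f(1) by (subst coset_eq_iff) (simp_all add: w_def)
    then have "C = Q.combine (map (\<lambda>c. coset n (const c)) (map c ms)) Us"
      by (simp only: comb w_def)
    moreover have "set (map (\<lambda>c. coset n (const c)) (map c ms)) \<subseteq> scalars I n"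
      by (auto simp: scalars_def)
    ultimately show "C \<in> Q.Span (scalars I n) Us"
      unfolding Q.Span_eq_combine_set[OF K Us_in] by blast
  qed
  have "Q.dimension (length Us) (scalars I n) (quot_invariants I n \<inter> quot_graded I n d)"
    by (rule Q.dimensionI[OF K indep span])
  then have "Q.dim (scalars I n) (quot_invariants I n \<inter> quot_graded I n d) = length Us"
    using Q.dimI[OF K] unfolding over_def by blast
  also have "length Us = card S" using ms distinct_card[OF ms(2)] by (simp add: Us_def)
  finally show ?thesis by (simp add: S_def)
qed

text \<open>Here the quotient is the zero ring and the scalars are no subfield, so the dimension is
  read off its inductive definition.\<close>

lemma dim_unit_ideal:
  assumes one: "1 \<in> I"
  shows "ring.dim (quot I n) (scalars I n) (quot_invariants I n \<inter> quot_graded I n d) = 0"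
    and "standard k = {}"
proof -
  interpret Q: ring "quot I n" by (rule ring_quot)
  have all: "f \<in> I" for f using I_mult_left[OF one, of f] by simp
  have car: "carrier (quot I n) = {\<zero>\<^bsub>quot I n\<^esub>}"
    unfolding carrier_quot zero_quot using coset_eq_iff[of _ n 0] polys_in_0
    by (auto simp: trunc_def all polys_in_diff)
  have E: "quot_invariants I n \<inter> quot_graded I n d = {\<zero>\<^bsub>quot I n\<^esub>}"
  proof (intro equalityI subsetI)
    fix C assume "C \<in> quot_invariants I n \<inter> quot_graded I n d"
    then show "C \<in> {\<zero>\<^bsub>quot I n\<^esub>}" using car by (auto simp: quot_invariants_def)
  next
    fix C assume "C \<in> {\<zero>\<^bsub>quot I n\<^esub>}"
    then have C: "C = coset n 0" by (simp add: zero_quot)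
    have "f \<in> coset n 0 \<longleftrightarrow> f \<in> polys_in n" for f
      unfolding mem_coset by (simp add: trunc_def all)
    then have P: "coset n 0 = polys_in n" by blast
    have "perm_poly \<sigma> ` polys_in n = (polys_in n :: 'k inf_poly set)" if \<sigma>: "\<sigma> \<in> Sym n" for \<sigma>
    proof (intro equalityI subsetI)
      fix y :: "'k inf_poly" assume "y \<in> polys_in n"
      then have "perm_poly (inv_into UNIV \<sigma>) y \<in> polys_in n" by (rule polys_in_perm_poly[OF Sym_inv[OF \<sigma>]])
      then have "perm_poly \<sigma> (perm_poly (inv_into UNIV \<sigma>) y) \<in> perm_poly \<sigma> ` polys_in n" by (rule imageI)
      then show "y \<in> perm_poly \<sigma> ` polys_in n" by (simp add: perm_poly_inv[OF Sym_bij[OF \<sigma>]])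
    qed (use polys_in_perm_poly[OF \<sigma>] in blast)
    moreover have "polys_in n \<in> carrier (quot I n)"
      unfolding P[symmetric] by (rule coset_in_carrier[OF polys_in_0])
    ultimately have "C \<in> quot_invariants I n"
      unfolding quot_invariants_def using C P by simp
    moreover have "C \<in> quot_graded I n d"
      unfolding quot_graded_def using C polys_in_0 homogeneous_0 by blast
    ultimately show "C \<in> quot_invariants I n \<inter> quot_graded I n d" by blast
  qed
  \<comment> \<open>An extension step needs a vector outside the current space, and the carrier has
    nothing besides zero.\<close>
  have "m = 0 \<and> A = {\<zero>\<^bsub>quot I n\<^esub>}" if "Q.dimension m (scalars I n) A" for m A
    using that by (induction rule: Q.dimension.induct) (use car in auto)
  then have "(THE m. Q.dimension m (scalars I n) {\<zero>\<^bsub>quot I n\<^esub>}) = 0"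
    by (intro the_equality) auto
  then show "Q.dim (scalars I n) (quot_invariants I n \<inter> quot_graded I n d) = 0"
    by (simp add: Q.dim_def E)
  have "\<mu> \<in> leading k" if \<mu>: "0 \<notin># \<mu>" for \<mu>
  proof -
    obtain m where m: "shape m = \<mu>" using ex_mon_shape[OF \<mu>] by blast
    show ?thesis by (rule leadingI[of "mon m 1"]) (auto simp: all coef_mon m split: if_splits)
  qed
  then show "standard k = {}" by (auto simp: standard_def)
qed

text \<open>Each coefficient is eventually constant, from \<open>max n0 d\<close> on.
  \<open>k\<close> is arbitrary here: the order affects which partitions are nonleading, but not how
  many there are in each degree.\<close>

theorem hilbert_series_limit:
  "(\<lambda>n. fps_nth (hilbert_series_invariants I n) d) \<longlonglongrightarrow> fps_nth (gf sum_mset (standard k)) d"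
proof -
  obtain n0 where n0: "\<And>n f. n0 \<le> n \<Longrightarrow> f \<in> polys_in n \<Longrightarrow> homogeneous d f \<Longrightarrow>
     \<exists>h\<in>I. h \<in> polys_in n \<and> homogeneous d h \<and> (\<forall>\<nu>\<in>leading k. coef (f - h) \<nu> = 0)"
    using reduce_leading[of d k] by blast
  have "fps_nth (hilbert_series_invariants I n) d = fps_nth (gf sum_mset (standard k)) d"
    if "max n0 d \<le> n" for n
  proof (cases "1 \<in> I")
    case True
    then show ?thesis by (simp add: hilbert_series_invariants_def dim_unit_ideal)
  next
    case False
    then show ?thesis
      using card_standard_eq_dim[of n d k, OF n0 _ False] that
      by (simp add: hilbert_series_invariants_def gf_nth)
  qed
  then have "\<forall>\<^sub>F n in sequentially. fps_nth (hilbert_series_invariants I n) d = fps_nth (gf sum_mset (standard k)) d"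
    unfolding eventually_sequentially by blast
  then show ?thesis by (rule tendsto_eventually)
qed

end

theorem corollary1p2:
  fixes I :: "'k::field_char_0 inf_poly set"
  assumes "homogeneous_ideal I"
    and "symmetric_ideal I"
    and "uncountable (UNIV :: 'k alg_closure set)"
    and "\<exists>p q. p > 0 \<and> q > 0 \<and> zero_locus I \<subseteq> Delta_set p \<union> H_set q"
  shows "\<exists>F. (\<forall>d. (\<lambda>n. fps_nth (hilbert_series_invariants I n) d) \<longlonglongrightarrow> fps_nth F d) \<and>
             rational_fps F"
proof -
  interpret J: ideal I "ring_of_type_algebra :: 'k inf_poly ring"
    using assms(1) by (simp add: homogeneous_ideal_def)
  interpret sym_hom_ideal I
  proof
    show "0 \<in> I"
      using additive_subgroup.zero_closed[OF J.additive_subgroup_axioms]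
      by (simp add: ring_of_type_algebra_def)
    show "f + g \<in> I" if "f \<in> I" "g \<in> I" for f g
      using additive_subgroup.a_closed[OF J.additive_subgroup_axioms that] by (simp add: ring_of_type_algebra_def)
    show "f * g \<in> I" if "f \<in> I" for f g
      using J.I_r_closed[OF that, of g] by (simp add: ring_of_type_algebra_def)
    show "perm_poly \<sigma> f \<in> I" if "\<sigma> \<in> Sym_inf" "f \<in> I" for \<sigma> f
      using assms(2) that by (simp add: symmetric_ideal_def)
    show "homogeneous_part d f \<in> I" if "f \<in> I" for d f
      using assms(1) that by (simp add: homogeneous_ideal_def)
  qed
  obtain p q where pq: "p > 0" "zero_locus I \<subseteq> Delta_set p \<union> H_set q" using assms(4) by blast
  \<comment> \<open>The exponent supplied by the Nullstellensatz now fixes the order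
    \<open>below k\<close> in which leading partitions are taken.\<close>
  obtain k where k: "k > 0" "(var 0 ^ p - var 1 ^ p) ^ k * (\<Prod>l<Suc q. var (l + 2) ^ k) \<in> I"
    by (rule Delta_H_power_mem[OF assms(3) is_ideal_I pq(2)])
  have "rational_fps (gf sum_mset (standard k))"
    by (rule rational_gf_standard[OF k(2) pq(1) k(1)])
  then show ?thesis using hilbert_series_limit by blast
qed

end
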